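(* Let the chance-constrained problem $Z^\star(\theta)=\min\{\boldsymbol c^\top\boldsymbol x:\boldsymbol x\in P(\theta)\}$ with Gaussian mixture data be as in the context, suppose Assumptions 1-4 listed there hold, and let $\boldsymbol x^*(\theta')$ denote an optimal solution of the problem with probability level $\theta'$. There is an absolute constant $C>0$ such that for every user-specified tolerance $\hat\tau>0$ there exist $\tau$ with $0<\tau\le\hat\tau$ and $\tau<1$, and valid arrays of breakpoints for the outer and for the inner approximation problem, each having at most $C\sqrt{\tfrac1\tau\log\tfrac1\tau}$ breakpoints, such that the resulting outer and inner approximation problems have optimal solutions $\boldsymbol x^{\mathrm{OA}}$ and $\boldsymbol x^{\mathrm{IA}}$ (the $\boldsymbol x$-components), respectively, that are $\hat\tau$-optimal for the chance-constrained problem at level $\theta$, and $$|\boldsymbol c^\top\boldsymbol x^{\mathrm{IA}}-\boldsymbol c^\top\boldsymbol x^{\mathrm{OA}}|\le|\boldsymbol c^\top\boldsymbol x^*(\theta+\tau)-\boldsymbol c^\top\boldsymbol x^*(\theta-\tau)|\le\hat\tau .$$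
   Context: Problem. $\boldsymbol c\in\mathbb R^n$, $b\in\mathbb R$, $\theta\in(0,1)$, and $\mathcal X=\{\boldsymbol x\in\mathbb R^n:\boldsymbol H\boldsymbol x=\boldsymbol h,\ \boldsymbol A\boldsymbol x\ge\boldsymbol d\}$ is compact. The random vector $\boldsymbol\xi\in\mathbb R^n$ has a Gaussian mixture distribution with density $\sum_{k=1}^K w_k\,\mathcal N(\cdot\mid\boldsymbol\mu_k,\boldsymbol\Sigma_k)$, where $w_k\ge0$, $\sum_k w_k=1$. Let $p(\boldsymbol x)=\mathbb P[\boldsymbol\xi^\top\boldsymbol x\le b]=\sum_{k=1}^K w_kp_k(\boldsymbol x)$, where $p_k(\boldsymbol 0)=1$ if $b\ge0$ and $0$ if $b<0$, and $p_k(\boldsymbol x)=\Phi\big((b-\boldsymbol\mu_k^\top\boldsymbol x)/\sqrt{\boldsymbol x^\top\boldsymbol\Sigma_k\boldsymbol x}\big)$ for $\boldsymbol x\ne\boldsymbol 0$; $\Phi,\phi$ are the standard normal CDF and density. Let $P(\theta')=\{\boldsymbol x\in\mathcal X:p(\boldsymbol x)\ge\theta'\}$ and $Z^\star(\theta')=\min\{\boldsymbol c^\top\boldsymbol x:\boldsymbol x\in P(\theta')\}$. Assumption 1: every $\boldsymbol\Sigma_k$ is positive definite. Assumption 2: there is $\rho>0$ such that $P(\theta')\neq\emptyset$ for all $\theta'\in[\theta-\rho,\theta+\rho]$. Assumption 3: if $b=0$, then there is $\hat\delta>0$ with $P(\theta)\cap\{\boldsymbol x:\|\boldsymbol x\|\le\hat\delta\}=\emptyset$.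 Assumption 4: the linear independence constraint qualification holds at every optimal solution of the problem at level $\theta$, i.e. the gradients of the equality constraints $\boldsymbol H\boldsymbol x=\boldsymbol h$ and of those constraints among $\boldsymbol A\boldsymbol x\ge\boldsymbol d$, $p(\boldsymbol x)\ge\theta$ that are active there are linearly independent. $\hat\tau$-optimality. $\hat{\boldsymbol x}$ is $\hat\tau$-feasible if $\boldsymbol H\hat{\boldsymbol x}=\boldsymbol h$, $\boldsymbol A\hat{\boldsymbol x}\ge\boldsymbol d$, $p(\hat{\boldsymbol x})\ge\theta-\hat\tau$; it is $\hat\tau$-optimal if it is $\hat\tau$-feasible and $|\boldsymbol c^\top\boldsymbol x^*(\theta)-\boldsymbol c^\top\hat{\boldsymbol x}|\le\hat\tau$. Approximations. $[m]=\{1,\dots,m\}$, $[m]_0=\{0,\dots,m\}$. A valid array of breakpoints is $\check{\boldsymbol z}=(\check z_{-L},\dots,\check z_R)$, $L,R>0$ integers, with $-\infty<\check z_{-L}<\dots<\check z_{-1}<\check z_0=0<\check z_1<\dots<\check z_R<\infty$; it has $L+R+1$ breakpoints. Let $\ell_u(z)=\Phi(u)+\phi(u)(z-u)$ be the tangent of $\Phi$ at $u$ and $s_{u,v}(z)=\Phi(u)+\frac{\Phi(v)-\Phi(u)}{v-u}(z-u)$ the secant through $u<v$. Define $$\bar\Phi(z;\check{\boldsymbol z})=\begin{cases}\min\{1,\min_{i\in[R]_0}\ell_{\check z_i}(z)\},&z\ge0\\ \max\{\Phi(\check z_{-L}),\max_{i\in[L]}s_{\check z_{-i},\check z_{-i+1}}(z)\},&z<0\end{cases}$$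 $$\underline\Phi(z;\check{\boldsymbol z})=\begin{cases}\min\{\Phi(\check z_R),\min_{i\in[R]}s_{\check z_{i-1},\check z_i}(z)\},&z\ge0\\ \max\{0,\max_{i\in[L]_0}\ell_{\check z_{-i}}(z)\},&z<0.\end{cases}$$ The outer approximation problem is: minimize $\boldsymbol c^\top\boldsymbol x$ over $\boldsymbol x\in\mathcal X$, $\boldsymbol z\in\mathbb R^K$, $\boldsymbol\zeta\in[0,1]^K$, $\boldsymbol\lambda\in\mathbb R^K_+$ subject to $\sum_{k=1}^K w_k\zeta_k\ge\theta$ and, for each $k\in[K]$, $\bar\Phi(z_k;\check{\boldsymbol z})\ge\zeta_k$, $b-\boldsymbol x^\top\boldsymbol\mu_k\ge z_k\lambda_k$, $\boldsymbol x^\top\boldsymbol\Sigma_k\boldsymbol x=\lambda_k^2$. The inner approximation problem is the same with $\underline\Phi$ in place of $\bar\Phi$. *)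

theory Defs
  imports
    "HOL-Probability.Probability"
    "Jordan_Normal_Form.Determinant"
    "Jordan_Normal_Form.Gauss_Jordan_Elimination"
    "Jordan_Normal_Form.VS_Connect"
begin

unbundle no vec_syntax and no inner_syntax
hide_type (open) Finite_Cartesian_Product.vec
hide_const (open) Finite_Cartesian_Product.vec Finite_Cartesian_Product.row
  Finite_Cartesian_Product.rows Determinants.det

text \<open>
  The dimension \<open>n\<close> has to be an ordinary natural number: the constant of the main result is
  independent of all problem data, \<open>n\<close> included, so \<open>n\<close> is quantified inside the scope of an
  existential quantifier.  Hence vectors and matrices are those of \<^theory>\<open>Jordan_Normal_Form.Matrix\<close>,
  which carry their dimensions as values; indices start at \<open>0\<close>.
\<close>

section \<open>The Euclidean space \<open>carrier_vec n\<close>\<close>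

definition vnorm :: "real vec \<Rightarrow> real" where
  "vnorm v = sqrt (v \<bullet> v)"

text \<open>
  The coordinate map into the type of functions, extended by \<^const>\<open>undefined\<close> outside of
  \<open>{..<n}\<close>.  It identifies \<open>carrier_vec n\<close> with the space of the product measure
  \<open>\<Pi>\<^sub>M i\<in>{..<n}. lborel\<close> (Lebesgue measure on Borel sets), and it is a homeomorphism onto its
  image for the product topology of the function type, which is the topology used by
  \<^const>\<open>compact\<close> below.
\<close>

definition coords :: "nat \<Rightarrow> real vec \<Rightarrow> nat \<Rightarrow> real" where
  "coords n v = (\<lambda>i\<in>{..<n}. v $ i)"

definition vec_compact :: "nat \<Rightarrow> real vec set \<Rightarrow> bool" where
  "vec_compact n S \<longleftrightarrow> S \<subseteq> carrier_vec n \<and> compact (coords n ` S)"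

definition has_gradient :: "nat \<Rightarrow> (real vec \<Rightarrow> real) \<Rightarrow> real vec \<Rightarrow> real vec \<Rightarrow> bool" where
  "has_gradient n f x g \<longleftrightarrow> g \<in> carrier_vec n \<and>
     (\<forall>e>0. \<exists>r>0. \<forall>y\<in>carrier_vec n. vnorm (y - x) < r \<longrightarrow>
        \<bar>f y - f x - g \<bullet> (y - x)\<bar> \<le> e * vnorm (y - x))"

definition gradient :: "nat \<Rightarrow> (real vec \<Rightarrow> real) \<Rightarrow> real vec \<Rightarrow> real vec" where
  "gradient n f x = (THE g. has_gradient n f x g)"

text \<open>Linear independence of a finite family, so that repeated members count as dependent.\<close>

definition lin_indpt_family :: "nat \<Rightarrow> real vec list \<Rightarrow> bool" where
  "lin_indpt_family n vs \<longleftrightarrow> distinct vs \<and>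
     \<not> LinearCombinations.module.lin_dep class_ring (module_vec TYPE(real) n) (set vs)"

definition positive_definite :: "nat \<Rightarrow> real mat \<Rightarrow> bool" where
  "positive_definite n S \<longleftrightarrow> S \<in> carrier_mat n n \<and> S\<^sup>T = S \<and>
     (\<forall>x\<in>carrier_vec n. x \<noteq> 0\<^sub>v n \<longrightarrow> x \<bullet> (S *\<^sub>v x) > 0)"

section \<open>The chance-constrained problem\<close>

definition std_normal_cdf :: "real \<Rightarrow> real" where
  "std_normal_cdf = cdf std_normal_distribution"

definition mvn_density :: "nat \<Rightarrow> real vec \<Rightarrow> real mat \<Rightarrow> real vec \<Rightarrow> real" where
  "mvn_density n m S y =
     exp (- ((y - m) \<bullet> (the (mat_inverse S) *\<^sub>v (y - m))) / 2) / sqrt ((2 * pi) ^ n * det S)"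

text \<open>
  Data of the problem: dimension \<open>n\<close>, number of mixture components \<open>K\<close>, \<open>H\<close>, \<open>h\<close>, \<open>A\<close>, \<open>d\<close>,
  \<open>c\<close>, \<open>b\<close>, \<open>\<theta>\<close>, and the mixture parameters \<open>w\<^sub>k\<close>, \<open>\<mu>\<^sub>k\<close>, \<open>\<Sigma>\<^sub>k\<close> for \<open>k < K\<close>.
\<close>

record ccp =
  ndim :: nat
  ncomp :: nat
  eq_mat :: "real mat"
  eq_rhs :: "real vec"
  ineq_mat :: "real mat"
  ineq_rhs :: "real vec"
  cost :: "real vec"
  bound :: real
  level :: real
  weight :: "nat \<Rightarrow> real"
  mean :: "nat \<Rightarrow> real vec"
  covar :: "nat \<Rightarrow> real mat"

definition polytope :: "ccp \<Rightarrow> real vec set" where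
  "polytope P = {x \<in> carrier_vec (ndim P).
     eq_mat P *\<^sub>v x = eq_rhs P \<and> ineq_mat P *\<^sub>v x \<ge> ineq_rhs P}"

definition well_formed :: "ccp \<Rightarrow> bool" where
  "well_formed P \<longleftrightarrow>
     dim_col (eq_mat P) = ndim P \<and> dim_vec (eq_rhs P) = dim_row (eq_mat P) \<and>
     dim_col (ineq_mat P) = ndim P \<and> dim_vec (ineq_rhs P) = dim_row (ineq_mat P) \<and>
     cost P \<in> carrier_vec (ndim P) \<and>
     0 < level P \<and> level P < 1 \<and>
     (\<forall>k<ncomp P. weight P k \<ge> 0 \<and> mean P k \<in> carrier_vec (ndim P)
        \<and> covar P k \<in> carrier_mat (ndim P) (ndim P)) \<and>
     (\<Sum>k<ncomp P. weight P k) = 1 \<and>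
     vec_compact (ndim P) (polytope P)"

definition mixture_density :: "ccp \<Rightarrow> real vec \<Rightarrow> real" where
  "mixture_density P y =
     (\<Sum>k<ncomp P. weight P k * mvn_density (ndim P) (mean P k) (covar P k) y)"

text \<open>
  The law of the random vector, on coordinate functions.  Only the law of the random vector enters
  the problem, so no underlying probability space is carried along.
\<close>

definition mixture_law :: "ccp \<Rightarrow> (nat \<Rightarrow> real) measure" where
  "mixture_law P = density (\<Pi>\<^sub>M i\<in>{..<ndim P}. lborel)
     (\<lambda>y. ennreal (mixture_density P (vec (ndim P) y)))"

definition prob_le :: "ccp \<Rightarrow> real vec \<Rightarrow> real" where
  "prob_le P x =
     measure (mixture_law P) {y \<in> space (mixture_law P). vec (ndim P) y \<bullet> x \<le> bound P}"

definition chance_set :: "ccp \<Rightarrow> real \<Rightarrow> real vec set" where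
  "chance_set P t = {x \<in> polytope P. prob_le P x \<ge> t}"

definition opt_sol :: "ccp \<Rightarrow> real \<Rightarrow> real vec \<Rightarrow> bool" where
  "opt_sol P t x \<longleftrightarrow> is_arg_min (\<lambda>x. cost P \<bullet> x) (\<lambda>x. x \<in> chance_set P t) x"

definition covar_pos_def :: "ccp \<Rightarrow> bool" where
  "covar_pos_def P \<longleftrightarrow> (\<forall>k<ncomp P. positive_definite (ndim P) (covar P k))"

definition feasible_nearby :: "ccp \<Rightarrow> bool" where
  "feasible_nearby P \<longleftrightarrow> (\<exists>\<rho>>0. \<forall>t\<in>{level P - \<rho>..level P + \<rho>}. chance_set P t \<noteq> {})"

definition away_from_origin :: "ccp \<Rightarrow> bool" where
  "away_from_origin P \<longleftrightarrow> (bound P = 0 \<longrightarrow>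
     (\<exists>\<delta>>0. chance_set P (level P) \<inter> {x \<in> carrier_vec (ndim P). vnorm x \<le> \<delta>} = {}))"

text \<open>
  The gradients of the linear constraints are the rows of their matrices.
\<close>

definition active_gradients :: "ccp \<Rightarrow> real vec \<Rightarrow> real vec list" where
  "active_gradients P x =
     rows (eq_mat P)
     @ map (row (ineq_mat P))
         (filter (\<lambda>i. row (ineq_mat P) i \<bullet> x = ineq_rhs P $ i) [0..<dim_row (ineq_mat P)])
     @ (if prob_le P x = level P then [gradient (ndim P) (prob_le P) x] else [])"

definition licq :: "ccp \<Rightarrow> bool" where
  "licq P \<longleftrightarrow>
     (\<forall>x. opt_sol P (level P) x \<longrightarrow> lin_indpt_family (ndim P) (active_gradients P x))"

definition tol_feasible :: "ccp \<Rightarrow> real \<Rightarrow> real vec \<Rightarrow> bool" where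
  "tol_feasible P \<tau> x \<longleftrightarrow> x \<in> carrier_vec (ndim P) \<and>
     eq_mat P *\<^sub>v x = eq_rhs P \<and> ineq_mat P *\<^sub>v x \<ge> ineq_rhs P \<and> prob_le P x \<ge> level P - \<tau>"

text \<open>The argument \<open>xstar\<close> is an optimal solution at level \<open>\<theta>\<close>.\<close>

definition tol_optimal :: "ccp \<Rightarrow> real vec \<Rightarrow> real \<Rightarrow> real vec \<Rightarrow> bool" where
  "tol_optimal P xstar \<tau> x \<longleftrightarrow>
     tol_feasible P \<tau> x \<and> \<bar>cost P \<bullet> xstar - cost P \<bullet> x\<bar> \<le> \<tau>"

section \<open>Piecewise linear approximations\<close>

text \<open>A breakpoint array is a function on the integers, relevant only on \<open>{-L..R}\<close>.\<close>

definition valid_breakpoints :: "nat \<Rightarrow> nat \<Rightarrow> (int \<Rightarrow> real) \<Rightarrow> bool" where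
  "valid_breakpoints L R z \<longleftrightarrow>
     L > 0 \<and> R > 0 \<and> strict_mono_on {- int L..int R} z \<and> z 0 = 0"

definition tangent :: "real \<Rightarrow> real \<Rightarrow> real" where
  "tangent u z = std_normal_cdf u + std_normal_density u * (z - u)"

definition secant :: "real \<Rightarrow> real \<Rightarrow> real \<Rightarrow> real" where
  "secant u v z =
     std_normal_cdf u + (std_normal_cdf v - std_normal_cdf u) / (v - u) * (z - u)"

definition upper_cdf :: "nat \<Rightarrow> nat \<Rightarrow> (int \<Rightarrow> real) \<Rightarrow> real \<Rightarrow> real" where
  "upper_cdf L R zb z =
     (if z \<ge> 0 then min 1 (MIN i\<in>{0..R}. tangent (zb (int i)) z)
      else max (std_normal_cdf (zb (- int L)))
             (MAX i\<in>{1..L}. secant (zb (- int i)) (zb (- int i + 1)) z))"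

definition lower_cdf :: "nat \<Rightarrow> nat \<Rightarrow> (int \<Rightarrow> real) \<Rightarrow> real \<Rightarrow> real" where
  "lower_cdf L R zb z =
     (if z \<ge> 0 then min (std_normal_cdf (zb (int R)))
             (MIN i\<in>{1..R}. secant (zb (int i - 1)) (zb (int i)) z)
      else max 0 (MAX i\<in>{0..L}. tangent (zb (- int i)) z))"

text \<open>
  Feasible points \<open>(x, z, \<zeta>, l)\<close> of the approximation problem in which the function \<open>F\<close> takes the
  place of the standard normal distribution function.
\<close>

definition approx_feasible ::
  "ccp \<Rightarrow> (real \<Rightarrow> real) \<Rightarrow> (real vec \<times> real vec \<times> real vec \<times> real vec) set" where
  "approx_feasible P F = {(x, z, \<zeta>, l).
     x \<in> polytope P \<and> z \<in> carrier_vec (ncomp P) \<and>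
     \<zeta> \<in> carrier_vec (ncomp P) \<and> (\<forall>k<ncomp P. 0 \<le> \<zeta> $ k \<and> \<zeta> $ k \<le> 1) \<and>
     l \<in> carrier_vec (ncomp P) \<and> (\<forall>k<ncomp P. 0 \<le> l $ k) \<and>
     (\<Sum>k<ncomp P. weight P k * \<zeta> $ k) \<ge> level P \<and>
     (\<forall>k<ncomp P. F (z $ k) \<ge> \<zeta> $ k \<and>
        bound P - x \<bullet> mean P k \<ge> z $ k * l $ k \<and>
        x \<bullet> (covar P k *\<^sub>v x) = (l $ k)\<^sup>2)}"

definition approx_opt_x :: "ccp \<Rightarrow> (real \<Rightarrow> real) \<Rightarrow> real vec \<Rightarrow> bool" where
  "approx_opt_x P F x \<longleftrightarrow> (\<exists>z \<zeta> l.
     is_arg_min (\<lambda>(x, z, \<zeta>, l). cost P \<bullet> x) (\<lambda>q. q \<in> approx_feasible P F) (x, z, \<zeta>, l))"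

end

(* The constraints of either approximation problem force the x-components to satisfy
   sum_k w_k F(z_k) >= theta with z_k = (b - mu_k.x)/sqrt(x.Sigma_k x), where F is the piecewise
   linear function.  A uniform mesh of width sqrt tau on an interval of radius about
   sqrt(2 ln(1/tau)) gives Phi <= F_outer <= Phi + tau and Phi - tau <= F_inner <= Phi, so that
   P(theta) \<subseteq> X_OA \<subseteq> P(theta - tau) and P(theta + tau) \<subseteq> X_IA \<subseteq> P(theta), and all costs lie
   between Z(theta - tau) and Z(theta + tau).  It remains to make this window small: Z is
   left-continuous at theta by compactness; it is right-continuous because, by LICQ, at an optimal
   point with p = theta some direction orthogonal to the other active gradients increases p to
   first order. *)
theory Submission
  imports Defs
begin

text \<open>The probability is given through a mixture density on coordinate functions, so its
  closed form in \<Phi> has to be derived; this is done by integrating out one coordinate at a time.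
  The second obstacle is the origin, where the quotient (b - mu.x)/sqrt(x.Sigma x) is meaningless.
  Every function \<open>F\<close> standing in for \<Phi> is therefore carried along with its limits
  \<open>hi\<close> and \<open>lo\<close> at plus and minus infinity, which serve as its values at x
  = 0. For b \<noteq> 0 this choice makes the constraint function continuous on the whole polytope;
  for b = 0 Assumption 3 keeps the origin out of the polytope. The error bounds must then hold for
  \<open>hi\<close> and \<open>lo\<close> as well. The mesh is symmetric, so the inner function is
  the reflection of the outer one in the point (0, 1/2), and only the outer one is analysed
  directly. Continuity of the optimal value at \<theta> gives no rate: \<tau> depends on all the
  problem data, but the number of breakpoints depends on \<tau> alone, which is how the constant can
  be absolute.\<close>

section \<open>The law of a linear functional of a Gaussian vector\<close>

text \<open>Block elimination with the last diagonal entry as pivot: the matrix is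
  \<open>?T * ?L\<close>, where \<open>?T\<close> is unit upper triangular and adds multiples of the
  last row, and \<open>?L\<close> has a zero block above the pivot.\<close>

lemma det_schur_complement:
  fixes Q :: "nat \<Rightarrow> nat \<Rightarrow> real"
  assumes a: "Q n n \<noteq> 0"
  shows "det (mat (Suc n) (Suc n) (\<lambda>(i, j). Q i j)) =
    Q n n * det (mat n n (\<lambda>(i, j). Q i j - Q i n * Q n j / Q n n))"
proof -
  let ?S = "mat n n (\<lambda>(i, j). Q i j - Q i n * Q n j / Q n n)"
  let ?T = "mat (Suc n) (Suc n) (\<lambda>(i, k). if i = k then 1 else if k = n then Q i n / Q n n else 0)"
  let ?L = "four_block_mat ?S (0\<^sub>m n 1) (mat 1 n (\<lambda>(i, j). Q n j)) (mat 1 1 (\<lambda>_. Q n n))"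
  have L: "?L \<in> carrier_mat (Suc n) (Suc n)"
    using four_block_carrier_mat[of ?S n n "mat 1 1 (\<lambda>_. Q n n)" 1 1] by simp
  have "mat (Suc n) (Suc n) (\<lambda>(i, j). Q i j) = ?T * ?L"
  proof (rule eq_matI)
    fix i j assume "i < dim_row (?T * ?L)" "j < dim_col (?T * ?L)"
    then have ij: "i < Suc n" "j < Suc n" using L by auto
    have "(?T * ?L) $$ (i, j) = (\<Sum>k\<in>{0..<Suc n}. ?T $$ (i, k) * ?L $$ (k, j))"
      using ij L by (simp add: scalar_prod_def)
    also have "\<dots> = (\<Sum>k\<in>{0..<n}. if k = i then ?L $$ (i, j) else 0) + ?T $$ (i, n) * ?L $$ (n, j)"
      unfolding sum.atLeast0_lessThan_Suc using ij by (intro arg_cong2[of _ _ _ _ "(+)"] sum.cong) auto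
    also have "\<dots> = Q i j"
      using ij a by (auto simp: less_Suc_eq)
    finally show "mat (Suc n) (Suc n) (\<lambda>(i, j). Q i j) $$ (i, j) = (?T * ?L) $$ (i, j)"
      using ij by simp
  qed (use L in auto)
  moreover have "det ?T = 1"
  proof -
    have "upper_triangular ?T" by auto
    then have "det ?T = prod_list (diag_mat ?T)"
      by (intro det_upper_triangular[of _ "Suc n"]) auto
    also have "diag_mat ?T = map (\<lambda>_. 1) [0..<Suc n]"
      by (auto simp: diag_mat_def)
    finally show ?thesis by (simp add: prod_list_replicate map_replicate_const)
  qed
  moreover have "det ?L = det ?S * Q n n"
    by (subst det_four_block_mat_upper_right_zero[of _ n _ 1]) (auto simp: det_single)
  ultimately show ?thesis
    by (simp add: det_mult[OF _ L] del: One_nat_def)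
qed

text \<open>The expectation of \<open>f\<close> under the centred normal law with standard deviation
  |s|. Integrating against the standard density gives it a meaning for \<open>s = 0\<close> (point
  mass at 0) and for \<open>s < 0\<close>; eliminating a coordinate can produce both.\<close>

definition gauss_avg :: "real \<Rightarrow> (real \<Rightarrow> ennreal) \<Rightarrow> ennreal" where
  "gauss_avg s f = (\<integral>\<^sup>+ t. ennreal (std_normal_density t) * f (s * t) \<partial>lborel)"

lemma nn_integral_std_normal_density [simp]: "(\<integral>\<^sup>+ t. ennreal (std_normal_density t) \<partial>lborel) = 1"
  using prob_space_normal_density[of 1 0, THEN prob_space.emeasure_space_1]
  by (simp add: emeasure_density cong: nn_integral_cong)

lemma gauss_avg_zero [simp]: "gauss_avg 0 f = f 0"
  unfolding gauss_avg_def by (simp add: nn_integral_multc)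

lemma gauss_avg_scaled:
  assumes s: "s > 0" and [measurable]: "f \<in> borel_measurable borel"
  shows "gauss_avg s f = (\<integral>\<^sup>+ t. ennreal (normal_density 0 s t) * f t \<partial>lborel)"
proof -
  have "(\<integral>\<^sup>+ t. ennreal (normal_density 0 s t) * f t \<partial>lborel)
     = ennreal \<bar>s\<bar> * (\<integral>\<^sup>+ t. ennreal (normal_density 0 s (0 + s * t)) * f (0 + s * t) \<partial>lborel)"
    using s by (intro nn_integral_real_affine) auto
  also have "\<dots> = (\<integral>\<^sup>+ t. ennreal \<bar>s\<bar> * (ennreal (normal_density 0 s (0 + s * t)) * f (0 + s * t)) \<partial>lborel)"
    by (simp add: nn_integral_cmult)
  also have "\<dots> = gauss_avg s f"
    unfolding gauss_avg_def
  proof (intro nn_integral_cong)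
    fix t
    have "s * normal_density 0 s (s * t) = std_normal_density t"
      using s by (simp add: normal_density_def real_sqrt_mult power_mult_distrib)
    then have "ennreal \<bar>s\<bar> * ennreal (normal_density 0 s (0 + s * t)) = ennreal (std_normal_density t)"
      using s by (simp add: ennreal_mult'[symmetric])
    then show "ennreal \<bar>s\<bar> * (ennreal (normal_density 0 s (0 + s * t)) * f (0 + s * t))
       = ennreal (std_normal_density t) * f (s * t)"
      by (simp add: mult.assoc[symmetric])
  qed
  finally show ?thesis by simp
qed

lemma gauss_avg_uminus:
  assumes [measurable]: "f \<in> borel_measurable borel"
  shows "gauss_avg (- s) f = gauss_avg s f"
proof -
  have "gauss_avg s f = ennreal \<bar>- 1\<bar> * (\<integral>\<^sup>+ t. ennreal (std_normal_density (0 + - 1 * t)) * f (s * (0 + - 1 * t)) \<partial>lborel)"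
    unfolding gauss_avg_def by (intro nn_integral_real_affine) auto
  then show ?thesis by (simp add: gauss_avg_def std_normal_density_def)
qed

lemma gauss_avg_measurable [measurable]:
  assumes [measurable]: "f \<in> borel_measurable borel"
  shows "(\<lambda>x. gauss_avg c (\<lambda>t. f (x + t))) \<in> borel_measurable borel"
  unfolding gauss_avg_def by measurable

text \<open>Variances of independent centred Gaussians add: a shift of the inner variable and an
  exchange of the integrals expose the convolution of the two densities.\<close>

lemma gauss_avg_gauss_avg_pos:
  assumes s: "s > 0" and c: "c > 0" and [measurable]: "f \<in> borel_measurable borel"
  shows "gauss_avg s (\<lambda>x. gauss_avg c (\<lambda>t. f (x + t))) = gauss_avg (sqrt (s\<^sup>2 + c\<^sup>2)) f"
proof -
  let ?n = "\<lambda>s t. ennreal (normal_density 0 s t)"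
  have "gauss_avg s (\<lambda>x. gauss_avg c (\<lambda>t. f (x + t)))
      = (\<integral>\<^sup>+ x. ?n s x * (\<integral>\<^sup>+ t. ?n c t * f (x + t) \<partial>lborel) \<partial>lborel)"
    using s c by (simp add: gauss_avg_scaled)
  also have "\<dots> = (\<integral>\<^sup>+ x. ?n s x * (\<integral>\<^sup>+ y. ?n c (y - x) * f y \<partial>lborel) \<partial>lborel)"
  proof (rule nn_integral_cong, rule arg_cong2[of _ _ _ _ "(*)"], rule refl)
    fix x
    have "(\<integral>\<^sup>+ y. ?n c (y - x) * f y \<partial>lborel)
       = ennreal \<bar>1\<bar> * (\<integral>\<^sup>+ t. ?n c ((x + 1 * t) - x) * f (x + 1 * t) \<partial>lborel)"
      by (intro nn_integral_real_affine) auto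
    then show "(\<integral>\<^sup>+ t. ?n c t * f (x + t) \<partial>lborel) = (\<integral>\<^sup>+ y. ?n c (y - x) * f y \<partial>lborel)"
      by simp
  qed
  also have "\<dots> = (\<integral>\<^sup>+ x. (\<integral>\<^sup>+ y. ?n s x * (?n c (y - x) * f y) \<partial>lborel) \<partial>lborel)"
    by (simp add: nn_integral_cmult)
  also have "\<dots> = (\<integral>\<^sup>+ y. (\<integral>\<^sup>+ x. ?n s x * (?n c (y - x) * f y) \<partial>lborel) \<partial>lborel)"
    by (intro lborel_pair.Fubini') measurable
  also have "\<dots> = (\<integral>\<^sup>+ y. (\<integral>\<^sup>+ x. ennreal (normal_density 0 c (y - x) * normal_density 0 s x) \<partial>lborel) * f y \<partial>lborel)"
    by (intro nn_integral_cong, subst nn_integral_multc[symmetric], measurable)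
       (auto simp: ennreal_mult' mult_ac intro!: nn_integral_cong)
  also have "\<dots> = (\<integral>\<^sup>+ y. ?n (sqrt (c\<^sup>2 + s\<^sup>2)) y * f y \<partial>lborel)"
    using fun_cong[OF conv_normal_density_zero_mean[OF c s]] by simp
  also have "\<dots> = gauss_avg (sqrt (s\<^sup>2 + c\<^sup>2)) f"
    using s by (subst gauss_avg_scaled) (auto simp: add.commute add_nonneg_pos)
  finally show ?thesis .
qed

text \<open>The sign of \<open>c\<close> is left open because \<open>c\<close> will be the scaled
  coefficient of a linear form. Evenness of the density handles \<open>c < 0\<close>, point masses
  handle the zeros.\<close>

lemma gauss_avg_gauss_avg:
  assumes s: "s \<ge> 0" and f [measurable]: "f \<in> borel_measurable borel"
  shows "gauss_avg s (\<lambda>x. gauss_avg c (\<lambda>t. f (x + t))) = gauss_avg (sqrt (s\<^sup>2 + c\<^sup>2)) f"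
proof -
  have pos: "gauss_avg s (\<lambda>x. gauss_avg c (\<lambda>t. f (x + t))) = gauss_avg (sqrt (s\<^sup>2 + c\<^sup>2)) f"
    if "c \<ge> 0" for c
  proof (cases "s = 0 \<or> c = 0")
    case True
    then show ?thesis using s that by auto
  next
    case False
    then show ?thesis using s that by (intro gauss_avg_gauss_avg_pos) auto
  qed
  show ?thesis
  proof (cases "c \<ge> 0")
    case False
    then show ?thesis using pos[of "- c"] by (simp add: gauss_avg_uminus)
  qed (use pos in auto)
qed

section \<open>Quadratic forms and elimination of the last variable\<close>

definition quad :: "nat \<Rightarrow> (nat \<Rightarrow> nat \<Rightarrow> real) \<Rightarrow> (nat \<Rightarrow> real) \<Rightarrow> real" where
  "quad n Q v = (\<Sum>i<n. \<Sum>j<n. Q i j * v i * v j)"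

text \<open>Coefficients are functions on all index pairs, of which only those below
  \<open>n\<close> matter; going from \<open>Suc n\<close> to \<open>n\<close> thus involves no
  submatrices.\<close>

definition sym_posdef :: "nat \<Rightarrow> (nat \<Rightarrow> nat \<Rightarrow> real) \<Rightarrow> bool" where
  "sym_posdef n Q \<longleftrightarrow> (\<forall>i<n. \<forall>j<n. Q i j = Q j i) \<and> (\<forall>v. (\<exists>i<n. v i \<noteq> 0) \<longrightarrow> quad n Q v > 0)"

definition schur :: "nat \<Rightarrow> (nat \<Rightarrow> nat \<Rightarrow> real) \<Rightarrow> nat \<Rightarrow> nat \<Rightarrow> real" where
  "schur n Q i j = Q i j - Q i n * Q n j / Q n n"

lemma sym_posdef_sym: "sym_posdef n Q \<Longrightarrow> i < n \<Longrightarrow> j < n \<Longrightarrow> Q i j = Q j i"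
  unfolding sym_posdef_def by blast

lemma sym_posdef_quad_pos: "sym_posdef n Q \<Longrightarrow> i < n \<Longrightarrow> v i \<noteq> 0 \<Longrightarrow> quad n Q v > 0"
  unfolding sym_posdef_def by blast

lemma sym_posdef_pivot_pos:
  assumes "sym_posdef (Suc n) Q"
  shows "Q n n > 0"
  using sym_posdef_quad_pos[OF assms, of n "\<lambda>i. if i = n then 1 else 0"] by (simp add: quad_def)

lemma sym_posdef_nonneg:
  assumes "sym_posdef n Q"
  shows "quad n Q v \<ge> 0"
proof (cases "\<exists>i<n. v i \<noteq> 0")
  case True
  then show ?thesis using sym_posdef_quad_pos[OF assms] less_imp_le by blast
qed (simp add: quad_def)

lemma quad_cong: "(\<And>i. i < n \<Longrightarrow> v i = w i) \<Longrightarrow> quad n Q v = quad n Q w"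
  by (auto simp: quad_def intro!: sum.cong)

lemma complete_square:
  "(a::real) > 0 \<Longrightarrow> a * (v + R / a)\<^sup>2 = a * v\<^sup>2 + 2 * v * R + R * R / a"
  by (simp add: power2_eq_square field_simps)

text \<open>Completing the square in the last variable; \<open>R\<close> in the proof is half the
  coefficient of \<open>v n\<close>.\<close>

lemma quad_Suc:
  assumes Q: "sym_posdef (Suc n) Q"
  shows "quad (Suc n) Q v
    = quad n (schur n Q) v + Q n n * (v n + (\<Sum>j<n. Q n j * v j) / Q n n)\<^sup>2"
proof -
  define R where "R = (\<Sum>j<n. Q n j * v j)"
  note a = sym_posdef_pivot_pos[OF Q]
  have sym: "Q i n = Q n i" if "i < n" for i
    using sym_posdef_sym[OF Q] that by simp
  have "(\<Sum>i<n. \<Sum>j<n. Q i n * Q n j / Q n n * v i * v j) = (\<Sum>i<n. Q n i * v i * (R / Q n n))"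
    unfolding R_def sum_divide_distrib sum_distrib_left by (intro sum.cong) (auto simp: sym)
  also have "\<dots> = R * R / Q n n"
    unfolding sum_distrib_right[symmetric] by (simp add: R_def)
  finally have "quad n (schur n Q) v = quad n Q v - R * R / Q n n"
    by (simp add: quad_def schur_def left_diff_distrib sum_subtractf)
  moreover have "quad (Suc n) Q v = quad n Q v + 2 * v n * R + Q n n * (v n)\<^sup>2"
    by (simp add: quad_def R_def sum.distrib sym sum_distrib_left power2_eq_square algebra_simps)
  moreover have "Q n n * (v n + R / Q n n)\<^sup>2 = Q n n * (v n)\<^sup>2 + 2 * v n * R + R * R / Q n n"
    by (rule complete_square[OF a])
  ultimately show ?thesis
    unfolding R_def[symmetric] by simp
qed

lemma sym_posdef_schur:
  assumes Q: "sym_posdef (Suc n) Q"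
  shows "sym_posdef n (schur n Q)"
  unfolding sym_posdef_def
proof (intro conjI allI impI)
  fix v :: "nat \<Rightarrow> real" assume "\<exists>i<n. v i \<noteq> 0"
  then obtain i where i: "i < n" "v i \<noteq> 0" by blast
  \<comment> \<open>The last entry is chosen to make the completed square vanish, so the Schur form
    at \<open>v\<close> is a value of the full form.\<close>
  let ?w = "v(n := - (\<Sum>j<n. Q n j * v j) / Q n n)"
  have "0 < quad (Suc n) Q ?w"
    using i by (intro sym_posdef_quad_pos[OF Q, of i]) auto
  also have "\<dots> = quad n (schur n Q) ?w"
    unfolding quad_Suc[OF Q] by simp
  also have "\<dots> = quad n (schur n Q) v" by (rule quad_cong) auto
  finally show "0 < quad n (schur n Q) v" .
next
  fix i j assume "i < n" "j < n"
  then show "schur n Q i j = schur n Q j i"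
    using sym_posdef_sym[OF Q, of i j] sym_posdef_sym[OF Q, of i n] sym_posdef_sym[OF Q, of n j]
    by (simp add: schur_def)
qed

lemma det_schur:
  assumes "sym_posdef (Suc n) Q"
  shows "det (mat (Suc n) (Suc n) (\<lambda>(i, j). Q i j)) = Q n n * det (mat n n (\<lambda>(i, j). schur n Q i j))"
  using det_schur_complement[of Q n] sym_posdef_pivot_pos[OF assms] by (simp add: schur_def)

lemma det_pos: "sym_posdef n Q \<Longrightarrow> det (mat n n (\<lambda>(i, j). Q i j)) > 0"
proof (induction n arbitrary: Q)
  case (Suc n)
  then show ?case
    using sym_posdef_schur sym_posdef_pivot_pos by (simp add: det_schur)
qed (simp add: det_def)

text \<open>The reason why \<open>u\<close> survives elimination: with x = Q u, the terms in
  \<open>u n\<close> cancel, and the Schur complement applied to the first entries of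
  \<open>u\<close> gives x i - x n * Q n i / Q n n. What is left over is x n times the base of the
  square in \<open>quad_Suc\<close>.\<close>

lemma linear_form_Suc:
  fixes Q :: "nat \<Rightarrow> nat \<Rightarrow> real"
  assumes Q: "sym_posdef (Suc n) Q"
  shows "(\<Sum>i<Suc n. (\<Sum>j<Suc n. Q i j * u j) * v i)
    = (\<Sum>i<n. (\<Sum>j<n. schur n Q i j * u j) * v i)
      + (\<Sum>j<Suc n. Q n j * u j) * (v n + (\<Sum>j<n. Q n j * v j) / Q n n)"
proof -
  define x where "x i = (\<Sum>j<Suc n. Q i j * u j)" for i
  note a = sym_posdef_pivot_pos[OF Q]
  have sym: "Q i n = Q n i" if "i < n" for i
    using sym_posdef_sym[OF Q] that by simp
  have "(\<Sum>j<n. schur n Q i j * u j) = x i - x n * Q n i / Q n n" if "i < n" for i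
    using a sym[OF that]
    by (simp add: x_def schur_def left_diff_distrib sum_subtractf sum_distrib_left
        sum_divide_distrib[symmetric] mult.assoc sum_distrib_left[symmetric] field_simps)
  then have "(\<Sum>i<n. (\<Sum>j<n. schur n Q i j * u j) * v i) = (\<Sum>i<n. (x i - x n * Q n i / Q n n) * v i)"
    by simp
  also have "\<dots> = (\<Sum>i<n. x i * v i - x n * (Q n i * v i / Q n n))"
    by (simp add: left_diff_distrib mult.assoc)
  also have "\<dots> = (\<Sum>i<n. x i * v i) - x n * ((\<Sum>j<n. Q n j * v j) / Q n n)"
    unfolding sum_subtractf sum_distrib_left[symmetric] sum_divide_distrib[symmetric] ..
  finally show ?thesis
    unfolding x_def[symmetric] by (simp add: algebra_simps)
qed

text \<open>The integral over the last coordinate: \<open>q\<close> and \<open>X\<close> are the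
  remaining quadratic and linear forms, \<open>r\<close> is the shift from completing the square,
  \<open>D\<close> the determinant of the Schur complement. The substitution t = sqrt a * (y - m +
  r) makes the exponent standard.\<close>

lemma gauss_inner_integral:
  assumes a: "a > 0" and D: "D \<ge> 0" and [measurable]: "f \<in> borel_measurable borel"
  shows "(\<integral>\<^sup>+ y. ennreal (sqrt (a * D / (2 * pi) ^ Suc n) * exp (- (q + a * (y - m + r)\<^sup>2) / 2))
              * f (X + x * (y - m + r)) \<partial>lborel)
    = ennreal (sqrt (D / (2 * pi) ^ n) * exp (- q / 2)) * gauss_avg (x / sqrt a) (\<lambda>t. f (X + t))"
    (is "?L = ?R")
proof -
  let ?c = "1 / sqrt a"
  have "?L = ennreal \<bar>?c\<bar> * (\<integral>\<^sup>+ t. ennreal (sqrt (a * D / (2 * pi) ^ Suc n) * exp (- (q + a * ((m - r + ?c * t) - m + r)\<^sup>2) / 2))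
              * f (X + x * ((m - r + ?c * t) - m + r)) \<partial>lborel)"
    using a by (intro nn_integral_real_affine) auto
  also have "\<dots> = (\<integral>\<^sup>+ t. ennreal \<bar>?c\<bar> * (ennreal (sqrt (a * D / (2 * pi) ^ Suc n) * exp (- (q + a * ((m - r + ?c * t) - m + r)\<^sup>2) / 2))
              * f (X + x * ((m - r + ?c * t) - m + r))) \<partial>lborel)"
    by (simp add: nn_integral_cmult)
  also have "\<dots> = (\<integral>\<^sup>+ t. ennreal (sqrt (D / (2 * pi) ^ n) * exp (- q / 2)) *
      (ennreal (std_normal_density t) * f (X + x / sqrt a * t)) \<partial>lborel)"
  proof (rule nn_integral_cong)
    fix t
    have e: "a * (m - r + ?c * t - m + r)\<^sup>2 = t\<^sup>2"
      using a by (simp add: power_mult_distrib power_divide)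
    have 1: "sqrt (a * D / (2 * pi) ^ Suc n) = sqrt a * (sqrt (D / (2 * pi) ^ n) / sqrt (2 * pi))"
      by (simp add: real_sqrt_mult real_sqrt_divide)
    have 2: "exp (- (q + t\<^sup>2) / 2) = exp (- q / 2) * exp (- t\<^sup>2 / 2)"
      by (simp add: exp_add[symmetric] add_divide_distrib[symmetric])
    have "?c * (sqrt (a * D / (2 * pi) ^ Suc n) * exp (- (q + t\<^sup>2) / 2))
       = sqrt (D / (2 * pi) ^ n) * exp (- q / 2) * std_normal_density t"
      unfolding 1 2 std_normal_density_def using a by simp
    then show "ennreal \<bar>?c\<bar> * (ennreal (sqrt (a * D / (2 * pi) ^ Suc n) * exp (- (q + a * ((m - r + ?c * t) - m + r)\<^sup>2) / 2))
              * f (X + x * ((m - r + ?c * t) - m + r)))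
       = ennreal (sqrt (D / (2 * pi) ^ n) * exp (- q / 2)) *
      (ennreal (std_normal_density t) * f (X + x / sqrt a * t))"
      unfolding e using a D by (simp add: mult.assoc[symmetric] ennreal_mult[symmetric])
  qed
  also have "\<dots> = ?R"
    by (simp add: gauss_avg_def nn_integral_cmult)
  finally show ?thesis .
qed

text \<open>Integrating out the last coordinate replaces \<open>Q\<close> by its Schur complement.  With the linear
  form written as \<open>Q u\<close>, the vector \<open>u\<close> does not change in that step and the variance is \<open>u \<bullet> Q u\<close>,
  so no inverse of \<open>Q\<close> enters the induction.\<close>

lemma gauss_nn_integral:
  assumes "sym_posdef n Q" and "f \<in> borel_measurable borel"
  shows "(\<integral>\<^sup>+ y. ennreal (sqrt (det (mat n n (\<lambda>(i, j). Q i j)) / (2 * pi) ^ n)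
              * exp (- quad n Q (\<lambda>i. y i - m i) / 2))
            * f (\<Sum>i<n. (\<Sum>j<n. Q i j * u j) * (y i - m i)) \<partial>(\<Pi>\<^sub>M i\<in>{..<n}. lborel))
    = gauss_avg (sqrt (quad n Q u)) f"
  using assms
proof (induction n arbitrary: Q f)
  case 0
  then show ?case by (simp add: quad_def det_def PiM_empty nn_integral_count_space_finite)
next
  case (Suc n)
  note Q = Suc.prems(1) and f [measurable] = Suc.prems(2)
  interpret product_sigma_finite "\<lambda>_::nat. lborel :: real measure" ..
  let ?M = "\<lambda>n. \<Pi>\<^sub>M i\<in>{..<n::nat}. (lborel :: real measure)"
  let ?a = "Q n n" and ?x = "\<Sum>j<Suc n. Q n j * u j" and ?S = "schur n Q"
  let ?D = "det (mat n n (\<lambda>(i, j). schur n Q i j))"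
  let ?G = "\<lambda>y. ennreal (sqrt (?a * ?D / (2 * pi) ^ Suc n) * exp (- quad (Suc n) Q (\<lambda>i. y i - m i) / 2))
            * f (\<Sum>i<Suc n. (\<Sum>j<Suc n. Q i j * u j) * (y i - m i))"
  have meas: "?G \<in> borel_measurable (?M (Suc n))"
    unfolding quad_def by measurable
  have "(\<integral>\<^sup>+ y. ?G y \<partial>?M (Suc n)) = (\<integral>\<^sup>+ y. (\<integral>\<^sup>+ z. ?G (y(n := z)) \<partial>lborel) \<partial>?M n)"
    unfolding lessThan_Suc using meas[unfolded lessThan_Suc] by (intro product_nn_integral_insert) auto
  also have "\<dots> = (\<integral>\<^sup>+ y. ennreal (sqrt (?D / (2 * pi) ^ n) * exp (- quad n ?S (\<lambda>i. y i - m i) / 2))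
     * gauss_avg (?x / sqrt ?a) (\<lambda>t. f ((\<Sum>i<n. (\<Sum>j<n. ?S i j * u j) * (y i - m i)) + t)) \<partial>?M n)"
  proof (rule nn_integral_cong)
    fix y :: "nat \<Rightarrow> real"
    let ?r = "(\<Sum>j<n. Q n j * (y j - m j)) / ?a"
    have 1: "quad (Suc n) Q (\<lambda>i. (y(n := z)) i - m i)
        = quad n ?S (\<lambda>i. y i - m i) + ?a * (z - m n + ?r)\<^sup>2" for z
      by (subst quad_Suc[OF Q], intro arg_cong2[of _ _ _ _ "(+)"] quad_cong) auto
    have 2: "(\<Sum>i<Suc n. (\<Sum>j<Suc n. Q i j * u j) * ((y(n := z)) i - m i))
       = (\<Sum>i<n. (\<Sum>j<n. ?S i j * u j) * (y i - m i)) + ?x * (z - m n + ?r)" for z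
      by (subst linear_form_Suc[OF Q]) (auto intro!: arg_cong2[of _ _ _ _ "(+)"] sum.cong)
    show "(\<integral>\<^sup>+ z. ?G (y(n := z)) \<partial>lborel)
       = ennreal (sqrt (?D / (2 * pi) ^ n) * exp (- quad n ?S (\<lambda>i. y i - m i) / 2))
     * gauss_avg (?x / sqrt ?a) (\<lambda>t. f ((\<Sum>i<n. (\<Sum>j<n. ?S i j * u j) * (y i - m i)) + t))"
      unfolding 1 2
      using sym_posdef_pivot_pos[OF Q] det_pos[OF sym_posdef_schur[OF Q]]
      by (intro gauss_inner_integral) auto
  qed
  \<comment> \<open>The induction hypothesis is applied to a Gaussian average of \<open>f\<close> as
    the new test function; hence \<open>f\<close> is generalised along with
    \<open>Q\<close>.\<close>
  also have "\<dots> = gauss_avg (sqrt (quad n ?S u)) (\<lambda>x. gauss_avg (?x / sqrt ?a) (\<lambda>t. f (x + t)))"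
    by (rule Suc.IH[OF sym_posdef_schur[OF Q]]) measurable
  also have "\<dots> = gauss_avg (sqrt ((sqrt (quad n ?S u))\<^sup>2 + (?x / sqrt ?a)\<^sup>2)) f"
    by (rule gauss_avg_gauss_avg) (auto simp: sym_posdef_nonneg[OF sym_posdef_schur[OF Q]])
  \<comment> \<open>This is \<open>quad_Suc\<close> at \<open>u\<close>, where the completed square
    equals \<open>?x\<^sup>2 / ?a\<close>.\<close>
  also have "(sqrt (quad n ?S u))\<^sup>2 + (?x / sqrt ?a)\<^sup>2 = quad (Suc n) Q u"
    using sym_posdef_pivot_pos[OF Q] sym_posdef_nonneg[OF sym_posdef_schur[OF Q], of u]
    by (simp add: quad_Suc[OF Q] power_divide power2_eq_square field_simps)
  finally show ?case by (simp add: det_schur[OF Q])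
qed

section \<open>The standard normal distribution function\<close>

abbreviation (input) "Phi \<equiv> std_normal_cdf"
abbreviation (input) "phi \<equiv> std_normal_density"

lemma real_distribution_std_normal: "real_distribution std_normal_distribution"
  by (intro real_distribution.intro real_distribution_axioms.intro prob_space_normal_density) auto

lemma std_normal_cdf_nonneg: "Phi x \<ge> 0"
  by (simp add: std_normal_cdf_def cdf_def)

lemma std_normal_cdf_mono: "x \<le> y \<Longrightarrow> Phi x \<le> Phi y"
  unfolding std_normal_cdf_def
  by (rule finite_borel_measure.cdf_nondecreasing[OF real_distribution.finite_borel_measure_M[OF real_distribution_std_normal]])

lemma std_normal_cdf_at_top: "(Phi \<longlongrightarrow> 1) at_top"
  unfolding std_normal_cdf_def
  by (rule real_distribution.cdf_lim_at_top_prob[OF real_distribution_std_normal])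

lemma std_normal_cdf_at_bot: "(Phi \<longlongrightarrow> 0) at_bot"
  unfolding std_normal_cdf_def
  by (rule finite_borel_measure.cdf_lim_at_bot[OF real_distribution.finite_borel_measure_M[OF real_distribution_std_normal]])

lemma std_normal_cdf_le_1: "Phi x \<le> 1"
  unfolding std_normal_cdf_def
  by (rule real_distribution.cdf_bounded_prob[OF real_distribution_std_normal])

lemma std_normal_cdf_diff_eq_integral:
  assumes "c \<le> x"
  shows "Phi x = Phi c + integral {c..x} phi"
proof (cases "c = x")
  case False
  then have cx: "c < x" using assms by simp
  interpret real_distribution std_normal_distribution by (rule real_distribution_std_normal)
  have int: "set_integrable lborel {c..x} phi"
    by (intro borel_integrable_atLeastAtMost') (auto simp: std_normal_density_def intro!: continuous_intros)
  have "ennreal (Phi x - Phi c) = emeasure std_normal_distribution {c<..x}"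
    using cdf_diff_eq[OF cx] by (simp add: std_normal_cdf_def emeasure_eq_measure)
  also have "\<dots> = (\<integral>\<^sup>+ t. ennreal (phi t) * indicator {c<..x} t \<partial>lborel)"
    by (simp add: emeasure_density)
  \<comment> \<open>The half-open and the closed interval differ by one point, a null set.\<close>
  also have "\<dots> = (\<integral>\<^sup>+ t. ennreal (indicator {c..x} t *\<^sub>R phi t) \<partial>lborel)"
    by (intro nn_integral_cong_AE) (use AE_lborel_singleton[of c] in \<open>eventually_elim, auto simp: indicator_def\<close>)
  also have "\<dots> = ennreal (LINT t:{c..x}|lborel. phi t)"
    using int unfolding set_integrable_def set_lebesgue_integral_def
    by (intro nn_integral_eq_integral) auto
  also have "(LINT t:{c..x}|lborel. phi t) = integral {c..x} phi"
    by (rule set_borel_integral_eq_integral(2)[OF int])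
  finally have "Phi x - Phi c = integral {c..x} phi"
    using std_normal_cdf_mono[OF assms] set_borel_integral_eq_integral(1)[OF int]
    by (subst (asm) ennreal_inj) (auto intro!: integral_nonneg)
  then show ?thesis by simp
qed simp

lemma std_normal_cdf_deriv: "(Phi has_real_derivative phi x) (at x)"
proof -
  have "continuous_on {x - 1..x + 1} phi"
    by (auto simp: std_normal_density_def intro!: continuous_intros)
  then have "((\<lambda>u. integral {x - 1..u} phi) has_real_derivative phi x) (at x within {x - 1..x + 1})"
    by (intro integral_has_real_derivative) auto
  then have "((\<lambda>u. Phi (x - 1) + integral {x - 1..u} phi) has_real_derivative phi x) (at x within {x - 1..x + 1})"
    by (auto intro!: derivative_eq_intros)
  then have "(Phi has_real_derivative phi x) (at x within {x - 1..x + 1})"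
    by (rule has_field_derivative_transform_within[where d = 1]) (auto simp: std_normal_cdf_diff_eq_integral)
  then show ?thesis
    by (simp add: at_within_Icc_at)
qed

lemma std_normal_cdf_continuous: "continuous_on S Phi"
  using std_normal_cdf_deriv DERIV_isCont continuous_at_imp_continuous_on by blast

text \<open>Since the density is even, Phi x + Phi (- x) has derivative 0; the constant is read off
  at infinity.\<close>

lemma std_normal_cdf_uminus: "Phi (- x) = 1 - Phi x"
proof -
  have "((\<lambda>x. Phi (- x)) has_real_derivative phi (- x) * - 1) (at x)" for x
    by (rule DERIV_chain'[OF _ std_normal_cdf_deriv]) (auto intro!: derivative_eq_intros)
  from DERIV_add[OF std_normal_cdf_deriv this]
  have D: "((\<lambda>x. Phi x + Phi (- x)) has_real_derivative 0) (at x)" for x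
    by (simp add: std_normal_density_def)
  have const: "Phi x + Phi (- x) = Phi y + Phi (- y)" for y
    by (rule DERIV_isconst_all) (use D in blast)
  have "(\<lambda>y. Phi y + Phi (- y)) = (\<lambda>_. Phi x + Phi (- x))"
    by (intro ext const[symmetric])
  moreover have "((\<lambda>y. Phi y + Phi (- y)) \<longlongrightarrow> 1 + 0) at_top"
    by (intro tendsto_add std_normal_cdf_at_top filterlim_compose[OF std_normal_cdf_at_bot] filterlim_uminus_at_bot_at_top)
  ultimately show ?thesis
    by (simp add: tendsto_const_iff)
qed

lemma std_normal_cdf_0: "Phi 0 = 1 / 2"
  using std_normal_cdf_uminus[of 0] by simp

lemma std_normal_density_uminus: "phi (- x) = phi x"
  by (simp add: std_normal_density_def)

lemma std_normal_density_antimono: "0 \<le> u \<Longrightarrow> u \<le> v \<Longrightarrow> phi v \<le> phi u"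
  by (simp add: std_normal_density_def divide_right_mono power_mono)

lemma std_normal_density_deriv: "(phi has_real_derivative (- x * phi x)) (at x)"
  unfolding std_normal_density_def
  by (auto intro!: derivative_eq_intros simp: field_simps power2_eq_square)

lemma std_normal_density_le_exp: "phi x \<le> exp (- x\<^sup>2 / 2)"
proof -
  have "1 \<le> sqrt (2 * pi)" using pi_gt3 by simp
  then show ?thesis
    by (simp add: std_normal_density_def field_simps mult_le_cancel_left1)
qed

text \<open>The Lipschitz constant 1 of the density is what turns a mesh width h into an
  approximation error of at most h^2.\<close>

lemma std_normal_density_lipschitz: "\<bar>phi u - phi v\<bar> \<le> \<bar>u - v\<bar>"
proof -
  have *: "\<bar>- x * phi x\<bar> \<le> 1" for x
  proof -
    have "\<bar>x\<bar> \<le> 1 + x\<^sup>2 / 2"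
      using sum_squares_ge_zero[of "\<bar>x\<bar> - 1" 0] by (simp add: power2_eq_square algebra_simps)
    also have "\<dots> \<le> exp (x\<^sup>2 / 2)" by (rule exp_ge_add_one_self)
    finally have "\<bar>x\<bar> * exp (- x\<^sup>2 / 2) \<le> 1" by (simp add: exp_minus field_simps)
    moreover have "\<bar>x\<bar> * phi x \<le> \<bar>x\<bar> * exp (- x\<^sup>2 / 2)"
      by (intro mult_left_mono std_normal_density_le_exp) auto
    ultimately show ?thesis by (simp add: abs_mult)
  qed
  have "norm (phi u - phi v) \<le> 1 * norm (u - v)"
    by (rule field_differentiable_bound[of UNIV phi "\<lambda>x. - x * phi x"])
       (use std_normal_density_deriv * in \<open>auto\<close>)
  then show ?thesis by simp
qed

lemma std_normal_cdf_mvt: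
  assumes "u < v"
  obtains x where "u < x" "x < v" "Phi v - Phi u = phi x * (v - u)"
  using MVT2[OF assms, of Phi phi] std_normal_cdf_deriv by (metis mult.commute)

text \<open>The function phi + Phi has derivative (1 - t) * phi t, so it does not increase beyond 1;
  it dominates Phi, which tends to 1. Hence phi x + Phi x \<ge> 1.\<close>

lemma std_normal_cdf_tail: "1 \<le> x \<Longrightarrow> 1 - Phi x \<le> exp (- x\<^sup>2 / 2)"
proof -
  assume x: "1 \<le> x"
  let ?g = "\<lambda>t. phi t + Phi t"
  have mono: "?g y \<le> ?g x" if "x \<le> y" for y
  proof (rule DERIV_nonpos_imp_nonincreasing[OF that])
    fix t assume t: "x \<le> t" "t \<le> y"
    have "(?g has_real_derivative (- t * phi t + phi t)) (at t)"
      by (intro DERIV_add std_normal_density_deriv std_normal_cdf_deriv)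
    moreover have "1 * phi t \<le> t * phi t"
      using t x by (intro mult_right_mono) auto
    then have "- t * phi t + phi t \<le> 0" by simp
    ultimately show "\<exists>y. (?g has_real_derivative y) (at t) \<and> y \<le> 0" by blast
  qed
  have "1 \<le> ?g x"
  proof (rule tendsto_upperbound[OF std_normal_cdf_at_top])
    show "\<forall>\<^sub>F y in at_top. Phi y \<le> ?g x"
      using eventually_ge_at_top[of x]
    proof eventually_elim
      case (elim y)
      then show ?case using mono[of y] normal_density_nonneg[of 0 1 y] by linarith
    qed
  qed simp
  then show ?thesis using std_normal_density_le_exp[of x] by linarith
qed

section \<open>Tangents and secants of \<Phi>\<close>

lemma tangent_uminus: "tangent (- u) (- z) = 1 - tangent u z"
  by (simp add: tangent_def std_normal_cdf_uminus std_normal_density_uminus algebra_simps)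

text \<open>Concavity of \<Phi> on the nonnegative half-line, obtained by comparing mean value
  slopes with the tangent slope.\<close>

lemma std_normal_cdf_le_tangent:
  assumes "u \<ge> 0" "z \<ge> 0"
  shows "Phi z \<le> tangent u z"
proof -
  consider "z = u" | "u < z" | "z < u" by linarith
  then show ?thesis
  proof cases
    case 2
    then obtain x where x: "u < x" "x < z" "Phi z - Phi u = phi x * (z - u)"
      by (rule std_normal_cdf_mvt)
    have "phi x * (z - u) \<le> phi u * (z - u)"
      using assms x by (intro mult_right_mono std_normal_density_antimono) auto
    then show ?thesis unfolding tangent_def using x by linarith
  next
    case 3
    then obtain x where x: "z < x" "x < u" "Phi u - Phi z = phi x * (u - z)"
      by (rule std_normal_cdf_mvt)
    have "phi u * (u - z) \<le> phi x * (u - z)"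
      using assms x by (intro mult_right_mono std_normal_density_antimono) auto
    then show ?thesis using x by (simp add: tangent_def algebra_simps)
  qed (simp add: tangent_def)
qed

text \<open>The tangent slope and the mean value slope are densities at points at most z - u apart,
  so the Lipschitz bound leaves a gap of at most (z - u)^2.\<close>

lemma tangent_le_std_normal_cdf:
  assumes "u \<le> z"
  shows "tangent u z \<le> Phi z + (z - u)\<^sup>2"
proof (cases "u = z")
  case False
  then have "u < z" using assms by simp
  then obtain x where x: "u < x" "x < z" "Phi z - Phi u = phi x * (z - u)"
    by (rule std_normal_cdf_mvt)
  have "phi u - phi x \<le> z - u"
    using std_normal_density_lipschitz[of u x] x by linarith
  then have "(phi u - phi x) * (z - u) \<le> (z - u) * (z - u)"
    using assms by (intro mult_right_mono) auto
  then show ?thesis using x by (simp add: tangent_def power2_eq_square algebra_simps)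
qed (simp add: tangent_def)

lemma secant_eq_right: "u < v \<Longrightarrow> secant u v z = Phi v + (Phi v - Phi u) / (v - u) * (z - v)"
  by (simp add: secant_def divide_simps) (simp add: algebra_simps)

text \<open>With \<open>tangent_uminus\<close>, the symmetry about (0, 1/2): it carries estimates
  from the right half-line to the left one and from the outer function to the inner one.\<close>

lemma secant_uminus:
  assumes "u < v"
  shows "secant (- v) (- u) (- z) = 1 - secant u v z"
proof -
  have "(Phi (- u) - Phi (- v)) / (- u - (- v)) = (Phi v - Phi u) / (v - u)"
    by (simp add: std_normal_cdf_uminus)
  then show ?thesis
    unfolding secant_eq_right[OF assms] unfolding secant_def
    by (simp add: std_normal_cdf_uminus right_diff_distrib distrib_left)
qed

text \<open>A chord of a concave function, extended beyond its end points, lies above the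
  graph.\<close>

lemma std_normal_cdf_le_secant:
  assumes "0 \<le> u" "u < v" "0 \<le> z" "z \<le> u \<or> v \<le> z"
  shows "Phi z \<le> secant u v z"
proof -
  obtain x where x: "u < x" "x < v" "Phi v - Phi u = phi x * (v - u)"
    using assms(2) by (rule std_normal_cdf_mvt)
  have slope: "(Phi v - Phi u) / (v - u) = phi x" using x assms(2) by simp
  consider "z = u" | "z = v" | "z < u" | "v < z" using assms by linarith
  then show ?thesis
  proof cases
    case 3
    then obtain y where y: "z < y" "y < u" "Phi u - Phi z = phi y * (u - z)"
      by (rule std_normal_cdf_mvt)
    have "phi x * (u - z) \<le> phi y * (u - z)"
      using assms x y by (intro mult_right_mono std_normal_density_antimono) auto
    then show ?thesis using y unfolding secant_def slope by (simp add: algebra_simps)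
  next
    case 4
    then obtain y where y: "v < y" "y < z" "Phi z - Phi v = phi y * (z - v)"
      by (rule std_normal_cdf_mvt)
    have "phi y * (z - v) \<le> phi x * (z - v)"
      using assms x y by (intro mult_right_mono std_normal_density_antimono) auto
    then show ?thesis using y unfolding secant_eq_right[OF assms(2)] slope by linarith
  qed (use assms in \<open>auto simp: secant_def\<close>)
qed

lemma secant_bounds:
  assumes "0 \<le> u" "u < v" "u \<le> z" "z \<le> v"
  shows "secant u v z \<le> Phi z" and "Phi z \<le> secant u v z + (v - u)\<^sup>2"
proof -
  have "secant u v z \<le> Phi z \<and> Phi z \<le> secant u v z + (v - u)\<^sup>2"
  proof (cases "z = u \<or> z = v")
    case False
    then have "u < z" "z < v" using assms by auto
    obtain x where x: "u < x" "x < v" "Phi v - Phi u = phi x * (v - u)"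
      using assms(2) by (rule std_normal_cdf_mvt)
    obtain y where y: "u < y" "y < z" "Phi z - Phi u = phi y * (z - u)"
      using \<open>u < z\<close> by (rule std_normal_cdf_mvt)
    obtain w where w: "z < w" "w < v" "Phi v - Phi z = phi w * (v - z)"
      using \<open>z < v\<close> by (rule std_normal_cdf_mvt)
    have slope: "(Phi v - Phi u) / (v - u) = phi x" using x assms(2) by simp
    \<comment> \<open>The chord slope \<open>phi x\<close> is a weighted mean of the slopes
      \<open>phi y\<close> and \<open>phi w\<close> of its two parts; the density decreases, so it
      is at most \<open>phi y\<close>.\<close>
    have "phi x * (v - u) = phi y * (z - u) + phi w * (v - z)" using x y w by linarith
    also have "\<dots> \<le> phi y * (z - u) + phi y * (v - z)"
      using assms y w by (intro add_left_mono mult_right_mono std_normal_density_antimono) auto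
    finally have "phi x * (v - u) \<le> phi y * (v - u)" by (simp add: algebra_simps)
    then have le: "phi x \<le> phi y" using assms by (simp add: mult_le_cancel_right)
    have "phi y - phi x \<le> v - u"
      using std_normal_density_lipschitz[of y x] x y \<open>z < v\<close> by linarith
    then have "(phi y - phi x) * (z - u) \<le> (v - u) * (v - u)"
      using assms by (intro mult_mono) auto
    moreover have "0 \<le> (phi y - phi x) * (z - u)"
      using assms le by simp
    moreover have "Phi z - secant u v z = (phi y - phi x) * (z - u)"
      unfolding secant_def slope using y by (simp add: algebra_simps)
    ultimately show ?thesis by (simp add: power2_eq_square)
  qed (use assms in \<open>auto simp: secant_def\<close>)
  then show "secant u v z \<le> Phi z" "Phi z \<le> secant u v z + (v - u)\<^sup>2" by auto
qed

section \<open>The chance constraint in closed form\<close>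

lemma scalar_prod_lessThan: "w \<in> carrier_vec n \<Longrightarrow> v \<bullet> w = (\<Sum>i<n. v $ i * w $ i)"
  by (simp add: scalar_prod_def atLeast0LessThan)

lemma scalar_prod_self_nonneg: "(v::real vec) \<bullet> v \<ge> 0"
  by (simp add: scalar_prod_def sum_nonneg)

lemma quad_mat:
  assumes "S \<in> carrier_mat n n" "v \<in> carrier_vec n"
  shows "quad n (\<lambda>i j. S $$ (i, j)) (\<lambda>i. v $ i) = v \<bullet> (S *\<^sub>v v)"
proof -
  have "v \<bullet> (S *\<^sub>v v) = (\<Sum>i<n. v $ i * (\<Sum>j<n. S $$ (i, j) * v $ j))"
    using assms by (auto simp: scalar_prod_def atLeast0LessThan intro!: sum.cong)
  then show ?thesis
    by (simp add: quad_def sum_distrib_left mult_ac)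
qed

lemma positive_definite_sym_posdef:
  assumes S: "positive_definite n S"
  shows "sym_posdef n (\<lambda>i j. S $$ (i, j))"
proof -
  have carr: "S \<in> carrier_mat n n" and tr: "S\<^sup>T = S"
    using S by (auto simp: positive_definite_def)
  have "S $$ (i, j) = S $$ (j, i)" if "i < n" "j < n" for i j
    using carr that by (subst tr[symmetric]) auto
  moreover have "quad n (\<lambda>i j. S $$ (i, j)) v > 0" if "i < n" "v i \<noteq> 0" for v i
  proof -
    have "vec n v \<noteq> 0\<^sub>v n"
    proof
      assume "vec n v = 0\<^sub>v n"
      then have "vec n v $ i = 0" using that by simp
      then show False using that by simp
    qed
    then have "0 < vec n v \<bullet> (S *\<^sub>v vec n v)"
      using S by (auto simp: positive_definite_def)
    also have "\<dots> = quad n (\<lambda>i j. S $$ (i, j)) (\<lambda>i. vec n v $ i)"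
      using carr by (simp add: quad_mat)
    also have "\<dots> = quad n (\<lambda>i j. S $$ (i, j)) v"
      by (rule quad_cong) simp
    finally show ?thesis .
  qed
  ultimately show ?thesis by (auto simp: sym_posdef_def)
qed

lemma positive_definite_det_pos:
  assumes S: "positive_definite n S"
  shows "det S > 0"
proof -
  have "mat n n (\<lambda>(i, j). S $$ (i, j)) = S"
    using S by (auto simp: positive_definite_def)
  then show ?thesis
    using det_pos[OF positive_definite_sym_posdef[OF S]] by simp
qed

text \<open>The positive determinant makes the optional inverse exist. It is positive definite
  because v.(B v) equals (B v).(S (B v)).\<close>

lemma positive_definite_inverse:
  assumes S: "positive_definite n S"
  obtains B where "mat_inverse S = Some B" "S * B = 1\<^sub>m n" "B * S = 1\<^sub>m n" "positive_definite n B"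
proof -
  have carr: "S \<in> carrier_mat n n" and tr: "S\<^sup>T = S"
    using S by (auto simp: positive_definite_def)
  have "S \<in> Units (ring_mat TYPE(real) n ())"
    using det_non_zero_imp_unit[OF carr] positive_definite_det_pos[OF S] by simp
  then obtain B where "mat_inverse S = Some B"
    using mat_inverse(1)[OF carr, where b = "()"] by (cases "mat_inverse S") auto
  moreover from mat_inverse(2)[OF carr this]
  have SB: "S * B = 1\<^sub>m n" and BS: "B * S = 1\<^sub>m n" and B: "B \<in> carrier_mat n n" by auto
  moreover have "positive_definite n B"
    unfolding positive_definite_def
  proof (intro conjI ballI impI)
    have "B\<^sup>T = B\<^sup>T * (S * B)" using B SB by simp
    also have "\<dots> = (B\<^sup>T * S\<^sup>T) * B" using B carr tr by (simp add: assoc_mult_mat[of _ n n _ n _ n])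
    also have "\<dots> = (S * B)\<^sup>T * B" using B carr by (simp add: transpose_mult[of _ n n _ n])
    also have "\<dots> = B" using B SB by simp
    finally show "B\<^sup>T = B" .
    fix v :: "real vec" assume v: "v \<in> carrier_vec n" "v \<noteq> 0\<^sub>v n"
    have Bv: "B *\<^sub>v v \<in> carrier_vec n" using B v by auto
    have SBv: "S *\<^sub>v (B *\<^sub>v v) = v"
      using v SB by (simp add: assoc_mult_mat_vec[OF carr B v(1), symmetric])
    have "S *\<^sub>v 0\<^sub>v n = 0\<^sub>v n" using carr by (intro eq_vecI) auto
    then have "B *\<^sub>v v \<noteq> 0\<^sub>v n" using SBv v by auto
    then have "0 < (B *\<^sub>v v) \<bullet> (S *\<^sub>v (B *\<^sub>v v))"
      using S Bv by (auto simp: positive_definite_def)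
    then show "0 < v \<bullet> (B *\<^sub>v v)"
      using v Bv unfolding SBv by (simp add: comm_scalar_prod[of _ n])
  qed (rule B)
  ultimately show thesis using that by blast
qed

text \<open>This is \<open>gauss_nn_integral\<close> with the inverse covariance as \<open>Q\<close>
  and \<open>u = S x\<close>: then Q u = x is the given linear form and u.(Q u) = x.(S x) its
  variance.\<close>

lemma mvn_nn_integral:
  assumes S: "positive_definite n S" and m: "m \<in> carrier_vec n" and x: "x \<in> carrier_vec n"
    and [measurable]: "f \<in> borel_measurable borel"
  shows "(\<integral>\<^sup>+ y. ennreal (mvn_density n m S (vec n y)) * f (vec n y \<bullet> x) \<partial>(\<Pi>\<^sub>M i\<in>{..<n}. lborel))
    = gauss_avg (sqrt (x \<bullet> (S *\<^sub>v x))) (\<lambda>t. f (m \<bullet> x + t))"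
proof -
  obtain B where inv: "mat_inverse S = Some B" and SB: "S * B = 1\<^sub>m n" and BS: "B * S = 1\<^sub>m n"
    and B: "positive_definite n B"
    using positive_definite_inverse[OF S] .
  have carr: "S \<in> carrier_mat n n" "B \<in> carrier_mat n n"
    using S B by (auto simp: positive_definite_def)
  have mat_B: "mat n n (\<lambda>(i, j). B $$ (i, j)) = B" using carr by auto
  have Sx: "S *\<^sub>v x \<in> carrier_vec n" using carr x by auto
  have BSx: "B *\<^sub>v (S *\<^sub>v x) = x"
    using x BS by (simp add: assoc_mult_mat_vec[OF carr(2) carr(1) x, symmetric])
  have det: "det S * det B = 1"
    using det_mult[OF carr] SB by simp
  let ?Q = "\<lambda>i j. B $$ (i, j)" and ?u = "\<lambda>j. (S *\<^sub>v x) $ j"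
  have lin: "(\<Sum>j<n. ?Q i j * ?u j) = x $ i" if "i < n" for i
  proof -
    have "(\<Sum>j<n. ?Q i j * ?u j) = (B *\<^sub>v (S *\<^sub>v x)) $ i"
      using carr that Sx by (auto simp: scalar_prod_lessThan intro!: sum.cong)
    then show ?thesis by (simp add: BSx)
  qed
  have "(\<integral>\<^sup>+ y. ennreal (mvn_density n m S (vec n y)) * f (vec n y \<bullet> x) \<partial>(\<Pi>\<^sub>M i\<in>{..<n}. lborel))
    = (\<integral>\<^sup>+ y. ennreal (sqrt (det (mat n n (\<lambda>(i, j). ?Q i j)) / (2 * pi) ^ n)
              * exp (- quad n ?Q (\<lambda>i. y i - m $ i) / 2))
            * f (m \<bullet> x + (\<Sum>i<n. (\<Sum>j<n. ?Q i j * ?u j) * (y i - m $ i))) \<partial>(\<Pi>\<^sub>M i\<in>{..<n}. lborel))"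
  proof (intro nn_integral_cong arg_cong2[of _ _ _ _ "(*)"] arg_cong[of _ _ ennreal] arg_cong[of _ _ f])
    fix y :: "nat \<Rightarrow> real"
    have vm: "vec n y - m \<in> carrier_vec n" using m by auto
    have "(vec n y - m) \<bullet> (B *\<^sub>v (vec n y - m)) = quad n ?Q (\<lambda>i. (vec n y - m) $ i)"
      using quad_mat[OF carr(2) vm] by simp
    also have "\<dots> = quad n ?Q (\<lambda>i. y i - m $ i)"
      using m by (intro quad_cong) auto
    finally show "mvn_density n m S (vec n y) = sqrt (det (mat n n (\<lambda>(i, j). ?Q i j)) / (2 * pi) ^ n)
              * exp (- quad n ?Q (\<lambda>i. y i - m $ i) / 2)"
      using det positive_definite_det_pos[OF S] unfolding mat_B
      by (simp add: mvn_density_def inv real_sqrt_divide real_sqrt_mult divide_simps)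
         (simp add: real_sqrt_mult[symmetric] mult.commute)
    have "(\<Sum>i<n. (\<Sum>j<n. ?Q i j * ?u j) * (y i - m $ i)) = (\<Sum>i<n. x $ i * (y i - m $ i))"
      by (simp add: lin)
    also have "\<dots> = vec n y \<bullet> x - m \<bullet> x"
      using x by (simp add: scalar_prod_lessThan[OF x] right_diff_distrib sum_subtractf mult.commute)
    finally show "vec n y \<bullet> x = m \<bullet> x + (\<Sum>i<n. (\<Sum>j<n. ?Q i j * ?u j) * (y i - m $ i))"
      by simp
  qed
  also have "\<dots> = gauss_avg (sqrt (quad n ?Q ?u)) (\<lambda>t. f (m \<bullet> x + t))"
    by (rule gauss_nn_integral[OF positive_definite_sym_posdef[OF B], where f = "\<lambda>t. f (m \<bullet> x + t)"]) measurable
  also have "quad n ?Q ?u = x \<bullet> (S *\<^sub>v x)"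
    using x Sx by (simp add: quad_mat[OF carr(2) Sx] BSx comm_scalar_prod[of _ n])
  finally show ?thesis .
qed

lemma std_normal_cdf_nn_integral:
  "ennreal (std_normal_cdf t) = (\<integral>\<^sup>+ s. ennreal (std_normal_density s) * indicator {..t} s \<partial>lborel)"
proof -
  interpret prob_space std_normal_distribution by (rule prob_space_normal_density) simp
  show ?thesis
    by (simp add: std_normal_cdf_def cdf_def emeasure_eq_measure[symmetric] emeasure_density)
qed

text \<open>The value contributed by one mixture component when \<open>\<Phi>\<close> is replaced by \<open>F\<close>; \<open>hi\<close> and \<open>lo\<close>
  are the values of \<open>F\<close> at \<open>\<infinity>\<close> and \<open>-\<infinity>\<close>, used for \<open>x = 0\<close>, i.e. for zero variance \<open>v\<close>.\<close>

definition comp_val :: "(real \<Rightarrow> real) \<Rightarrow> real \<Rightarrow> real \<Rightarrow> real \<Rightarrow> real \<Rightarrow> real \<Rightarrow> real" where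
  "comp_val F hi lo b a v =
     (if v = 0 then (if b \<ge> 0 then hi else lo) else F ((b - a) / sqrt v))"

text \<open>With \<open>std_normal_cdf\<close>, 1 and 0 this is the function p of the problem; with
  the piecewise linear functions it is the constraint that remains after elimination of z, \<zeta>
  and \<lambda> from the approximation problems.\<close>

definition mix_val :: "(real \<Rightarrow> real) \<Rightarrow> real \<Rightarrow> real \<Rightarrow> ccp \<Rightarrow> real vec \<Rightarrow> real" where
  "mix_val F hi lo P x = (\<Sum>k<ncomp P.
     weight P k * comp_val F hi lo (bound P) (mean P k \<bullet> x) (x \<bullet> (covar P k *\<^sub>v x)))"

lemma positive_definite_quad_eq_0_iff:
  assumes "positive_definite n S" "x \<in> carrier_vec n"
  shows "x \<bullet> (S *\<^sub>v x) = 0 \<longleftrightarrow> x = 0\<^sub>v n"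
  using assms by (auto simp: positive_definite_def scalar_prod_def)

lemma mvn_halfspace:
  assumes S: "positive_definite n S" and m: "m \<in> carrier_vec n" and x: "x \<in> carrier_vec n"
  shows "(\<integral>\<^sup>+ y. ennreal (mvn_density n m S (vec n y)) * indicator {..b} (vec n y \<bullet> x) \<partial>(\<Pi>\<^sub>M i\<in>{..<n}. lborel))
    = ennreal (comp_val std_normal_cdf 1 0 b (m \<bullet> x) (x \<bullet> (S *\<^sub>v x)))"
proof -
  let ?v = "x \<bullet> (S *\<^sub>v x)"
  have "(\<integral>\<^sup>+ y. ennreal (mvn_density n m S (vec n y)) * indicator {..b} (vec n y \<bullet> x) \<partial>(\<Pi>\<^sub>M i\<in>{..<n}. lborel))
    = gauss_avg (sqrt ?v) (\<lambda>t. indicator {..b} (m \<bullet> x + t))"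
    by (rule mvn_nn_integral[OF S m x]) measurable
  also have "\<dots> = ennreal (comp_val std_normal_cdf 1 0 b (m \<bullet> x) ?v)"
  proof (cases "?v = 0")
    \<comment> \<open>The law is a point mass at 0, and the indicator there is 1 or 0 by the sign of
      \<open>b\<close>: the source of \<open>hi = 1\<close> and \<open>lo = 0\<close>.\<close>
    case True
    then have "x = 0\<^sub>v n" using positive_definite_quad_eq_0_iff[OF S x] by simp
    then show ?thesis using True m by (simp add: comp_val_def)
  next
    case False
    then have "x \<noteq> 0\<^sub>v n" using positive_definite_quad_eq_0_iff[OF S x] by simp
    then have v: "?v > 0" using S x by (auto simp: positive_definite_def)
    then have "indicator {..b} (m \<bullet> x + sqrt ?v * t) = (indicator {..(b - m \<bullet> x) / sqrt ?v} t :: ennreal)" for t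
      by (auto simp: indicator_def field_simps)
    then show ?thesis
      using v by (simp add: gauss_avg_def comp_val_def std_normal_cdf_nn_integral)
  qed
  finally show ?thesis .
qed

lemma prob_le_eq_mix_val:
  assumes wf: "well_formed P" and pd: "covar_pos_def P" and x: "x \<in> carrier_vec (ndim P)"
  shows "prob_le P x = mix_val std_normal_cdf 1 0 P x"
proof -
  let ?n = "ndim P" and ?M = "\<Pi>\<^sub>M i\<in>{..<ndim P}. (lborel :: real measure)"
  have S: "positive_definite ?n (covar P k)" and m: "mean P k \<in> carrier_vec ?n" and w: "weight P k \<ge> 0"
    if "k < ncomp P" for k
    using wf pd that by (auto simp: well_formed_def covar_pos_def_def)
  have meas_lin: "(\<lambda>y. vec ?n y \<bullet> x) \<in> borel_measurable ?M"
    using x by (simp add: scalar_prod_lessThan[OF x])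
  have meas_mvn: "(\<lambda>y. mvn_density ?n (mean P k) (covar P k) (vec ?n y)) \<in> borel_measurable ?M"
    if k: "k < ncomp P" for k
  proof -
    obtain B where inv: "mat_inverse (covar P k) = Some B" and B: "positive_definite ?n B"
      using positive_definite_inverse[OF S[OF k]] by metis
    have vm: "vec ?n y - mean P k \<in> carrier_vec ?n" for y using m[OF k] by auto
    have carr: "B \<in> carrier_mat ?n ?n" using B by (simp add: positive_definite_def)
    \<comment> \<open>Measurability of the density: its exponent is a polynomial in the
      coordinates.\<close>
    have "(vec ?n y - mean P k) \<bullet> (B *\<^sub>v (vec ?n y - mean P k))
       = quad ?n (\<lambda>i j. B $$ (i, j)) (\<lambda>i. y i - mean P k $ i)" for y
      unfolding quad_mat[OF carr vm, symmetric] using m[OF k] by (intro quad_cong) auto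
    then show ?thesis
      unfolding mvn_density_def inv option.sel by (simp add: quad_def)
  qed
  have nonneg: "mvn_density ?n (mean P k) (covar P k) y \<ge> 0" if "k < ncomp P" for k y
    using positive_definite_det_pos[OF S[OF that]] by (simp add: mvn_density_def)
  let ?A = "{y \<in> space (mixture_law P). vec ?n y \<bullet> x \<le> bound P}"
  have A: "?A \<in> sets ?M"
    using meas_lin by (simp add: mixture_law_def)
  have meas_mix: "(\<lambda>y. ennreal (mixture_density P (vec ?n y))) \<in> borel_measurable ?M"
    unfolding mixture_density_def using meas_mvn by (intro measurable_compose[OF _ measurable_ennreal] borel_measurable_sum borel_measurable_times) auto
  have "emeasure (mixture_law P) ?A = (\<integral>\<^sup>+ y. ennreal (mixture_density P (vec ?n y)) * indicator ?A y \<partial>?M)"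
    unfolding mixture_law_def using meas_mix A by (subst emeasure_density) (auto simp: mixture_law_def)
  also have "\<dots> = (\<integral>\<^sup>+ y. (\<Sum>k<ncomp P. ennreal (weight P k) *
      (ennreal (mvn_density ?n (mean P k) (covar P k) (vec ?n y)) * indicator {..bound P} (vec ?n y \<bullet> x))) \<partial>?M)"
  proof (rule nn_integral_cong)
    fix y assume y: "y \<in> space ?M"
    have "ennreal (mixture_density P (vec ?n y)) = (\<Sum>k<ncomp P. ennreal (weight P k) *
      ennreal (mvn_density ?n (mean P k) (covar P k) (vec ?n y)))"
      unfolding mixture_density_def using w nonneg
      by (subst sum_ennreal[symmetric]) (auto simp: ennreal_mult intro!: sum.cong)
    moreover have "(indicator ?A y :: ennreal) = indicator {..bound P} (vec ?n y \<bullet> x)"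
      using y by (auto simp: indicator_def mixture_law_def)
    ultimately show "ennreal (mixture_density P (vec ?n y)) * indicator ?A y = (\<Sum>k<ncomp P. ennreal (weight P k) *
      (ennreal (mvn_density ?n (mean P k) (covar P k) (vec ?n y)) * indicator {..bound P} (vec ?n y \<bullet> x)))"
      by (simp add: sum_distrib_right mult.assoc)
  qed
  also have "\<dots> = (\<Sum>k<ncomp P. ennreal (weight P k) *
     (\<integral>\<^sup>+ y. ennreal (mvn_density ?n (mean P k) (covar P k) (vec ?n y)) * indicator {..bound P} (vec ?n y \<bullet> x) \<partial>?M))"
    using meas_lin meas_mvn by (subst nn_integral_sum) (auto intro!: sum.cong nn_integral_cmult)
  also have "\<dots> = (\<Sum>k<ncomp P. ennreal (weight P k *
     comp_val std_normal_cdf 1 0 (bound P) (mean P k \<bullet> x) (x \<bullet> (covar P k *\<^sub>v x))))"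
    using w by (auto simp: mvn_halfspace[OF S m x] ennreal_mult' intro!: sum.cong)
  also have "\<dots> = ennreal (mix_val std_normal_cdf 1 0 P x)"
    unfolding mix_val_def using w by (subst sum_ennreal) (auto simp: comp_val_def std_normal_cdf_nonneg)
  finally have "emeasure (mixture_law P) ?A = ennreal (mix_val std_normal_cdf 1 0 P x)" .
  moreover have "mix_val std_normal_cdf 1 0 P x \<ge> 0"
    unfolding mix_val_def using w by (intro sum_nonneg) (auto simp: comp_val_def std_normal_cdf_nonneg)
  ultimately show ?thesis
    by (simp add: prob_le_def measure_def)
qed

section \<open>Piecewise linear bounds on a uniform mesh\<close>

lemma continuous_on_MIN:
  fixes f :: "'i \<Rightarrow> 'a::topological_space \<Rightarrow> real"
  assumes "finite I" "I \<noteq> {}" "\<And>i. i \<in> I \<Longrightarrow> continuous_on S (f i)"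
  shows "continuous_on S (\<lambda>x. MIN i\<in>I. f i x)"
  using assms by (induction rule: finite_ne_induct) (auto intro: continuous_on_min)

lemma continuous_on_MAX:
  fixes f :: "'i \<Rightarrow> 'a::topological_space \<Rightarrow> real"
  assumes "finite I" "I \<noteq> {}" "\<And>i. i \<in> I \<Longrightarrow> continuous_on S (f i)"
  shows "continuous_on S (\<lambda>x. MAX i\<in>I. f i x)"
  using assms by (induction rule: finite_ne_induct) (auto intro: continuous_on_max)

lemma MIN_mono:
  fixes f g :: "'i \<Rightarrow> real"
  assumes "finite I" "I \<noteq> {}" "\<And>i. i \<in> I \<Longrightarrow> f i \<le> g i"
  shows "(MIN i\<in>I. f i) \<le> (MIN i\<in>I. g i)"
proof -
  have "(MIN i\<in>I. g i) \<in> g ` I" using assms by (intro Min_in) auto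
  then obtain i where i: "(MIN i\<in>I. g i) = g i" "i \<in> I" by (rule imageE)
  have "(MIN i\<in>I. f i) \<le> f i" using i assms by simp
  also have "\<dots> \<le> g i" using i assms by simp
  finally show ?thesis using i by simp
qed

lemma one_minus_MIN:
  fixes f :: "'i \<Rightarrow> real"
  assumes "finite I" "I \<noteq> {}"
  shows "1 - (MIN i\<in>I. f i) = (MAX i\<in>I. 1 - f i)"
proof (rule Max_eqI[symmetric])
  have "(MIN i\<in>I. f i) \<in> f ` I" using assms by (intro Min_in) auto
  then obtain i where "(MIN i\<in>I. f i) = f i" "i \<in> I" by (rule imageE)
  then show "1 - (MIN i\<in>I. f i) \<in> (\<lambda>i. 1 - f i) ` I" by auto
qed (use assms in auto)

lemma one_minus_MAX:
  fixes f :: "'i \<Rightarrow> real"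
  assumes "finite I" "I \<noteq> {}"
  shows "1 - (MAX i\<in>I. f i) = (MIN i\<in>I. 1 - f i)"
  using one_minus_MIN[OF assms, of "\<lambda>i. 1 - f i"] by simp

lemma MAX_mono:
  fixes f g :: "'i \<Rightarrow> real"
  assumes "finite I" "I \<noteq> {}" "\<And>i. i \<in> I \<Longrightarrow> f i \<le> g i"
  shows "(MAX i\<in>I. f i) \<le> (MAX i\<in>I. g i)"
  using MIN_mono[OF assms(1,2), of "\<lambda>i. 1 - g i" "\<lambda>i. 1 - f i"] assms(3)
  unfolding one_minus_MAX[OF assms(1,2), symmetric] by simp

text \<open>The properties that \<Phi> and its substitutes share and that compactness and
  elimination rely on. The limits are parameters because an outer function need not tend to 0, nor
  an inner one to 1.\<close>

definition cdf_like :: "(real \<Rightarrow> real) \<Rightarrow> real \<Rightarrow> real \<Rightarrow> bool" where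
  "cdf_like F hi lo \<longleftrightarrow> continuous_on UNIV F \<and> mono F \<and> (\<forall>z. 0 \<le> F z \<and> F z \<le> 1)
     \<and> (F \<longlongrightarrow> hi) at_top \<and> (F \<longlongrightarrow> lo) at_bot"

lemma cdf_like_std_normal: "cdf_like Phi 1 0"
  by (auto simp: cdf_like_def std_normal_cdf_continuous std_normal_cdf_mono std_normal_cdf_le_1
      std_normal_cdf_at_top std_normal_cdf_at_bot std_normal_cdf_nonneg intro!: monoI)

section \<open>The outer function on a uniform symmetric mesh\<close>

definition mesh :: "real \<Rightarrow> int \<Rightarrow> real" where
  "mesh h i = h * of_int i"

text \<open>This and \<open>upper_left\<close> are the two branches of \<open>upper_cdf\<close>
  freed from the case distinction at 0, so that each is monotone and continuous on the whole
  line.\<close>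

definition upper_right :: "real \<Rightarrow> nat \<Rightarrow> real \<Rightarrow> real" where
  "upper_right h N z = min 1 (MIN i\<in>{0..N}. tangent (h * real i) z)"

definition upper_left :: "real \<Rightarrow> nat \<Rightarrow> real \<Rightarrow> real" where
  "upper_left h N z = max (Phi (- (h * real N))) (MAX i\<in>{1..N}. secant (- (h * real i)) (- (h * (real i - 1))) z)"

lemma upper_cdf_mesh:
  "upper_cdf N N (mesh h) z = (if z \<ge> 0 then upper_right h N z else upper_left h N z)"
  unfolding upper_cdf_def upper_right_def upper_left_def mesh_def
  by (simp add: right_diff_distrib distrib_left)

lemma tangent_mono: "x \<le> y \<Longrightarrow> tangent u x \<le> tangent u y"
  by (simp add: tangent_def mult_left_mono)

lemma secant_mono: "u < v \<Longrightarrow> x \<le> y \<Longrightarrow> secant u v x \<le> secant u v y"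
  unfolding secant_def
  by (intro add_left_mono mult_left_mono divide_nonneg_pos) (auto simp: std_normal_cdf_mono)

lemma tangent_continuous: "continuous_on S (tangent u)"
  unfolding tangent_def by (intro continuous_intros)

lemma secant_continuous: "continuous_on S (secant u v)"
  unfolding secant_def by (intro continuous_intros)

context
  fixes h :: real and N :: nat
  assumes h: "h > 0" and N: "N > 0"
begin

lemma upper_right_continuous: "continuous_on S (upper_right h N)"
  unfolding upper_right_def by (intro continuous_on_min continuous_on_MIN continuous_intros tangent_continuous) auto

lemma upper_left_continuous: "continuous_on S (upper_left h N)"
  unfolding upper_left_def using N by (intro continuous_on_max continuous_on_MAX continuous_intros secant_continuous) auto

lemma upper_right_mono: "x \<le> y \<Longrightarrow> upper_right h N x \<le> upper_right h N y"
  unfolding upper_right_def by (intro min.mono MIN_mono tangent_mono) auto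

lemma upper_left_mono: "x \<le> y \<Longrightarrow> upper_left h N x \<le> upper_left h N y"
  unfolding upper_left_def using h N by (intro max.mono MAX_mono secant_mono) auto

lemma upper_right_ge:
  assumes "z \<ge> 0"
  shows "Phi z \<le> upper_right h N z"
  unfolding upper_right_def using assms h
  by (auto simp: std_normal_cdf_le_1 intro!: std_normal_cdf_le_tangent)

text \<open>Beyond the last breakpoint the cap 1 is within the tail of \<Phi>; before it, the
  tangent at the nearest breakpoint on the left is within h^2.\<close>

lemma upper_right_le:
  assumes z: "z \<ge> 0" and tail: "1 - Phi (h * real N) \<le> t" and step: "h\<^sup>2 \<le> t"
  shows "upper_right h N z \<le> Phi z + t"
proof (cases "z \<ge> h * real N")
  case True
  have "upper_right h N z \<le> 1" unfolding upper_right_def by simp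
  then show ?thesis using std_normal_cdf_mono[OF True] tail by linarith
next
  case False
  define i where "i = nat \<lfloor>z / h\<rfloor>"
  have i: "real i = of_int \<lfloor>z / h\<rfloor>" using z h by (simp add: i_def)
  have "real i \<le> z / h" "z / h < real i + 1" unfolding i by linarith+
  then have zi: "h * real i \<le> z" "z \<le> h * real i + h" using h by (auto simp: field_simps)
  have "h * real i < h * real N" using zi False by linarith
  then have "i \<le> N" using h by simp
  then have "upper_right h N z \<le> tangent (h * real i) z"
    unfolding upper_right_def by (intro min.coboundedI2 Min_le) auto
  also have "\<dots> \<le> Phi z + (z - h * real i)\<^sup>2" using zi by (intro tangent_le_std_normal_cdf) auto
  also have "(z - h * real i)\<^sup>2 \<le> h\<^sup>2" using zi by (intro power_mono) auto
  finally show ?thesis using step by linarith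
qed

text \<open>\<Phi> is convex on the negative half-line, so the secant over the cell of z lies above
  it; to the left of the mesh the constant does.\<close>

lemma upper_left_ge:
  assumes z: "z \<le> 0"
  shows "Phi z \<le> upper_left h N z"
proof (cases "z \<le> - (h * real N)")
  case True
  then show ?thesis
    unfolding upper_left_def by (intro max.coboundedI1 std_normal_cdf_mono)
next
  case False
  define i where "i = nat \<lfloor>- z / h\<rfloor>"
  have i: "real i = of_int \<lfloor>- z / h\<rfloor>" using z h by (simp add: i_def divide_nonpos_pos)
  have "real i \<le> - z / h" "- z / h < real i + 1" unfolding i by linarith+
  then have zi: "h * real i \<le> - z" "- z \<le> h * (real i + 1)" using h by (auto simp: field_simps)
  have "h * real i < h * real N" using zi False by linarith
  then have iN: "i < N" using h by simp
  have "1 - Phi (- z) \<le> 1 - secant (h * real i) (h * (real i + 1)) (- z)"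
    using zi h secant_bounds(1)[of "h * real i" "h * (real i + 1)" "- z"] by simp
  \<comment> \<open>\<open>upper_left\<close> counts its cells from 1, so the cell between h i and h
    (i + 1) has number \<open>Suc i\<close>.\<close>
  also have "\<dots> = secant (- (h * real (Suc i))) (- (h * (real (Suc i) - 1))) z"
    using secant_uminus[of "h * real i" "h * (real i + 1)" "- z"] h by (simp add: add.commute)
  also have "\<dots> \<le> upper_left h N z"
    unfolding upper_left_def using iN
    by (intro max.coboundedI2 Max_ge imageI finite_imageI) auto
  finally show ?thesis by (simp add: std_normal_cdf_uminus)
qed

text \<open>By convexity a secant can exceed \<Phi> only over its own cell. The second bound, free
  of the error term, is what makes the outer function constant to the left of the mesh.\<close>

lemma secant_left_le:
  assumes z: "z \<le> 0" and i: "1 \<le> i"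
  shows "secant (- (h * real i)) (- (h * (real i - 1))) z \<le> Phi z + h\<^sup>2"
    and "z \<le> - (h * real i) \<Longrightarrow> secant (- (h * real i)) (- (h * (real i - 1))) z \<le> Phi z"
proof -
  let ?u = "h * (real i - 1)" and ?v = "h * real i"
  have uv: "0 \<le> ?u" "?u < ?v" using h i by (auto simp: algebra_simps)
  have eq: "secant (- ?v) (- ?u) z = 1 - secant ?u ?v (- z)"
    using secant_uminus[OF uv(2), of "- z"] by simp
  have out: "secant (- ?v) (- ?u) z \<le> Phi z" if "- z \<le> ?u \<or> ?v \<le> - z"
    using std_normal_cdf_le_secant[OF uv _ that] z unfolding eq by (simp add: std_normal_cdf_uminus)
  show "secant (- ?v) (- ?u) z \<le> Phi z + h\<^sup>2"
  proof (cases "- z \<le> ?u \<or> ?v \<le> - z")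
    case True
    then show ?thesis using out by (simp add: add_increasing2)
  next
    case False
    then have "Phi (- z) \<le> secant ?u ?v (- z) + (?v - ?u)\<^sup>2"
      using uv by (intro secant_bounds) auto
    also have "?v - ?u = h" by (simp add: algebra_simps)
    finally show ?thesis unfolding eq by (simp add: std_normal_cdf_uminus)
  qed
  show "secant (- ?v) (- ?u) z \<le> Phi z" if "z \<le> - ?v"
    using out that by simp
qed

lemma std_normal_cdf_left_end_le:
  assumes tail: "1 - Phi (h * real N) \<le> t"
  shows "Phi (- (h * real N)) \<le> Phi z + t"
  using tail std_normal_cdf_uminus[of "h * real N"] std_normal_cdf_nonneg[of z] by simp

lemma upper_left_le:
  assumes z: "z \<le> 0" and tail: "1 - Phi (h * real N) \<le> t" and step: "h\<^sup>2 \<le> t"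
  shows "upper_left h N z \<le> Phi z + t"
proof -
  have "secant (- (h * real i)) (- (h * (real i - 1))) z \<le> Phi z + t" if "1 \<le> i" for i
    using secant_left_le(1)[OF z that] step by linarith
  then show ?thesis
    unfolding upper_left_def using N std_normal_cdf_left_end_le[OF tail] by auto
qed

lemma upper_left_eq:
  assumes z: "z \<le> - (h * real N)"
  shows "upper_left h N z = Phi (- (h * real N))"
proof -
  have "0 \<le> h * real N" using h by simp
  then have z0: "z \<le> 0" using z by linarith
  have "secant (- (h * real i)) (- (h * (real i - 1))) z \<le> Phi (- (h * real N))" if "i \<in> {1..N}" for i
  proof -
    have "h * real i \<le> h * real N" using that h by simp
    then have "secant (- (h * real i)) (- (h * (real i - 1))) z \<le> Phi z"
      using secant_left_le(2)[OF z0] that z by auto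
    then show ?thesis using std_normal_cdf_mono[OF z] by linarith
  qed
  then show ?thesis
    unfolding upper_left_def using N by (intro max_absorb1) auto
qed

text \<open>The finitely many tangents all have slope at least phi (h N) > 0, so eventually all
  exceed the cap 1. Attaining the value 1, beyond tending to it, is what
  \<open>approx_feasible_iff\<close> asks for at the origin.\<close>

lemma upper_right_eq_1: "\<exists>Z. \<forall>z\<ge>Z. upper_right h N z = 1"
proof (intro exI allI impI)
  let ?M = "h * real N"
  have M: "?M \<ge> 0" using h by simp
  have pos: "phi ?M > 0" by (simp add: std_normal_density_def)
  fix z assume z: "z \<ge> ?M + 1 / phi ?M"
  then have zM: "z - ?M \<ge> 1 / phi ?M" by simp
  have "1 / phi ?M > 0" using pos by simp
  then have zM': "z - ?M \<ge> 0" using zM by linarith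
  have "1 \<le> tangent (h * real i) z" if "i \<le> N" for i
  proof -
    have iN: "h * real i \<le> ?M" using that h by simp
    have "1 = phi ?M * (1 / phi ?M)" using pos by simp
    also have "\<dots> \<le> phi ?M * (z - ?M)" using pos zM by (intro mult_left_mono) auto
    also have "\<dots> \<le> phi (h * real i) * (z - h * real i)"
      using iN zM' h by (intro mult_mono std_normal_density_antimono) auto
    finally show ?thesis
      unfolding tangent_def using cdf_like_std_normal by (simp add: cdf_like_def add_increasing)
  qed
  then show "upper_right h N z = 1"
    unfolding upper_right_def by (intro min_absorb1) auto
qed

text \<open>The tangent at the breakpoint 0 passes through (0, 1/2). Together with
  \<open>upper_left_0\<close> this glues the branches: continuity and monotonicity across 0 rest on
  it.\<close>

lemma upper_right_0: "upper_right h N 0 = 1 / 2"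
proof (rule antisym)
  have "upper_right h N 0 \<le> tangent (h * real 0) 0"
    unfolding upper_right_def
    by (rule min.coboundedI2[OF Min_le[OF _ imageI[of 0 "{0..N}" "\<lambda>i. tangent (h * real i) 0"]]]) auto
  then show "upper_right h N 0 \<le> 1 / 2" by (simp add: tangent_def std_normal_cdf_0)
  show "1 / 2 \<le> upper_right h N 0" using upper_right_ge[of 0] by (simp add: std_normal_cdf_0)
qed

lemma upper_left_0: "upper_left h N 0 = 1 / 2"
proof (rule antisym)
  have A: "secant (- (h * real i)) (- (h * (real i - 1))) 0 \<le> 1 / 2" if "1 \<le> i" for i
  proof -
    let ?u = "h * (real i - 1)" and ?v = "h * real i"
    have uv: "0 \<le> ?u" "?u < ?v" using h that by (auto simp: algebra_simps)
    then show ?thesis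
      using std_normal_cdf_le_secant[OF uv, of 0] secant_uminus[OF uv(2), of 0] by (simp add: std_normal_cdf_0)
  qed
  have "Phi (- (h * real N)) \<le> 1 / 2"
    using std_normal_cdf_mono[of "- (h * real N)" 0] h by (simp add: std_normal_cdf_0)
  then show "upper_left h N 0 \<le> 1 / 2"
    unfolding upper_left_def by (intro max.boundedI Max.boundedI) (use N A in auto)
  show "1 / 2 \<le> upper_left h N 0" using upper_left_ge[of 0] by (simp add: std_normal_cdf_0)
qed

lemma upper_cdf_mesh_bounds:
  assumes "1 - Phi (h * real N) \<le> t" "h\<^sup>2 \<le> t"
  shows "Phi z \<le> upper_cdf N N (mesh h) z" "upper_cdf N N (mesh h) z \<le> Phi z + t"
  using upper_right_ge upper_left_ge upper_right_le[OF _ assms] upper_left_le[OF _ assms]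
  unfolding upper_cdf_mesh by auto

lemma upper_cdf_mesh_mono: "mono (upper_cdf N N (mesh h))"
proof (rule monoI)
  fix x y :: real assume xy: "x \<le> y"
  show "upper_cdf N N (mesh h) x \<le> upper_cdf N N (mesh h) y"
  proof (cases "x < 0 \<and> 0 \<le> y")
    case True
    then show ?thesis
      using upper_left_mono[of x 0] upper_right_mono[of 0 y] upper_left_0 upper_right_0
      unfolding upper_cdf_mesh by auto
  next
    case False
    then show ?thesis
      using xy upper_left_mono upper_right_mono unfolding upper_cdf_mesh by auto
  qed
qed

lemma upper_cdf_mesh_continuous: "continuous_on UNIV (upper_cdf N N (mesh h))"
proof -
  have "continuous_on ({0..} \<union> {..0}) (\<lambda>z. if z \<ge> 0 then upper_right h N z else upper_left h N z)"
    by (intro continuous_on_cases upper_right_continuous upper_left_continuous)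
       (auto simp: upper_right_0 upper_left_0)
  moreover have "{0..} \<union> {..0::real} = UNIV" by auto
  ultimately show ?thesis by (simp add: upper_cdf_mesh cong: continuous_on_cong)
qed

lemma upper_cdf_mesh_eq_1: "\<exists>Z. \<forall>z\<ge>Z. upper_cdf N N (mesh h) z = 1"
proof -
  obtain Z where "\<forall>z\<ge>Z. upper_right h N z = 1" using upper_right_eq_1 by blast
  then show ?thesis unfolding upper_cdf_mesh by (intro exI[of _ "max Z 0"]) auto
qed

lemma upper_cdf_mesh_eq_left:
  assumes "z \<le> - (h * real N)"
  shows "upper_cdf N N (mesh h) z = Phi (- (h * real N))"
proof -
  have "h * real N > 0" using h N by simp
  then show ?thesis unfolding upper_cdf_mesh using upper_left_eq[OF assms] assms by auto
qed

lemma upper_cdf_mesh_cdf_like: "cdf_like (upper_cdf N N (mesh h)) 1 (Phi (- (h * real N)))"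
  unfolding cdf_like_def
proof (intro conjI allI upper_cdf_mesh_continuous upper_cdf_mesh_mono)
  let ?F = "upper_cdf N N (mesh h)"
  obtain Z where Z: "\<forall>z\<ge>Z. ?F z = 1" using upper_cdf_mesh_eq_1 by blast
  show "(?F \<longlongrightarrow> 1) at_top"
    by (rule tendsto_eventually) (use Z in \<open>auto simp: eventually_at_top_linorder\<close>)
  show "(?F \<longlongrightarrow> Phi (- (h * real N))) at_bot"
    by (rule tendsto_eventually) (use upper_cdf_mesh_eq_left in \<open>auto simp: eventually_at_bot_linorder\<close>)
  fix z
  have "?F z \<le> ?F (max z Z)" by (rule monoD[OF upper_cdf_mesh_mono]) simp
  then show "?F z \<le> 1" using Z by simp
  have "?F (min z (- (h * real N))) \<le> ?F z" by (rule monoD[OF upper_cdf_mesh_mono]) simp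
  then show "0 \<le> ?F z"
    using upper_cdf_mesh_eq_left[of "min z (- (h * real N))"] cdf_like_std_normal
    by (simp add: cdf_like_def) (metis order_trans)
qed

text \<open>The symmetric mesh makes the inner function a point reflection of the outer one:
  complement turns minima into maxima, and reflected tangents and secants are again tangents and
  secants.\<close>

lemma lower_cdf_mesh: "lower_cdf N N (mesh h) z = 1 - upper_cdf N N (mesh h) (- z)"
proof -
  consider "z < 0" | "z > 0" | "z = 0" by linarith
  then show ?thesis
  proof cases
    case 1
    have g: "1 - min 1 m = max 0 (1 - m)" for m :: real
      by (auto simp: min_def max_def)
    have "1 - min 1 (MIN i\<in>{0..N}. tangent (h * real i) (- z)) = max 0 (1 - (MIN i\<in>{0..N}. tangent (h * real i) (- z)))"
      by (rule g)
    also have "1 - (MIN i\<in>{0..N}. tangent (h * real i) (- z)) = (MAX i\<in>{0..N}. 1 - tangent (h * real i) (- z))"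
      by (rule one_minus_MIN) auto
    also have "(\<lambda>i. 1 - tangent (h * real i) (- z)) = (\<lambda>i. tangent (- (h * real i)) z)"
      using tangent_uminus[of _ "- z"] by auto
    finally show ?thesis
      using 1 unfolding upper_cdf_mesh upper_right_def lower_cdf_def mesh_def by simp
  next
    case 2
    have g: "1 - max (Phi (- m)) m' = min (Phi m) (1 - m')" for m m'
      by (auto simp: min_def max_def std_normal_cdf_uminus)
    have "1 - max (Phi (- (h * real N))) (MAX i\<in>{1..N}. secant (- (h * real i)) (- (h * (real i - 1))) (- z))
       = min (Phi (h * real N)) (1 - (MAX i\<in>{1..N}. secant (- (h * real i)) (- (h * (real i - 1))) (- z)))"
      by (rule g)
    also have "1 - (MAX i\<in>{1..N}. secant (- (h * real i)) (- (h * (real i - 1))) (- z))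
       = (MIN i\<in>{1..N}. 1 - secant (- (h * real i)) (- (h * (real i - 1))) (- z))"
      using N by (intro one_minus_MAX) auto
    also have "\<dots> = (MIN i\<in>{1..N}. secant (h * (real i - 1)) (h * real i) z)"
      using secant_uminus[of "h * (real _ - 1)" "h * real _" z] h by simp
    finally show ?thesis
      using 2 unfolding upper_cdf_mesh upper_left_def lower_cdf_def mesh_def by simp
  next
    \<comment> \<open>At 0 both definitions use their right branch, so reflection does not match the
      formulas. The first secant, \<open>i = 1\<close>, passes through (0, 1/2) and fixes the
      value.\<close>
    case 3
    have A: "secant (h * (real i - 1)) (h * real i) 0 \<ge> 1 / 2" if "1 \<le> i" for i
      using std_normal_cdf_le_secant[of "h * (real i - 1)" "h * real i" 0] h that by (simp add: std_normal_cdf_0)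
    have "Phi (h * real N) \<ge> 1 / 2"
      using std_normal_cdf_mono[of 0 "h * real N"] h by (simp add: std_normal_cdf_0)
    then have lower: "min (Phi (h * real N)) (MIN i\<in>{1..N}. secant (h * (real i - 1)) (h * real i) 0) \<ge> 1 / 2"
      by (intro min.boundedI Min.boundedI) (use N A in auto)
    have sec: "secant (h * (real 1 - 1)) (h * real 1) 0 = 1 / 2"
      by (simp add: secant_def std_normal_cdf_0)
    have upper: "min (Phi (h * real N)) (MIN i\<in>{1..N}. secant (h * (real i - 1)) (h * real i) 0)
        \<le> secant (h * (real 1 - 1)) (h * real 1) 0"
      using N by (intro min.coboundedI2 Min_le image_eqI[where x = 1]) auto
    have "min (Phi (h * real N)) (MIN i\<in>{1..N}. secant (h * (real i - 1)) (h * real i) 0) = 1 / 2"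
      by (rule antisym[OF upper[unfolded sec] lower])
    then show ?thesis
      using 3 upper_right_0 unfolding upper_cdf_mesh lower_cdf_def mesh_def by simp
  qed
qed

lemma lower_cdf_mesh_cdf_like: "cdf_like (lower_cdf N N (mesh h)) (Phi (h * real N)) 0"
proof -
  let ?F = "upper_cdf N N (mesh h)"
  have eq: "lower_cdf N N (mesh h) = (\<lambda>z. 1 - ?F (- z))"
    using lower_cdf_mesh by auto
  have F: "continuous_on UNIV ?F" "mono ?F" "0 \<le> ?F z" "?F z \<le> 1"
    "(?F \<longlongrightarrow> 1) at_top" "(?F \<longlongrightarrow> Phi (- (h * real N))) at_bot" for z
    using upper_cdf_mesh_cdf_like by (simp_all add: cdf_like_def)
  have "continuous_on UNIV (\<lambda>z. ?F (- z))"
    by (rule continuous_on_compose2[OF F(1)]) (auto intro: continuous_on_minus continuous_on_id)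
  then have "continuous_on UNIV (\<lambda>z. 1 - ?F (- z))"
    by (rule continuous_on_diff[OF continuous_on_const])
  moreover have "mono (\<lambda>z. 1 - ?F (- z))"
  proof (rule monoI)
    fix x y :: real assume "x \<le> y"
    then show "1 - ?F (- x) \<le> 1 - ?F (- y)" using monoD[OF F(2), of "- y" "- x"] by simp
  qed
  moreover have "((\<lambda>z. 1 - ?F (- z)) \<longlongrightarrow> 1 - Phi (- (h * real N))) at_top"
    by (intro tendsto_diff tendsto_const filterlim_compose[OF F(6)] filterlim_uminus_at_bot_at_top)
  moreover have "((\<lambda>z. 1 - ?F (- z)) \<longlongrightarrow> 1 - 1) at_bot"
    by (intro tendsto_diff tendsto_const filterlim_compose[OF F(5)] filterlim_uminus_at_top_at_bot)
  ultimately show ?thesis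
    using F(3,4) unfolding cdf_like_def eq by (simp add: std_normal_cdf_uminus)
qed

lemma lower_cdf_mesh_bounds:
  assumes "1 - Phi (h * real N) \<le> t" "h\<^sup>2 \<le> t"
  shows "lower_cdf N N (mesh h) z \<le> Phi z" "Phi z \<le> lower_cdf N N (mesh h) z + t"
  using upper_cdf_mesh_bounds[OF assms, of "- z"] unfolding lower_cdf_mesh std_normal_cdf_uminus by auto

lemma lower_cdf_mesh_attains: "\<exists>z. lower_cdf N N (mesh h) z = Phi (h * real N)"
  using upper_cdf_mesh_eq_left[of "- (h * real N)"] lower_cdf_mesh[of "h * real N"]
  by (intro exI[of _ "h * real N"]) (simp add: std_normal_cdf_uminus)

lemma valid_breakpoints_mesh: "valid_breakpoints N N (mesh h)"
  using h N by (auto simp: valid_breakpoints_def mesh_def intro!: strict_mono_onI)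

end

text \<open>The width sqrt t makes the cell error h^2 equal to t, and h N \<ge> sqrt (2 ln (1/t))
  makes the tail bound exp (-(h N)^2/2) at most t. The condition t \<le> exp (-1) gives ln (1/t)
  \<ge> 1, which brings h N into the range of \<open>std_normal_cdf_tail\<close> and makes
  \<open>?s\<close> at least 1.\<close>

lemma mesh_size:
  assumes t: "0 < t" "t \<le> exp (- 1)"
  defines "h \<equiv> sqrt t" and "N \<equiv> nat \<lceil>sqrt (2 * ln (1 / t)) / sqrt t\<rceil>"
  shows "h > 0" "N > 0" "h\<^sup>2 \<le> t" "1 - Phi (h * real N) \<le> t"
    "real (N + N + 1) \<le> 6 * sqrt (1 / t * ln (1 / t))"
proof -
  let ?l = "ln (1 / t)" and ?s = "sqrt (1 / t * ln (1 / t))"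
  show h: "h > 0" "h\<^sup>2 \<le> t" using t by (auto simp: h_def)
  have "ln t \<le> ln (exp (- 1))" using t by (subst ln_le_cancel_iff) auto
  then have l: "?l \<ge> 1" using t by (simp add: ln_div)
  have "exp (- 1 :: real) \<le> 1" by simp
  then have "t \<le> 1" using t by linarith
  have q: "sqrt (2 * ln (1 / t)) / sqrt t = sqrt 2 * ?s"
    by (simp add: real_sqrt_mult real_sqrt_divide)
  have "1 * 1 \<le> 1 / t * ?l" using t l \<open>t \<le> 1\<close> by (intro mult_mono) auto
  then have s: "?s \<ge> 1" by simp
  have s2: "sqrt 2 * ?s \<ge> 1 * 1" using s by (intro mult_mono) auto
  then show N: "N > 0" unfolding N_def q by simp
  have rN: "real N = of_int \<lceil>sqrt 2 * ?s\<rceil>" unfolding N_def q using s2 by simp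
  \<comment> \<open>Origin of the constant 6: N \<le> 3/2 s + 1, hence 2 N + 1 \<le> 3 s + 3 \<le> 6
    s because s \<ge> 1.\<close>
  have "sqrt 2 \<le> 3 / 2" by (rule real_le_lsqrt) (auto simp: power2_eq_square)
  then have "sqrt 2 * ?s \<le> 3 / 2 * ?s" using s by (intro mult_right_mono) auto
  moreover have "real N \<le> sqrt 2 * ?s + 1" unfolding rN by linarith
  ultimately show "real (N + N + 1) \<le> 6 * ?s" using s unfolding of_nat_add of_nat_1 by linarith
  have "sqrt (2 * ?l) / h \<le> real N" unfolding rN h_def q by linarith
  then have M: "sqrt (2 * ?l) \<le> h * real N" using h by (simp add: field_simps)
  have "1 \<le> sqrt (2 * ?l)" using l by simp
  then have "1 \<le> h * real N" using M by linarith
  then have "1 - Phi (h * real N) \<le> exp (- (h * real N)\<^sup>2 / 2)" by (rule std_normal_cdf_tail)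
  also have "\<dots> \<le> exp (- ?l)"
    using power_mono[OF M, of 2] l by simp
  also have "\<dots> = t" using t by (simp add: ln_div)
  finally show "1 - Phi (h * real N) \<le> t" .
qed

lemma exists_breakpoints:
  assumes t: "0 < t" "t \<le> exp (- 1)"
  obtains N z lo hi where "valid_breakpoints N N z" "real (N + N + 1) \<le> 6 * sqrt (1 / t * ln (1 / t))"
    "cdf_like (upper_cdf N N z) 1 lo" "lo \<le> t" "\<exists>x. upper_cdf N N z x = 1"
    "\<And>x. Phi x \<le> upper_cdf N N z x" "\<And>x. upper_cdf N N z x \<le> Phi x + t"
    "cdf_like (lower_cdf N N z) hi 0" "1 - t \<le> hi" "hi \<le> 1" "\<exists>x. lower_cdf N N z x = hi"
    "\<And>x. lower_cdf N N z x \<le> Phi x" "\<And>x. Phi x \<le> lower_cdf N N z x + t"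
proof -
  define h where "h = sqrt t"
  define N where "N = nat \<lceil>sqrt (2 * ln (1 / t)) / sqrt t\<rceil>"
  note size = mesh_size[OF t, folded h_def N_def]
  note hN = size(1,2) and bounds = size(4,3)
  show ?thesis
  proof (rule that)
    show "valid_breakpoints N N (mesh h)" by (rule valid_breakpoints_mesh[OF hN])
    show "real (N + N + 1) \<le> 6 * sqrt (1 / t * ln (1 / t))" by (rule size)
    show "cdf_like (upper_cdf N N (mesh h)) 1 (Phi (- (h * N)))" by (rule upper_cdf_mesh_cdf_like[OF hN])
    show "Phi (- (h * N)) \<le> t" using size(4) by (simp add: std_normal_cdf_uminus)
    show "\<exists>x. upper_cdf N N (mesh h) x = 1"
      using upper_cdf_mesh_eq_1[OF hN] by blast
    show "cdf_like (lower_cdf N N (mesh h)) (Phi (h * N)) 0" by (rule lower_cdf_mesh_cdf_like[OF hN])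
    show "1 - t \<le> Phi (h * N)" using size(4) by simp
    show "Phi (h * N) \<le> 1" by (rule std_normal_cdf_le_1)
    show "\<exists>x. lower_cdf N N (mesh h) x = Phi (h * N)" by (rule lower_cdf_mesh_attains[OF hN])
    fix x
    show "Phi x \<le> upper_cdf N N (mesh h) x" by (rule upper_cdf_mesh_bounds[OF hN bounds])
    show "upper_cdf N N (mesh h) x \<le> Phi x + t" by (rule upper_cdf_mesh_bounds[OF hN bounds])
    show "lower_cdf N N (mesh h) x \<le> Phi x" by (rule lower_cdf_mesh_bounds[OF hN bounds])
    show "Phi x \<le> lower_cdf N N (mesh h) x + t" by (rule lower_cdf_mesh_bounds[OF hN bounds])
  qed
qed

section \<open>Compactness and left continuity of the optimal value\<close>

lemma vec_coords: "x \<in> carrier_vec n \<Longrightarrow> vec n (coords n x) = x"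
  by (auto simp: coords_def)

text \<open>The extreme value theorem on the coordinate image, where compactness is defined; the
  condition g \<ge> t cuts out a closed part of it.\<close>

lemma exists_arg_min_vec_compact:
  fixes f g :: "real vec \<Rightarrow> real"
  assumes X: "vec_compact n X"
    and f: "continuous_on (coords n ` X) (\<lambda>y. f (vec n y))"
    and g: "continuous_on (coords n ` X) (\<lambda>y. g (vec n y))"
    and x0: "x0 \<in> X" "g x0 \<ge> t"
  shows "\<exists>x. is_arg_min f (\<lambda>x. x \<in> X \<and> g x \<ge> t) x"
proof -
  let ?Y = "coords n ` X"
  let ?K = "?Y \<inter> (\<lambda>y. g (vec n y)) -` {t..}"
  have vc: "vec n (coords n x) = x" if "x \<in> X" for x
    using X that by (intro vec_coords) (auto simp: vec_compact_def)
  have "closedin (top_of_set ?Y) ?K"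
    by (rule continuous_closedin_preimage[OF g]) simp
  then have "compact ?K"
    using X closedin_compact by (auto simp: vec_compact_def)
  moreover have "?K \<noteq> {}" using x0 vc by force
  moreover have "continuous_on ?K (\<lambda>y. f (vec n y))"
    by (rule continuous_on_subset[OF f]) auto
  ultimately obtain y where y: "y \<in> ?K" "\<And>y'. y' \<in> ?K \<Longrightarrow> f (vec n y) \<le> f (vec n y')"
    using continuous_attains_inf by metis
  obtain x where x: "x \<in> X" "y = coords n x" using y by auto
  have "f x \<le> f x'" if "x' \<in> X" "g x' \<ge> t" for x'
    using y(2)[of "coords n x'"] that x vc by auto
  moreover have "g x \<ge> t" using y x vc by auto
  ultimately have "is_arg_min f (\<lambda>x. x \<in> X \<and> g x \<ge> t) x"
    using x by (auto simp: is_arg_min_def not_less)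
  then show ?thesis ..
qed

section \<open>Continuity of the constraint functions\<close>

lemma continuous_on_linear_vec:
  fixes c :: "real vec"
  assumes "c \<in> carrier_vec n"
  shows "continuous_on Y (\<lambda>y. c \<bullet> vec n y)"
proof -
  have "c \<bullet> vec n y = (\<Sum>i<n. c $ i * y i)" for y
    by (simp add: scalar_prod_lessThan[of _ n])
  then show ?thesis
    by (simp only:) (intro continuous_on_sum continuous_on_mult continuous_on_const
      continuous_on_subset[OF continuous_on_product_coordinates subset_UNIV])
qed

lemma continuous_on_quad_vec:
  fixes S :: "real mat"
  assumes "S \<in> carrier_mat n n"
  shows "continuous_on Y (\<lambda>y. vec n y \<bullet> (S *\<^sub>v vec n y))"
proof -
  have "vec n y \<bullet> (S *\<^sub>v vec n y) = (\<Sum>i<n. \<Sum>j<n. S $$ (i, j) * y i * y j)" for y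
    using quad_mat[OF assms, of "vec n y"] by (simp add: quad_def)
  then show ?thesis
    by (simp only:) (intro continuous_on_sum continuous_on_mult continuous_on_const
      continuous_on_subset[OF continuous_on_product_coordinates subset_UNIV])
qed

text \<open>When the variance tends to 0, the quotient (b - a)/sqrt v tends to plus or minus
  infinity by the sign of b, so \<open>F\<close> tends to \<open>hi\<close> or \<open>lo\<close>.
  With b = 0 the quotient would be indeterminate.\<close>

lemma comp_val_tendsto:
  assumes F: "cdf_like F hi lo" and a: "(a \<longlongrightarrow> a0) G" and v: "(v \<longlongrightarrow> v0) G"
    and v0: "v0 \<ge> 0" and pos: "\<forall>\<^sub>F y in G. v y > 0" and zero: "v0 = 0 \<Longrightarrow> a0 = 0 \<and> b \<noteq> 0"
  shows "((\<lambda>y. comp_val F hi lo b (a y) (v y)) \<longlongrightarrow> comp_val F hi lo b a0 v0) G"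
proof -
  have Fc: "isCont F z" for z
    using F by (auto simp: cdf_like_def continuous_on_eq_continuous_at)
  have top: "(F \<longlongrightarrow> hi) at_top" and bot: "(F \<longlongrightarrow> lo) at_bot"
    using F by (auto simp: cdf_like_def)
  have "((\<lambda>y. F ((b - a y) / sqrt (v y))) \<longlongrightarrow> comp_val F hi lo b a0 v0) G"
  proof (cases "v0 = 0")
    case False
    then have "((\<lambda>y. (b - a y) / sqrt (v y)) \<longlongrightarrow> (b - a0) / sqrt v0) G"
      by (intro tendsto_intros a v) auto
    then show ?thesis
      using False isCont_tendsto_compose[OF Fc] by (simp add: comp_val_def)
  next
    case True
    then have a0: "a0 = 0" and b: "b \<noteq> 0" using zero by auto
    have "((\<lambda>y. sqrt (v y)) \<longlongrightarrow> 0) G"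
      using tendsto_real_sqrt[OF v] True by simp
    then have "filterlim (\<lambda>y. sqrt (v y)) (at_right 0) G"
      using pos by (auto simp: filterlim_at elim!: eventually_mono)
    then have inv: "filterlim (\<lambda>y. inverse (sqrt (v y))) at_top G"
      by (rule filterlim_compose[OF filterlim_inverse_at_top_right])
    have num: "((\<lambda>y. b - a y) \<longlongrightarrow> b) G"
      using tendsto_diff[OF tendsto_const a, of b] a0 by simp
    show ?thesis
    proof (cases "b > 0")
      case True
      have "filterlim (\<lambda>y. (b - a y) * inverse (sqrt (v y))) at_top G"
        by (rule filterlim_tendsto_pos_mult_at_top[OF num True inv])
      then show ?thesis
        using filterlim_compose[OF top] True \<open>v0 = 0\<close> by (simp add: comp_val_def divide_inverse)
    next
      case False
      then have "b < 0" using b by simp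
      then have "filterlim (\<lambda>y. (b - a y) * inverse (sqrt (v y))) at_bot G"
        by (rule filterlim_tendsto_neg_mult_at_bot[OF num _ inv])
      then show ?thesis
        using filterlim_compose[OF bot] \<open>b < 0\<close> \<open>v0 = 0\<close> by (simp add: comp_val_def divide_inverse)
    qed
  qed
  moreover have "\<forall>\<^sub>F y in G. F ((b - a y) / sqrt (v y)) = comp_val F hi lo b (a y) (v y)"
    using pos by eventually_elim (simp add: comp_val_def)
  ultimately show ?thesis by (rule Lim_transform_eventually)
qed

lemma positive_definite_quad_nonneg:
  assumes "positive_definite n S" "x \<in> carrier_vec n"
  shows "x \<bullet> (S *\<^sub>v x) \<ge> 0"
  using assms positive_definite_quad_eq_0_iff[OF assms]
  by (cases "x = 0\<^sub>v n") (auto simp: positive_definite_def less_imp_le)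

lemma continuous_on_mix_val:
  assumes F: "cdf_like F hi lo" and wf: "well_formed P" and pd: "covar_pos_def P"
    and origin: "bound P = 0 \<Longrightarrow> 0\<^sub>v (ndim P) \<notin> polytope P"
  shows "continuous_on (coords (ndim P) ` polytope P) (\<lambda>y. mix_val F hi lo P (vec (ndim P) y))"
  unfolding mix_val_def
proof (intro continuous_on_sum continuous_on_mult continuous_on_const)
  let ?n = "ndim P" and ?Y = "coords (ndim P) ` polytope P"
  fix k assume "k \<in> {..<ncomp P}"
  then have S: "positive_definite ?n (covar P k)" and m: "mean P k \<in> carrier_vec ?n"
    using wf pd by (auto simp: well_formed_def covar_pos_def_def)
  have carr: "covar P k \<in> carrier_mat ?n ?n" using S by (simp add: positive_definite_def)
  have vc: "vec ?n (coords ?n x) = x" if "x \<in> polytope P" for x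
    using that by (intro vec_coords) (auto simp: polytope_def)
  let ?a = "\<lambda>y. mean P k \<bullet> vec ?n y" and ?v = "\<lambda>y. vec ?n y \<bullet> (covar P k *\<^sub>v vec ?n y)"
  show "continuous_on ?Y (\<lambda>y. comp_val F hi lo (bound P) (?a y) (?v y))"
    unfolding continuous_on_def
  proof
    fix y0 assume y0: "y0 \<in> ?Y"
    have a: "(?a \<longlongrightarrow> ?a y0) (at y0 within ?Y)"
      using continuous_on_linear_vec[OF m] y0 by (auto simp: continuous_on_def)
    have v: "(?v \<longlongrightarrow> ?v y0) (at y0 within ?Y)"
      using continuous_on_quad_vec[OF carr] y0 by (auto simp: continuous_on_def)
    have v0: "?v y0 \<ge> 0" by (rule positive_definite_quad_nonneg[OF S]) simp
    show "((\<lambda>y. comp_val F hi lo (bound P) (?a y) (?v y)) \<longlongrightarrow> comp_val F hi lo (bound P) (?a y0) (?v y0)) (at y0 within ?Y)"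
    proof (rule comp_val_tendsto[OF F a v v0])
      show "\<forall>\<^sub>F y in at y0 within ?Y. ?v y > 0"
      proof (cases "?v y0 = 0")
        case False
        then show ?thesis using v v0 by (intro order_tendstoD) auto
      next
        \<comment> \<open>Here \<open>y0\<close> represents the origin; every other point of the
          polytope is a nonzero vector and has positive variance.\<close>
        case True
        then have z0: "vec ?n y0 = 0\<^sub>v ?n"
          by (subst (asm) positive_definite_quad_eq_0_iff[OF S]) auto
        have "?v y > 0" if "y \<noteq> y0" "y \<in> ?Y" for y
        proof -
          have "vec ?n y \<noteq> 0\<^sub>v ?n" using that y0 z0 vc by force
          then show ?thesis using S by (auto simp: positive_definite_def)
        qed
        then show ?thesis by (auto simp: eventually_at_filter)
      qed
      assume "?v y0 = 0"
      then have z0: "vec ?n y0 = 0\<^sub>v ?n"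
        by (subst (asm) positive_definite_quad_eq_0_iff[OF S]) auto
      then have "0\<^sub>v ?n \<in> polytope P" using y0 vc by force
      then show "?a y0 = 0 \<and> bound P \<noteq> 0" using z0 m origin by auto
    qed
  qed
qed

lemma mix_val_zero:
  assumes "well_formed P" "covar_pos_def P"
  shows "mix_val F hi lo P (0\<^sub>v (ndim P)) = (if bound P \<ge> 0 then hi else lo)"
proof -
  have "0\<^sub>v (ndim P) \<bullet> (covar P k *\<^sub>v 0\<^sub>v (ndim P)) = 0" if "k < ncomp P" for k
    using assms that by (subst positive_definite_quad_eq_0_iff[of "ndim P"]) (auto simp: covar_pos_def_def)
  then have "mix_val F hi lo P (0\<^sub>v (ndim P)) = (\<Sum>k<ncomp P. weight P k * (if bound P \<ge> 0 then hi else lo))"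
    unfolding mix_val_def by (intro sum.cong) (auto simp: comp_val_def)
  also have "\<dots> = (if bound P \<ge> 0 then hi else lo)"
    using assms by (simp add: sum_distrib_right[symmetric] well_formed_def)
  finally show ?thesis .
qed

text \<open>For b = 0 the origin has probability 1, so as a point of the polytope it would belong to
  P(\<theta>) and to every ball around 0.\<close>

lemma origin_not_in_polytope:
  assumes wf: "well_formed P" and pd: "covar_pos_def P" and away: "away_from_origin P" and b: "bound P = 0"
  shows "0\<^sub>v (ndim P) \<notin> polytope P"
proof
  assume X: "0\<^sub>v (ndim P) \<in> polytope P"
  obtain d where d: "d > 0" "chance_set P (level P) \<inter> {x \<in> carrier_vec (ndim P). vnorm x \<le> d} = {}"
    using away b by (auto simp: away_from_origin_def)
  have "prob_le P (0\<^sub>v (ndim P)) = 1"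
    using wf pd b by (simp add: prob_le_eq_mix_val mix_val_zero)
  then have "0\<^sub>v (ndim P) \<in> chance_set P (level P)"
    using X wf by (simp add: chance_set_def well_formed_def)
  moreover have "vnorm (0\<^sub>v (ndim P)) \<le> d" using d by (simp add: vnorm_def)
  ultimately show False using d(2) by fastforce
qed

text \<open>The weights sum to 1, so a uniform error survives the averaging unamplified; the bounds
  on \<open>hi\<close> and \<open>lo\<close> cover the origin.\<close>

lemma mix_val_mono:
  assumes wf: "well_formed P" and FG: "\<And>z. F z \<le> G z + t" and hi: "hi \<le> hi' + t" and lo: "lo \<le> lo' + t"
  shows "mix_val F hi lo P x \<le> mix_val G hi' lo' P x + t"
proof -
  have w: "weight P k \<ge> 0" if "k < ncomp P" for k
    using wf that by (simp add: well_formed_def)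
  have "mix_val F hi lo P x \<le> (\<Sum>k<ncomp P.
     weight P k * (comp_val G hi' lo' (bound P) (mean P k \<bullet> x) (x \<bullet> (covar P k *\<^sub>v x)) + t))"
    unfolding mix_val_def using w by (intro sum_mono mult_left_mono) (auto simp: comp_val_def FG hi lo)
  also have "\<dots> = mix_val G hi' lo' P x + (\<Sum>k<ncomp P. weight P k) * t"
    by (simp add: mix_val_def distrib_left sum.distrib sum_distrib_right)
  also have "(\<Sum>k<ncomp P. weight P k) = 1" using wf by (simp add: well_formed_def)
  finally show ?thesis by simp
qed

lemma exists_min_cost:
  assumes F: "cdf_like F hi lo" and wf: "well_formed P" and pd: "covar_pos_def P" and away: "away_from_origin P"
    and x: "x \<in> polytope P" "mix_val F hi lo P x \<ge> t"
  shows "\<exists>x. is_arg_min (\<lambda>x. cost P \<bullet> x) (\<lambda>x. x \<in> polytope P \<and> mix_val F hi lo P x \<ge> t) x"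
proof (rule exists_arg_min_vec_compact)
  show "vec_compact (ndim P) (polytope P)" using wf by (simp add: well_formed_def)
  show "continuous_on (coords (ndim P) ` polytope P) (\<lambda>y. cost P \<bullet> vec (ndim P) y)"
    using wf by (intro continuous_on_linear_vec) (simp add: well_formed_def)
  show "continuous_on (coords (ndim P) ` polytope P) (\<lambda>y. mix_val F hi lo P (vec (ndim P) y))"
    using origin_not_in_polytope[OF wf pd away] by (intro continuous_on_mix_val F wf pd)
qed (use x in auto)

lemma chance_set_eq:
  assumes "well_formed P" "covar_pos_def P"
  shows "x \<in> chance_set P t \<longleftrightarrow> x \<in> polytope P \<and> mix_val std_normal_cdf 1 0 P x \<ge> t"
  using prob_le_eq_mix_val[OF assms] by (auto simp: chance_set_def polytope_def)

lemma exists_opt_sol: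
  assumes wf: "well_formed P" and pd: "covar_pos_def P" and away: "away_from_origin P"
    and ne: "chance_set P t \<noteq> {}"
  shows "\<exists>x. opt_sol P t x"
  using exists_min_cost[OF cdf_like_std_normal wf pd away] ne
  unfolding opt_sol_def chance_set_eq[OF wf pd] by (metis chance_set_eq[OF wf pd] ex_in_conv)

text \<open>The points of the polytope that undercut the optimal cost by at least e form a compact
  set on which p < \<theta>. The maximum of p there is still below \<theta>, and above that level no
  such point is feasible.\<close>

lemma value_left_continuous:
  assumes wf: "well_formed P" and pd: "covar_pos_def P" and away: "away_from_origin P"
    and opt: "opt_sol P (level P) xs" and e: "e > 0"
  shows "\<exists>t<level P. \<forall>s>t. \<forall>x\<in>chance_set P s. cost P \<bullet> x > cost P \<bullet> xs - e"
proof -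
  let ?p = "mix_val std_normal_cdf 1 0 P"
  have low: "?p x < level P" if "x \<in> polytope P" "- (cost P \<bullet> x) \<ge> - (cost P \<bullet> xs - e)" for x
  proof (rule ccontr)
    assume "\<not> ?p x < level P"
    then have "x \<in> chance_set P (level P)" using that chance_set_eq[OF wf pd] by auto
    then show False using opt that e by (auto simp: opt_sol_def is_arg_min_def)
  qed
  show ?thesis
  proof (cases "\<exists>x\<in>polytope P. - (cost P \<bullet> x) \<ge> - (cost P \<bullet> xs - e)")
    case True
    then obtain x0 where x0: "x0 \<in> polytope P" "- (cost P \<bullet> x0) \<ge> - (cost P \<bullet> xs - e)" by blast
    \<comment> \<open>Maximising p under a cost bound, with both signs reversed to fit
      \<open>exists_arg_min_vec_compact\<close>.\<close>
    have "\<exists>x. is_arg_min (\<lambda>x. - ?p x) (\<lambda>x. x \<in> polytope P \<and> - (cost P \<bullet> x) \<ge> - (cost P \<bullet> xs - e)) x"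
    proof (rule exists_arg_min_vec_compact[of "ndim P" "polytope P"])
      show "vec_compact (ndim P) (polytope P)" using wf by (simp add: well_formed_def)
      show "continuous_on (coords (ndim P) ` polytope P) (\<lambda>y. - (cost P \<bullet> vec (ndim P) y))"
        using wf by (intro continuous_on_minus continuous_on_linear_vec) (simp add: well_formed_def)
      show "continuous_on (coords (ndim P) ` polytope P) (\<lambda>y. - ?p (vec (ndim P) y))"
        using origin_not_in_polytope[OF wf pd away]
        by (intro continuous_on_minus continuous_on_mix_val cdf_like_std_normal wf pd)
    qed (use x0 in auto)
    then obtain xm where xm: "xm \<in> polytope P" "- (cost P \<bullet> xm) \<ge> - (cost P \<bullet> xs - e)"
      and max: "\<And>x. x \<in> polytope P \<Longrightarrow> - (cost P \<bullet> x) \<ge> - (cost P \<bullet> xs - e) \<Longrightarrow> ?p x \<le> ?p xm"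
      by (auto simp: is_arg_min_def not_less)
    show ?thesis
    proof (intro exI conjI allI impI ballI)
      show "?p xm < level P" using low xm by blast
      fix s x assume "s > ?p xm" "x \<in> chance_set P s"
      then show "cost P \<bullet> x > cost P \<bullet> xs - e"
        using max[of x] chance_set_eq[OF wf pd] by force
    qed
  next
    case False
    \<comment> \<open>No point is that cheap, so any level below \<theta> can serve.\<close>
    show ?thesis
    proof (intro exI[of _ "level P - 1"] conjI allI impI ballI)
      fix s x assume "x \<in> chance_set P s"
      then have "x \<in> polytope P" using chance_set_eq[OF wf pd] by blast
      then show "cost P \<bullet> x > cost P \<bullet> xs - e" using False by force
    qed simp
  qed
qed

section \<open>Gradients\<close>

lemma vnorm_nonneg: "vnorm v \<ge> 0"
  by (simp add: vnorm_def scalar_prod_self_nonneg)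

lemma vnorm_eq_0: "v \<in> carrier_vec n \<Longrightarrow> vnorm v = 0 \<longleftrightarrow> v = 0\<^sub>v n"
  unfolding vnorm_def by (subst scalar_prod_lessThan[of _ n]) (auto simp: sum_nonneg_eq_0_iff)

lemma vnorm_smult: "vnorm (s \<cdot>\<^sub>v v) = \<bar>s\<bar> * vnorm v"
proof -
  have "(s \<cdot>\<^sub>v v) \<bullet> (s \<cdot>\<^sub>v v) = s\<^sup>2 * (v \<bullet> v)"
    by (simp add: power2_eq_square)
  then show ?thesis by (simp add: vnorm_def real_sqrt_mult)
qed

lemma vec_cauchy_schwarz:
  assumes "v \<in> carrier_vec n" "w \<in> carrier_vec n"
  shows "\<bar>v \<bullet> w\<bar> \<le> vnorm v * vnorm w"
proof -
  have "(v \<bullet> w)\<^sup>2 \<le> (v \<bullet> v) * (w \<bullet> w)"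
    using Cauchy_Schwarz_ineq_sum[of "\<lambda>i. v $ i" "\<lambda>i. w $ i" "{..<n}"] assms
    by (simp add: scalar_prod_lessThan[of _ n] power2_eq_square)
  then have "sqrt ((v \<bullet> w)\<^sup>2) \<le> sqrt ((v \<bullet> v) * (w \<bullet> w))" by (rule real_sqrt_le_mono)
  then show ?thesis by (simp add: vnorm_def real_sqrt_mult)
qed

lemma has_gradient_linear: "c \<in> carrier_vec n \<Longrightarrow> x \<in> carrier_vec n \<Longrightarrow> has_gradient n (\<lambda>y. c \<bullet> y) x c"
  unfolding has_gradient_def
  by (auto simp: scalar_prod_minus_distrib[of _ n] vnorm_nonneg intro!: exI[of _ 1])

lemma has_gradient_const: "has_gradient n (\<lambda>_. a) x (0\<^sub>v n)" if "x \<in> carrier_vec n"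
  using that unfolding has_gradient_def by (auto simp: vnorm_nonneg intro!: exI[of _ 1])

lemma has_gradient_add:
  assumes f: "has_gradient n f x u" and g: "has_gradient n g x v" and x: "x \<in> carrier_vec n"
  shows "has_gradient n (\<lambda>y. f y + g y) x (u + v)"
  unfolding has_gradient_def
proof (intro conjI allI impI)
  have u: "u \<in> carrier_vec n" and v: "v \<in> carrier_vec n"
    using f g by (auto simp: has_gradient_def)
  then show "u + v \<in> carrier_vec n" by simp
  fix e :: real assume "e > 0"
  then have e: "e / 2 > 0" by simp
  obtain r where r: "r > 0" "\<And>y. y \<in> carrier_vec n \<Longrightarrow> vnorm (y - x) < r \<Longrightarrow>
      \<bar>f y - f x - u \<bullet> (y - x)\<bar> \<le> e / 2 * vnorm (y - x)"
    using f e unfolding has_gradient_def by blast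
  obtain s where s: "s > 0" "\<And>y. y \<in> carrier_vec n \<Longrightarrow> vnorm (y - x) < s \<Longrightarrow>
      \<bar>g y - g x - v \<bullet> (y - x)\<bar> \<le> e / 2 * vnorm (y - x)"
    using g e unfolding has_gradient_def by blast
  show "\<exists>r>0. \<forall>y\<in>carrier_vec n. vnorm (y - x) < r \<longrightarrow>
      \<bar>f y + g y - (f x + g x) - (u + v) \<bullet> (y - x)\<bar> \<le> e * vnorm (y - x)"
  proof (intro exI[of _ "min r s"] conjI ballI impI)
    fix y assume y: "y \<in> carrier_vec n" "vnorm (y - x) < min r s"
    have "y - x \<in> carrier_vec n" using x y by auto
    then have "(u + v) \<bullet> (y - x) = u \<bullet> (y - x) + v \<bullet> (y - x)"
      using u v by (simp add: add_scalar_prod_distrib[of _ n])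
    moreover have "\<bar>f y - f x - u \<bullet> (y - x)\<bar> \<le> e / 2 * vnorm (y - x)"
      "\<bar>g y - g x - v \<bullet> (y - x)\<bar> \<le> e / 2 * vnorm (y - x)"
      using r(2) s(2) y by auto
    ultimately show "\<bar>f y + g y - (f x + g x) - (u + v) \<bullet> (y - x)\<bar> \<le> e * vnorm (y - x)"
      by linarith
  qed (use r s in auto)
qed

lemma has_gradient_compose:
  fixes \<phi> :: "real \<Rightarrow> real"
  assumes f: "has_gradient n f x g" and d: "(\<phi> has_real_derivative D) (at (f x))" and x: "x \<in> carrier_vec n"
  shows "has_gradient n (\<lambda>y. \<phi> (f y)) x (D \<cdot>\<^sub>v g)"
  unfolding has_gradient_def
proof (intro conjI allI impI)
  have g: "g \<in> carrier_vec n" using f by (simp add: has_gradient_def)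
  then show "D \<cdot>\<^sub>v g \<in> carrier_vec n" by simp
  fix e :: real assume e: "e > 0"
  \<comment> \<open>\<open>A\<close> bounds the growth of \<open>f\<close> near \<open>x\<close>,
    which is why \<open>e2\<close> is capped at 1. The choices of \<open>e1\<close> and
    \<open>e2\<close> give half of \<open>e\<close> to the error of \<phi> and half to that of
    \<open>f\<close>.\<close>
  define A where "A = vnorm g + 1"
  have A: "A > 0" using vnorm_nonneg[of g] by (simp add: A_def)
  define e1 where "e1 = e / (2 * A)"
  define e2 where "e2 = min 1 (e / (2 * (\<bar>D\<bar> + 1)))"
  have e1: "e1 > 0" using e A by (simp add: e1_def)
  have e2: "e2 > 0" using e by (simp add: e2_def add_nonneg_pos)
  obtain d1 where d1: "d1 > 0" "\<And>s. \<bar>s - f x\<bar> < d1 \<Longrightarrow> \<bar>\<phi> s - \<phi> (f x) - D * (s - f x)\<bar> \<le> e1 * \<bar>s - f x\<bar>"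
    using d e1 unfolding has_field_derivative_def has_derivative_at_alt by (auto simp: real_norm_def)
  obtain r where r: "r > 0" "\<And>y. y \<in> carrier_vec n \<Longrightarrow> vnorm (y - x) < r \<Longrightarrow>
      \<bar>f y - f x - g \<bullet> (y - x)\<bar> \<le> e2 * vnorm (y - x)"
    using f e2 unfolding has_gradient_def by blast
  show "\<exists>r>0. \<forall>y\<in>carrier_vec n. vnorm (y - x) < r \<longrightarrow>
      \<bar>\<phi> (f y) - \<phi> (f x) - (D \<cdot>\<^sub>v g) \<bullet> (y - x)\<bar> \<le> e * vnorm (y - x)"
  proof (intro exI[of _ "min r (d1 / A)"] conjI ballI impI)
    fix y assume y: "y \<in> carrier_vec n" and near: "vnorm (y - x) < min r (d1 / A)"
    let ?N = "vnorm (y - x)"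
    have N: "?N \<ge> 0" by (rule vnorm_nonneg)
    have yx: "y - x \<in> carrier_vec n" using x y by auto
    have lin: "\<bar>f y - f x - g \<bullet> (y - x)\<bar> \<le> e2 * ?N" using r(2) y near by auto
    moreover have "e2 * ?N \<le> 1 * ?N" using N by (intro mult_right_mono) (auto simp: e2_def)
    moreover have "\<bar>g \<bullet> (y - x)\<bar> \<le> vnorm g * ?N" by (rule vec_cauchy_schwarz[OF g yx])
    ultimately have fy: "\<bar>f y - f x\<bar> \<le> A * ?N"
      unfolding A_def distrib_right by linarith
    also have "\<dots> < d1" using near A by (simp add: field_simps)
    finally have "\<bar>\<phi> (f y) - \<phi> (f x) - D * (f y - f x)\<bar> \<le> e1 * \<bar>f y - f x\<bar>" by (rule d1(2))
    also have "\<dots> \<le> e1 * (A * ?N)" using fy e1 by (intro mult_left_mono) auto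
    also have "\<dots> = e / 2 * ?N" using A by (simp add: e1_def)
    finally have 1: "\<bar>\<phi> (f y) - \<phi> (f x) - D * (f y - f x)\<bar> \<le> e / 2 * ?N" .
    have "\<bar>D * (f y - f x - g \<bullet> (y - x))\<bar> \<le> \<bar>D\<bar> * (e2 * ?N)"
      unfolding abs_mult using lin by (intro mult_left_mono) auto
    also have "\<dots> = \<bar>D\<bar> * e2 * ?N" by simp
    also have "\<dots> \<le> e / 2 * ?N"
    proof (intro mult_right_mono N)
      have "\<bar>D\<bar> * e2 \<le> (\<bar>D\<bar> + 1) * (e / (2 * (\<bar>D\<bar> + 1)))"
        using e e2 by (intro mult_mono) (auto simp: e2_def)
      also have "\<dots> = e / 2" by (simp add: divide_simps) 
      finally show "\<bar>D\<bar> * e2 \<le> e / 2" .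
    qed
    finally have 2: "\<bar>D * (f y - f x - g \<bullet> (y - x))\<bar> \<le> e / 2 * ?N" .
    have "(D \<cdot>\<^sub>v g) \<bullet> (y - x) = D * (g \<bullet> (y - x))" using g yx by simp
    then have "\<phi> (f y) - \<phi> (f x) - (D \<cdot>\<^sub>v g) \<bullet> (y - x)
       = (\<phi> (f y) - \<phi> (f x) - D * (f y - f x)) + D * (f y - f x - g \<bullet> (y - x))"
      by (simp add: algebra_simps)
    also have "\<bar>\<dots>\<bar> \<le> e / 2 * ?N + e / 2 * ?N"
      using 1 2 by (intro order_trans[OF abs_triangle_ineq] add_mono)
    finally show "\<bar>\<phi> (f y) - \<phi> (f x) - (D \<cdot>\<^sub>v g) \<bullet> (y - x)\<bar> \<le> e * ?N" by simp
  qed (use r d1 A in auto)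
qed

text \<open>Hides the gradient: the argument uses that p has one, and no formula for it.\<close>

definition vec_differentiable :: "nat \<Rightarrow> (real vec \<Rightarrow> real) \<Rightarrow> real vec \<Rightarrow> bool" where
  "vec_differentiable n f x \<longleftrightarrow> x \<in> carrier_vec n \<and> (\<exists>g. has_gradient n f x g)"

lemma vec_differentiable_linear: "c \<in> carrier_vec n \<Longrightarrow> x \<in> carrier_vec n \<Longrightarrow> vec_differentiable n (\<lambda>y. c \<bullet> y) x"
  unfolding vec_differentiable_def using has_gradient_linear by blast

lemma vec_differentiable_const: "x \<in> carrier_vec n \<Longrightarrow> vec_differentiable n (\<lambda>_. a) x"
  unfolding vec_differentiable_def using has_gradient_const by blast

lemma vec_differentiable_add:
  "vec_differentiable n f x \<Longrightarrow> vec_differentiable n g x \<Longrightarrow> vec_differentiable n (\<lambda>y. f y + g y) x"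
  unfolding vec_differentiable_def using has_gradient_add by blast

lemma vec_differentiable_compose:
  "vec_differentiable n f x \<Longrightarrow> (\<phi> has_real_derivative D) (at (f x)) \<Longrightarrow> vec_differentiable n (\<lambda>y. \<phi> (f y)) x"
  unfolding vec_differentiable_def using has_gradient_compose by blast

lemma vec_differentiable_cmult: "vec_differentiable n f x \<Longrightarrow> vec_differentiable n (\<lambda>y. a * f y) x"
  by (rule vec_differentiable_compose[of n f x "(*) a" a]) (auto intro!: derivative_eq_intros)

text \<open>Polarisation, f g = ((f + g)^2 - (f - g)^2)/4, derives the product rule from sums and
  from composition with the square.\<close>

lemma vec_differentiable_mult:
  assumes "vec_differentiable n f x" "vec_differentiable n g x"
  shows "vec_differentiable n (\<lambda>y. f y * g y) x"
proof -
  have sq: "vec_differentiable n (\<lambda>y. (h y)\<^sup>2) x" if "vec_differentiable n h x" for h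
    by (rule vec_differentiable_compose[OF that, of "\<lambda>t. t\<^sup>2" "2 * h x"]) (auto intro!: derivative_eq_intros)
  have "vec_differentiable n (\<lambda>y. 1/4 * (f y + g y)\<^sup>2 + - (1/4) * (f y + -1 * g y)\<^sup>2) x"
    by (intro vec_differentiable_add vec_differentiable_cmult sq assms)
  then show ?thesis by (simp add: power2_eq_square field_simps)
qed

lemma vec_differentiable_sum:
  "finite I \<Longrightarrow> x \<in> carrier_vec n \<Longrightarrow> (\<And>i. i \<in> I \<Longrightarrow> vec_differentiable n (f i) x) \<Longrightarrow>
    vec_differentiable n (\<lambda>y. \<Sum>i\<in>I. f i y) x"
  by (induction rule: finite_induct) (auto intro: vec_differentiable_add vec_differentiable_const)

lemma vec_differentiable_transform:
  assumes f: "vec_differentiable n f x" and r: "r > 0"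
    and eq: "\<And>y. y \<in> carrier_vec n \<Longrightarrow> vnorm (y - x) < r \<Longrightarrow> f y = f' y"
  shows "vec_differentiable n f' x"
proof -
  obtain g where x: "x \<in> carrier_vec n" and g: "has_gradient n f x g"
    using f by (auto simp: vec_differentiable_def)
  have fx: "f x = f' x" using x r by (intro eq) (auto simp: vnorm_def)
  have "has_gradient n f' x g"
    unfolding has_gradient_def
  proof (intro conjI allI impI)
    show "g \<in> carrier_vec n" using g by (simp add: has_gradient_def)
    fix e :: real assume "e > 0"
    then obtain s where s: "s > 0" "\<And>y. y \<in> carrier_vec n \<Longrightarrow> vnorm (y - x) < s \<Longrightarrow>
      \<bar>f y - f x - g \<bullet> (y - x)\<bar> \<le> e * vnorm (y - x)"
      using g unfolding has_gradient_def by blast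
    show "\<exists>r>0. \<forall>y\<in>carrier_vec n. vnorm (y - x) < r \<longrightarrow>
      \<bar>f' y - f' x - g \<bullet> (y - x)\<bar> \<le> e * vnorm (y - x)"
    proof (intro exI[of _ "min r s"] conjI ballI impI)
      fix y assume y: "y \<in> carrier_vec n" "vnorm (y - x) < min r s"
      then have "f y = f' y" by (intro eq) auto
      then show "\<bar>f' y - f' x - g \<bullet> (y - x)\<bar> \<le> e * vnorm (y - x)"
        using s(2)[of y] y by (simp add: fx)
    qed (use r s in auto)
  qed
  then show ?thesis using x by (auto simp: vec_differentiable_def)
qed

lemma vec_differentiable_quad:
  assumes S: "S \<in> carrier_mat n n" and x: "x \<in> carrier_vec n"
  shows "vec_differentiable n (\<lambda>y. y \<bullet> (S *\<^sub>v y)) x"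
proof (rule vec_differentiable_transform[where r = 1])
  show "vec_differentiable n (\<lambda>y. \<Sum>i<n. (unit_vec n i \<bullet> y) * (row S i \<bullet> y)) x"
    using S x by (intro vec_differentiable_sum vec_differentiable_mult vec_differentiable_linear) auto
  fix y :: "real vec" assume "y \<in> carrier_vec n"
  then show "(\<Sum>i<n. (unit_vec n i \<bullet> y) * (row S i \<bullet> y)) = y \<bullet> (S *\<^sub>v y)"
    using S by (subst (3) scalar_prod_lessThan[of _ n]) auto
qed simp

text \<open>Uniqueness gives the definite description in \<open>gradient\<close> its meaning.
  Comparing the two expansions along w = g - g' yields |w|^2 \<le> 2 e |w| for every e > 0.\<close>

lemma has_gradient_unique:
  assumes g: "has_gradient n f x g" and g': "has_gradient n f x g'" and x: "x \<in> carrier_vec n"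
  shows "g = g'"
proof -
  have carr: "g \<in> carrier_vec n" "g' \<in> carrier_vec n" using g g' by (auto simp: has_gradient_def)
  define w where "w = g - g'"
  have w: "w \<in> carrier_vec n" using carr by (simp add: w_def)
  have "vnorm w \<le> 0 + 2 * e" if e: "e > 0" for e
  proof -
    obtain r where r: "r > 0" "\<And>y. y \<in> carrier_vec n \<Longrightarrow> vnorm (y - x) < r \<Longrightarrow>
      \<bar>f y - f x - g \<bullet> (y - x)\<bar> \<le> e * vnorm (y - x)"
      using g e unfolding has_gradient_def by blast
    obtain s where s: "s > 0" "\<And>y. y \<in> carrier_vec n \<Longrightarrow> vnorm (y - x) < s \<Longrightarrow>
      \<bar>f y - f x - g' \<bullet> (y - x)\<bar> \<le> e * vnorm (y - x)"
      using g' e unfolding has_gradient_def by blast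
    \<comment> \<open>The summand 1 keeps the quotient defined if w = 0; the factor 2 puts the test
      point strictly inside both radii.\<close>
    define q where "q = min r s / (2 * (vnorm w + 1))"
    have w1: "vnorm w + 1 > 0" using vnorm_nonneg[of w] by simp
    have q: "q > 0" using r s w1 by (simp add: q_def)
    have d: "(x + q \<cdot>\<^sub>v w) - x = q \<cdot>\<^sub>v w" using x w by (intro eq_vecI) auto
    have y: "x + q \<cdot>\<^sub>v w \<in> carrier_vec n" using x w by simp
    have half: "m / (2 * c) * c = m / 2" if "c > 0" for m c :: real
      using that by simp
    have "q * vnorm w \<le> q * (vnorm w + 1)" using q by simp
    also have "\<dots> = min r s / 2" unfolding q_def by (rule half[OF w1])
    also have "min r s > 0" using r(1) s(1) by simp
    then have "min r s / 2 < min r s" by linarith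
    finally have "vnorm ((x + q \<cdot>\<^sub>v w) - x) < min r s" unfolding d using q by (simp add: vnorm_smult)
    then have "\<bar>f (x + q \<cdot>\<^sub>v w) - f x - g \<bullet> (q \<cdot>\<^sub>v w)\<bar> \<le> e * (q * vnorm w)"
      "\<bar>f (x + q \<cdot>\<^sub>v w) - f x - g' \<bullet> (q \<cdot>\<^sub>v w)\<bar> \<le> e * (q * vnorm w)"
      using r(2)[OF y] s(2)[OF y] q unfolding d by (auto simp: vnorm_smult)
    then have "g \<bullet> (q \<cdot>\<^sub>v w) - g' \<bullet> (q \<cdot>\<^sub>v w) \<le> 2 * (e * (q * vnorm w))" by linarith
    moreover have "g \<bullet> (q \<cdot>\<^sub>v w) - g' \<bullet> (q \<cdot>\<^sub>v w) = q * (w \<bullet> w)"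
      using carr w by (simp add: w_def minus_scalar_prod_distrib[of _ n] right_diff_distrib)
    moreover have "w \<bullet> w = vnorm w * vnorm w"
      by (simp add: vnorm_def scalar_prod_self_nonneg)
    ultimately have "q * (vnorm w * vnorm w) \<le> q * (2 * e * vnorm w)" by (simp add: mult_ac)
    then have "vnorm w * vnorm w \<le> 2 * e * vnorm w" using q by simp
    then show ?thesis
      using vnorm_nonneg[of w] e by (cases "vnorm w = 0") (auto simp: mult_le_cancel_right)
  qed
  then have "vnorm w \<le> 0 + e" if "e > 0" for e
    using that by (metis field_sum_of_halves half_gt_zero mult_2)
  then have "vnorm w \<le> 0" using field_le_epsilon by blast
  then have "w = 0\<^sub>v n" using vnorm_eq_0[OF w] vnorm_nonneg[of w] by simp
  then have "g' + w = g'" using carr by simp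
  moreover have "g' + w = g" using carr by (intro eq_vecI) (auto simp: w_def)
  ultimately show ?thesis by simp
qed

lemma gradient_eq:
  assumes "vec_differentiable n f x"
  shows "has_gradient n f x (gradient n f x)"
proof -
  obtain g where "x \<in> carrier_vec n" "has_gradient n f x g"
    using assms by (auto simp: vec_differentiable_def)
  then show ?thesis
    unfolding gradient_def using has_gradient_unique by (metis (mono_tags, lifting) theI)
qed

text \<open>The ball of radius |x| around x misses the origin, so on it p is a smooth expression
  without the case of zero variance.\<close>

lemma vec_differentiable_prob_le:
  assumes wf: "well_formed P" and pd: "covar_pos_def P"
    and x: "x \<in> carrier_vec (ndim P)" and x0: "x \<noteq> 0\<^sub>v (ndim P)"
  shows "vec_differentiable (ndim P) (prob_le P) x"
proof -
  let ?n = "ndim P"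
  let ?f = "\<lambda>y. \<Sum>k<ncomp P. weight P k *
     std_normal_cdf ((bound P + -1 * (mean P k \<bullet> y)) * inverse (sqrt (y \<bullet> (covar P k *\<^sub>v y))))"
  have "vec_differentiable ?n ?f x"
  proof (intro vec_differentiable_sum vec_differentiable_cmult x finite_lessThan)
    fix k assume "k \<in> {..<ncomp P}"
    then have S: "positive_definite ?n (covar P k)" and m: "mean P k \<in> carrier_vec ?n"
      using wf pd by (auto simp: well_formed_def covar_pos_def_def)
    have carr: "covar P k \<in> carrier_mat ?n ?n" using S by (simp add: positive_definite_def)
    have pos: "x \<bullet> (covar P k *\<^sub>v x) > 0" using S x x0 by (simp add: positive_definite_def)
    have D: "((\<lambda>v. inverse (sqrt v)) has_real_derivative - (inverse (sqrt v) * (inverse (sqrt v) / 2) * inverse (sqrt v))) (at v)"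
      if "v > 0" for v :: real
      using that by (auto intro!: derivative_eq_intros)
    have "vec_differentiable ?n (\<lambda>y. (bound P + -1 * (mean P k \<bullet> y)) * inverse (sqrt (y \<bullet> (covar P k *\<^sub>v y)))) x"
      by (intro vec_differentiable_mult vec_differentiable_add vec_differentiable_cmult
          vec_differentiable_linear vec_differentiable_const x m)
         (rule vec_differentiable_compose[OF vec_differentiable_quad[OF carr x] D[OF pos]])
    then show "vec_differentiable ?n (\<lambda>y. std_normal_cdf ((bound P + -1 * (mean P k \<bullet> y)) * inverse (sqrt (y \<bullet> (covar P k *\<^sub>v y))))) x"
      by (rule vec_differentiable_compose[OF _ std_normal_cdf_deriv])
  qed
  moreover have "vnorm x > 0" using vnorm_eq_0[OF x] vnorm_nonneg[of x] x0 by linarith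
  moreover have "?f y = prob_le P y" if y: "y \<in> carrier_vec ?n" and near: "vnorm (y - x) < vnorm x" for y
  proof -
    have "y \<noteq> 0\<^sub>v ?n"
    proof
      assume "y = 0\<^sub>v ?n"
      then have "y - x = - 1 \<cdot>\<^sub>v x" using x by (intro eq_vecI) auto
      then show False using near by (simp add: vnorm_smult)
    qed
    then have "y \<bullet> (covar P k *\<^sub>v y) \<noteq> 0" if "k < ncomp P" for k
      using positive_definite_quad_eq_0_iff[of ?n "covar P k" y] y pd that by (simp add: covar_pos_def_def)
    then show ?thesis
      unfolding prob_le_eq_mix_val[OF wf pd y] mix_val_def comp_val_def
      by (intro sum.cong) (auto simp: divide_inverse)
  qed
  ultimately show ?thesis by (rule vec_differentiable_transform)
qed

section \<open>Constraint qualification and right continuity of the optimal value\<close>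

context vec_space
begin

text \<open>Finite-dimensional duality by induction on the list: a vector found for the tail is
  corrected to annihilate the head as well.\<close>

lemma exists_separating_vec:
  assumes "set ws \<subseteq> carrier_vec n" "g \<in> carrier_vec n" "g \<notin> span (set ws)"
  shows "\<exists>v\<in>carrier_vec n. (\<forall>w\<in>set ws. w \<bullet> v = 0) \<and> g \<bullet> v \<noteq> 0"
  using assms
proof (induction ws arbitrary: g)
  case Nil
  then have "g \<noteq> 0\<^sub>v n" by (simp add: span_empty)
  then obtain i where "i < n" "g $ i \<noteq> 0" using Nil by (metis carrier_vecD eq_vecI index_zero_vec)
  then show ?case using Nil by (intro bexI[of _ "unit_vec n i"]) auto
next
  case (Cons w ws)
  have w: "w \<in> carrier_vec n" and ws: "set ws \<subseteq> carrier_vec n" using Cons.prems by auto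
  note g = Cons.prems(2)
  have sub: "span (set ws) \<subseteq> span (set (w # ws))" by (rule span_is_monotone) auto
  then have "g \<notin> span (set ws)" using Cons.prems(3) by blast
  then obtain v where v: "v \<in> carrier_vec n" "\<forall>x\<in>set ws. x \<bullet> v = 0" "g \<bullet> v \<noteq> 0"
    using Cons.IH[OF ws g] by blast
  show ?case
  proof (cases "w \<bullet> v = 0")
    case True
    then show ?thesis using v by (intro bexI[of _ v]) auto
  next
    case False
    \<comment> \<open>\<open>c\<close> makes \<open>u\<close> orthogonal to \<open>v\<close>, and
      \<open>k\<close> below makes v' - k v orthogonal to \<open>w\<close>; with these choices
      \<open>g\<close> pairs with v' - k v exactly as \<open>u\<close> does with v'.\<close>
    define c where "c = (g \<bullet> v) / (w \<bullet> v)"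
    define u where "u = g - c \<cdot>\<^sub>v w"
    have u: "u \<in> carrier_vec n" using g w by (simp add: u_def)
    have "u \<notin> span (set ws)"
    proof
      assume "u \<in> span (set ws)"
      then have 1: "u \<in> span (set (w # ws))" using sub by blast
      have "c \<cdot>\<^sub>v w \<in> span (set (w # ws))"
        by (intro smult_in_span span_mem) (use Cons.prems(1) in auto)
      then have "u + c \<cdot>\<^sub>v w \<in> span (set (w # ws))"
        using 1 Cons.prems(1) by (intro span_add1)
      moreover have "u + c \<cdot>\<^sub>v w = g" using g w by (intro eq_vecI) (auto simp: u_def)
      ultimately show False using Cons.prems(3) by simp
    qed
    then obtain v' where v': "v' \<in> carrier_vec n" "\<forall>x\<in>set ws. x \<bullet> v' = 0" "u \<bullet> v' \<noteq> 0"
      using Cons.IH[OF ws u] by blast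
    define k where "k = (w \<bullet> v') / (w \<bullet> v)"
    have dot: "x \<bullet> (v' - k \<cdot>\<^sub>v v) = x \<bullet> v' - k * (x \<bullet> v)" if "x \<in> carrier_vec n" for x
      using that v(1) v'(1) by (simp add: scalar_prod_minus_distrib[of _ n])
    have "u \<bullet> v' = g \<bullet> v' - c * (w \<bullet> v')"
      using g w v'(1) by (simp add: u_def minus_scalar_prod_distrib[of _ n])
    then have "g \<bullet> (v' - k \<cdot>\<^sub>v v) = u \<bullet> v'"
      unfolding dot[OF g] by (simp add: k_def c_def)
    moreover have "w \<bullet> (v' - k \<cdot>\<^sub>v v) = 0" unfolding dot[OF w] using False by (simp add: k_def)
    moreover have "x \<bullet> (v' - k \<cdot>\<^sub>v v) = 0" if "x \<in> set ws" for x
      using that ws v v' by (subst dot) auto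
    ultimately show ?thesis
      using v v' by (intro bexI[of _ "v' - k \<cdot>\<^sub>v v"]) auto
  qed
qed

end

text \<open>The form in which the constraint qualification is used, with \<open>g\<close> the
  gradient of p and \<open>ws\<close> the other active gradients. Distinctness keeps
  \<open>g\<close> out of \<open>ws\<close>; a change of sign makes the product positive.\<close>

lemma lin_indpt_family_separating:
  assumes "lin_indpt_family n (ws @ [g])" "set ws \<subseteq> carrier_vec n" "g \<in> carrier_vec n"
  obtains v where "v \<in> carrier_vec n" "\<And>w. w \<in> set ws \<Longrightarrow> w \<bullet> v = 0" "g \<bullet> v > 0"
proof -
  interpret vec_space "TYPE(real)" n .
  have "g \<notin> set ws" and ind: "lin_indpt (insert g (set ws))"
    using assms(1) by (auto simp: lin_indpt_family_def)
  then have "insert g (set ws) - {g} = set ws" by auto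
  then have "g \<notin> span (set ws)"
    using lindep_span[of "insert g (set ws)"] ind assms by auto
  then obtain v where v: "v \<in> carrier_vec n" "\<forall>w\<in>set ws. w \<bullet> v = 0" "g \<bullet> v \<noteq> 0"
    using exists_separating_vec[OF assms(2,3)] by blast
  show thesis
  proof (cases "g \<bullet> v > 0")
    case True
    then show thesis using that v by blast
  next
    case False
    then have "g \<bullet> (- 1 \<cdot>\<^sub>v v) > 0" using v assms by simp
    moreover have "w \<bullet> (- 1 \<cdot>\<^sub>v v) = 0" if "w \<in> set ws" for w
      using v that assms(2) by auto
    ultimately show thesis using that[of "- 1 \<cdot>\<^sub>v v"] v by auto
  qed
qed

lemma has_gradient_increasing:
  assumes g: "has_gradient n f x g" and x: "x \<in> carrier_vec n" and v: "v \<in> carrier_vec n" and pos: "g \<bullet> v > 0"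
  shows "\<forall>\<^sub>F s in at_right 0. f (x + s \<cdot>\<^sub>v v) > f x"
proof -
  define c where "c = vnorm v + 1"
  have c: "c > 0" using vnorm_nonneg[of v] by (simp add: c_def)
  \<comment> \<open>With this \<open>e\<close> the remainder uses up at most half of the linear
    increase s * (g.v).\<close>
  define e where "e = (g \<bullet> v) / (2 * c)"
  have e: "e > 0" using pos c by (simp add: e_def)
  have gc: "g \<in> carrier_vec n" using g by (simp add: has_gradient_def)
  obtain r where r: "r > 0" "\<And>y. y \<in> carrier_vec n \<Longrightarrow> vnorm (y - x) < r \<Longrightarrow>
      \<bar>f y - f x - g \<bullet> (y - x)\<bar> \<le> e * vnorm (y - x)"
    using g e unfolding has_gradient_def by blast
  have "\<forall>\<^sub>F s in at_right 0. s \<in> {0<..<r / c}"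
    using r c by (intro eventually_at_right_real) simp
  then show ?thesis
  proof eventually_elim
    case (elim s)
    have d: "(x + s \<cdot>\<^sub>v v) - x = s \<cdot>\<^sub>v v" using x v by (intro eq_vecI) auto
    have N: "vnorm (s \<cdot>\<^sub>v v) = s * vnorm v" using elim by (simp add: vnorm_smult)
    have le: "s * vnorm v \<le> s * c" using elim by (simp add: c_def)
    also have "\<dots> < r" using elim c by (simp add: field_simps)
    finally have "\<bar>f (x + s \<cdot>\<^sub>v v) - f x - g \<bullet> (s \<cdot>\<^sub>v v)\<bar> \<le> e * (s * vnorm v)"
      using r(2)[of "x + s \<cdot>\<^sub>v v"] x v unfolding d N by simp
    also have "\<dots> \<le> e * (s * c)" by (rule mult_left_mono[OF le less_imp_le[OF e]])
    also have "\<dots> = s * (g \<bullet> v) / 2" using c by (simp add: e_def)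
    finally have "f (x + s \<cdot>\<^sub>v v) - f x \<ge> g \<bullet> (s \<cdot>\<^sub>v v) - s * (g \<bullet> v) / 2" by linarith
    moreover have "g \<bullet> (s \<cdot>\<^sub>v v) = s * (g \<bullet> v)" using gc v by simp
    moreover have "s * (g \<bullet> v) > 0" using elim pos by simp
    ultimately show ?case by linarith
  qed
qed

lemma tendsto_linear_along:
  fixes c x v :: "real vec"
  assumes "c \<in> carrier_vec n" "x \<in> carrier_vec n" "v \<in> carrier_vec n"
  shows "((\<lambda>s. c \<bullet> (x + s \<cdot>\<^sub>v v)) \<longlongrightarrow> c \<bullet> x) (at_right 0)"
proof -
  have "((\<lambda>s. c \<bullet> x + s * (c \<bullet> v)) \<longlongrightarrow> c \<bullet> x + 0 * (c \<bullet> v)) (at_right 0)"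
    by (intro tendsto_intros)
  then show ?thesis
    using assms by (simp add: scalar_prod_add_distrib[of _ n])
qed

text \<open>Equations and active inequalities keep their values along \<open>v\<close>; the finitely
  many inactive ones have slack for small steps.\<close>

lemma polytope_along_direction:
  assumes wf: "well_formed P" and x: "x \<in> polytope P" and v: "v \<in> carrier_vec (ndim P)"
    and eq: "\<And>w. w \<in> set (rows (eq_mat P)) \<Longrightarrow> w \<bullet> v = 0"
    and active: "\<And>i. i < dim_row (ineq_mat P) \<Longrightarrow> row (ineq_mat P) i \<bullet> x = ineq_rhs P $ i \<Longrightarrow>
      row (ineq_mat P) i \<bullet> v = 0"
  shows "\<forall>\<^sub>F s in at_right 0. x + s \<cdot>\<^sub>v v \<in> polytope P"
proof -
  let ?A = "ineq_mat P" and ?m = "dim_row (ineq_mat P)"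
  have xc: "x \<in> carrier_vec (ndim P)" and Hx: "eq_mat P *\<^sub>v x = eq_rhs P" and Ax: "?A *\<^sub>v x \<ge> ineq_rhs P"
    using x by (auto simp: polytope_def)
  have dims: "dim_col (eq_mat P) = ndim P" "dim_vec (eq_rhs P) = dim_row (eq_mat P)"
    "dim_col ?A = ndim P" "dim_vec (ineq_rhs P) = ?m"
    using wf by (auto simp: well_formed_def)
  have rowc: "row ?A i \<in> carrier_vec (ndim P)" for i using dims by (auto simp: row_def)
  have "\<forall>\<^sub>F s in at_right 0. row ?A i \<bullet> (x + s \<cdot>\<^sub>v v) \<ge> ineq_rhs P $ i" if i: "i < ?m" for i
  proof (cases "row ?A i \<bullet> x = ineq_rhs P $ i")
    case True
    have "row ?A i \<bullet> (x + s \<cdot>\<^sub>v v) = ineq_rhs P $ i" for s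
      using active[OF i True] True rowc[of i] xc v by (simp add: scalar_prod_add_distrib[of _ "ndim P"])
    then show ?thesis by simp
  next
    case False
    moreover have "row ?A i \<bullet> x \<ge> ineq_rhs P $ i"
      using Ax i dims by (auto simp: less_eq_vec_def)
    ultimately have less: "ineq_rhs P $ i < row ?A i \<bullet> x" by simp
    show ?thesis
      by (rule eventually_mono[OF order_tendstoD(1)[OF tendsto_linear_along[OF rowc xc v] less]]) simp
  qed
  then have "\<forall>\<^sub>F s in at_right 0. \<forall>i\<in>{..<?m}. row ?A i \<bullet> (x + s \<cdot>\<^sub>v v) \<ge> ineq_rhs P $ i"
    by (intro eventually_ball_finite) auto
  then show ?thesis
  proof eventually_elim
    case (elim s)
    have "row (eq_mat P) i \<bullet> (x + s \<cdot>\<^sub>v v) = eq_rhs P $ i" if i: "i < dim_row (eq_mat P)" for i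
    proof -
      have "row (eq_mat P) i \<bullet> v = 0" using eq i by (auto simp: rows_def)
      moreover have "row (eq_mat P) i \<bullet> x = eq_rhs P $ i"
        using Hx i by (metis index_mult_mat_vec)
      moreover have "row (eq_mat P) i \<in> carrier_vec (ndim P)" using dims by (auto simp: row_def)
      ultimately show ?thesis using xc v by (simp add: scalar_prod_add_distrib[of _ "ndim P"])
    qed
    then have "eq_mat P *\<^sub>v (x + s \<cdot>\<^sub>v v) = eq_rhs P"
      using dims by (intro eq_vecI) auto
    moreover have "?A *\<^sub>v (x + s \<cdot>\<^sub>v v) \<ge> ineq_rhs P"
      using elim dims by (auto simp: less_eq_vec_def)
    ultimately show ?case using xc v by (simp add: polytope_def)
  qed
qed

text \<open>The point found is feasible for all levels slightly above \<theta> and so bounds their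
  optimal values from above.\<close>

lemma value_right_continuous:
  assumes wf: "well_formed P" and pd: "covar_pos_def P" and licq: "licq P"
    and opt: "opt_sol P (level P) xs" and e: "e > 0"
  shows "\<exists>x\<in>polytope P. prob_le P x > level P \<and> cost P \<bullet> x < cost P \<bullet> xs + e"
proof -
  have X: "xs \<in> polytope P" and ge: "prob_le P xs \<ge> level P"
    using opt by (auto simp: opt_sol_def is_arg_min_def chance_set_def)
  show ?thesis
  proof (cases "prob_le P xs = level P")
    case False
    then show ?thesis using X ge e by (intro bexI[of _ xs]) auto
  next
    case True
    let ?n = "ndim P" and ?g = "gradient (ndim P) (prob_le P) xs"
    have xc: "xs \<in> carrier_vec ?n" using X by (simp add: polytope_def)
    \<comment> \<open>At the origin p is 0 or 1, while here it equals \<theta>, strictly in between;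
      so p is differentiable at \<open>xs\<close>.\<close>
    have "xs \<noteq> 0\<^sub>v ?n"
      using True prob_le_eq_mix_val[OF wf pd xc] mix_val_zero[OF wf pd] wf
      by (auto simp: well_formed_def split: if_splits)
    then have grad: "has_gradient ?n (prob_le P) xs ?g"
      by (intro gradient_eq vec_differentiable_prob_le wf pd xc)
    then have gc: "?g \<in> carrier_vec ?n" by (simp add: has_gradient_def)
    define ws where "ws = rows (eq_mat P) @ map (row (ineq_mat P))
         (filter (\<lambda>i. row (ineq_mat P) i \<bullet> xs = ineq_rhs P $ i) [0..<dim_row (ineq_mat P)])"
    have "lin_indpt_family ?n (ws @ [?g])"
      using licq[unfolded licq_def, rule_format, OF opt] True by (simp add: active_gradients_def ws_def)
    moreover have "set ws \<subseteq> carrier_vec ?n"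
      using wf by (auto simp: ws_def well_formed_def rows_def row_def)
    ultimately obtain v where v: "v \<in> carrier_vec ?n" "\<And>w. w \<in> set ws \<Longrightarrow> w \<bullet> v = 0" "?g \<bullet> v > 0"
      using lin_indpt_family_separating gc by metis
    have "\<forall>\<^sub>F s in at_right 0. xs + s \<cdot>\<^sub>v v \<in> polytope P"
      by (rule polytope_along_direction[OF wf X v(1)]) (auto intro!: v(2) simp: ws_def)
    moreover have "\<forall>\<^sub>F s in at_right 0. prob_le P (xs + s \<cdot>\<^sub>v v) > prob_le P xs"
      by (rule has_gradient_increasing[OF grad xc v(1,3)])
    moreover have "\<forall>\<^sub>F s in at_right 0. cost P \<bullet> (xs + s \<cdot>\<^sub>v v) < cost P \<bullet> xs + e"
      using wf e by (intro order_tendstoD(2)[OF tendsto_linear_along[OF _ xc v(1)]]) (auto simp: well_formed_def)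
    ultimately have "\<forall>\<^sub>F s in at_right 0. xs + s \<cdot>\<^sub>v v \<in> polytope P \<and>
        prob_le P (xs + s \<cdot>\<^sub>v v) > prob_le P xs \<and> cost P \<bullet> (xs + s \<cdot>\<^sub>v v) < cost P \<bullet> xs + e"
      by eventually_elim auto
    then obtain s where "xs + s \<cdot>\<^sub>v v \<in> polytope P \<and>
        prob_le P (xs + s \<cdot>\<^sub>v v) > prob_le P xs \<and> cost P \<bullet> (xs + s \<cdot>\<^sub>v v) < cost P \<bullet> xs + e"
      using eventually_happens'[OF trivial_limit_at_right_real] by blast
    then show ?thesis using True by auto
  qed
qed

section \<open>The approximation problems\<close>

lemma cdf_like_le_hi:
  assumes "cdf_like F hi lo"
  shows "F z \<le> hi"
proof (rule tendsto_lowerbound)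
  show "(F \<longlongrightarrow> hi) at_top" using assms by (simp add: cdf_like_def)
  show "\<forall>\<^sub>F y in at_top. F z \<le> F y"
    by (rule eventually_mono[OF eventually_ge_at_top[of z]]) (use assms in \<open>simp add: cdf_like_def monoD\<close>)
qed simp

lemma cdf_like_lo_nonneg:
  assumes "cdf_like F hi lo"
  shows "0 \<le> lo"
proof (rule tendsto_lowerbound)
  show "(F \<longlongrightarrow> lo) at_bot" using assms by (simp add: cdf_like_def)
  show "\<forall>\<^sub>F y in at_bot. 0 \<le> F y" using assms by (simp add: cdf_like_def)
qed simp

text \<open>Away from the origin, \<lambda> is the standard deviation and monotonicity of
  \<open>F\<close> makes the largest admissible z the best. At the origin \<lambda> = 0: the
  constraint on z collapses to b \<ge> 0 and z is free, so \<open>F\<close> must attain its supremum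
  \<open>hi\<close> there.\<close>

lemma approx_feasible_iff:
  assumes F: "cdf_like F hi lo" and wf: "well_formed P" and pd: "covar_pos_def P"
    and attains: "\<exists>z. F z = hi" and lo: "lo < level P"
  shows "(\<exists>z \<zeta> l. (x, z, \<zeta>, l) \<in> approx_feasible P F) \<longleftrightarrow> x \<in> polytope P \<and> mix_val F hi lo P x \<ge> level P"
    (is "?L \<longleftrightarrow> ?R")
proof -
  let ?n = "ndim P" and ?K = "ncomp P"
  let ?v = "\<lambda>k. x \<bullet> (covar P k *\<^sub>v x)" and ?a = "\<lambda>k. mean P k \<bullet> x"
  have S: "positive_definite ?n (covar P k)" and m: "mean P k \<in> carrier_vec ?n" and w: "weight P k \<ge> 0"
    if "k < ?K" for k
    using wf pd that by (auto simp: well_formed_def covar_pos_def_def)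
  have Fm: "mono F" and F01: "0 \<le> F z" "F z \<le> 1" for z
    using F by (auto simp: cdf_like_def)
  show ?thesis
  proof
    assume ?L
    then obtain z \<zeta> l where feas: "(x, z, \<zeta>, l) \<in> approx_feasible P F" by blast
    then have X: "x \<in> polytope P" by (simp add: approx_feasible_def)
    then have xc: "x \<in> carrier_vec ?n" by (simp add: polytope_def)
    have "\<zeta> $ k \<le> comp_val F hi lo (bound P) (?a k) (?v k)" if k: "k < ?K" for k
    proof -
      have c: "\<zeta> $ k \<le> F (z $ k)" "z $ k * l $ k \<le> bound P - x \<bullet> mean P k" "?v k = (l $ k)\<^sup>2" "0 \<le> l $ k"
        using feas k by (auto simp: approx_feasible_def)
      have comm: "x \<bullet> mean P k = ?a k" by (rule comm_scalar_prod[OF xc m[OF k]])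
      show ?thesis
      proof (cases "?v k = 0")
        case True
        then have "x = 0\<^sub>v ?n" using positive_definite_quad_eq_0_iff[OF S[OF k] xc] by simp
        then have "bound P \<ge> 0" using c m[OF k] True by simp
        then show ?thesis
          using True c(1) cdf_like_le_hi[OF F, of "z $ k"] by (simp add: comp_val_def)
      next
        case False
        then have l: "l $ k > 0" "sqrt (?v k) = l $ k" using c by auto
        have "z $ k \<le> (bound P - ?a k) / sqrt (?v k)"
          unfolding l(2) using l(1) c(2) comm by (simp add: pos_le_divide_eq)
        then show ?thesis using c(1) monoD[OF Fm] False by (fastforce simp: comp_val_def)
      qed
    qed
    then have "(\<Sum>k<?K. weight P k * \<zeta> $ k) \<le> mix_val F hi lo P x"
      unfolding mix_val_def using w by (intro sum_mono mult_left_mono) auto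
    then show ?R using feas X by (auto simp: approx_feasible_def)
  next
    assume R: ?R
    then have xc: "x \<in> carrier_vec ?n" by (simp add: polytope_def)
    obtain zh where zh: "F zh = hi" using attains by blast
    define zf where "zf k = (if ?v k = 0 then zh else (bound P - ?a k) / sqrt (?v k))" for k
    have zero: "x = 0\<^sub>v ?n \<and> bound P \<ge> 0" if "k < ?K" "?v k = 0" for k
    proof -
      have x0: "x = 0\<^sub>v ?n" using positive_definite_quad_eq_0_iff[OF S[OF that(1)] xc] that by simp
      \<comment> \<open>With b < 0 the reduced constraint at the origin would say \<open>lo\<close>
        \<ge> \<theta>.\<close>
      then show ?thesis using R lo mix_val_zero[OF wf pd, of F hi lo] by (auto split: if_splits)
    qed
    have val: "F (zf k) = comp_val F hi lo (bound P) (?a k) (?v k)" if "k < ?K" for k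
      using zero[OF that] zh by (auto simp: comp_val_def zf_def)
    have v: "?v k \<ge> 0" if "k < ?K" for k
      by (rule positive_definite_quad_nonneg[OF S[OF that] xc])
    have "level P \<le> (\<Sum>k<?K. weight P k * F (zf k))"
      using R val by (simp add: mix_val_def)
    moreover have "zf k * sqrt (?v k) \<le> bound P - x \<bullet> mean P k" if k: "k < ?K" for k
      unfolding comm_scalar_prod[OF xc m[OF k]] using zero[OF k] m[OF k] v[OF k]
      by (auto simp: zf_def)
    ultimately have "(x, vec ?K zf, vec ?K (\<lambda>k. F (zf k)), vec ?K (\<lambda>k. sqrt (?v k))) \<in> approx_feasible P F"
      using R v F01 by (simp add: approx_feasible_def)
    then show ?L by blast
  qed
qed

lemma exists_approx_opt:
  assumes F: "cdf_like F hi lo" and wf: "well_formed P" and pd: "covar_pos_def P" and away: "away_from_origin P"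
    and attains: "\<exists>z. F z = hi" and lo: "lo < level P"
    and ne: "x0 \<in> polytope P" "mix_val F hi lo P x0 \<ge> level P"
  obtains x where "approx_opt_x P F x" "x \<in> polytope P" "mix_val F hi lo P x \<ge> level P"
    "\<And>y. y \<in> polytope P \<Longrightarrow> mix_val F hi lo P y \<ge> level P \<Longrightarrow> cost P \<bullet> x \<le> cost P \<bullet> y"
proof -
  note iff = approx_feasible_iff[OF F wf pd attains lo]
  obtain x where x: "x \<in> polytope P" "mix_val F hi lo P x \<ge> level P"
    and min: "\<And>y. y \<in> polytope P \<Longrightarrow> mix_val F hi lo P y \<ge> level P \<Longrightarrow> cost P \<bullet> x \<le> cost P \<bullet> y"
    using exists_min_cost[OF F wf pd away ne] by (auto simp: is_arg_min_def not_less)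
  obtain z \<zeta> l where "(x, z, \<zeta>, l) \<in> approx_feasible P F" using iff[of x] x by blast
  moreover have "cost P \<bullet> x \<le> cost P \<bullet> x'" if "(x', z', \<zeta>', l') \<in> approx_feasible P F" for x' z' \<zeta>' l'
    using iff[of x'] that min[of x'] by blast
  ultimately have "approx_opt_x P F x"
    unfolding approx_opt_x_def is_arg_min_def by (fastforce simp: not_less)
  then show thesis using that x min by blast
qed

theorem theorem2:
  shows "\<exists>C::real. C > 0 \<and>
    (\<forall>(P::ccp) (xs :: real \<Rightarrow> real vec).
      well_formed P \<longrightarrow>
      covar_pos_def P \<longrightarrow>
      feasible_nearby P \<longrightarrow>
      away_from_origin P \<longrightarrow>
      licq P \<longrightarrow>
      (\<forall>t. (\<exists>x. opt_sol P t x) \<longrightarrow> opt_sol P t (xs t)) \<longrightarrow>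
      (\<forall>\<tau>hat>0. \<exists>\<tau> L\<^sub>O R\<^sub>O z\<^sub>O L\<^sub>I R\<^sub>I z\<^sub>I.
        0 < \<tau> \<and> \<tau> \<le> \<tau>hat \<and> \<tau> < 1 \<and>
        valid_breakpoints L\<^sub>O R\<^sub>O z\<^sub>O \<and>
        real (L\<^sub>O + R\<^sub>O + 1) \<le> C * sqrt (1 / \<tau> * ln (1 / \<tau>)) \<and>
        valid_breakpoints L\<^sub>I R\<^sub>I z\<^sub>I \<and>
        real (L\<^sub>I + R\<^sub>I + 1) \<le> C * sqrt (1 / \<tau> * ln (1 / \<tau>)) \<and>
        (\<forall>t\<in>{level P - \<tau>, level P, level P + \<tau>}. opt_sol P t (xs t)) \<and>
        (\<exists>x\<^sub>O x\<^sub>I.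
          approx_opt_x P (upper_cdf L\<^sub>O R\<^sub>O z\<^sub>O) x\<^sub>O \<and>
          approx_opt_x P (lower_cdf L\<^sub>I R\<^sub>I z\<^sub>I) x\<^sub>I \<and>
          tol_optimal P (xs (level P)) \<tau>hat x\<^sub>O \<and>
          tol_optimal P (xs (level P)) \<tau>hat x\<^sub>I \<and>
          \<bar>cost P \<bullet> x\<^sub>I - cost P \<bullet> x\<^sub>O\<bar>
            \<le> \<bar>cost P \<bullet> xs (level P + \<tau>) - cost P \<bullet> xs (level P - \<tau>)\<bar> \<and>
          \<bar>cost P \<bullet> xs (level P + \<tau>) - cost P \<bullet> xs (level P - \<tau>)\<bar> \<le> \<tau>hat)))"
proof (rule exI[of _ 6], rule conjI, simp, intro allI impI)
  fix P :: ccp and xs :: "real \<Rightarrow> real vec" and \<tau>hat :: real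
  assume wf: "well_formed P" and pd: "covar_pos_def P" and near: "feasible_nearby P"
    and away: "away_from_origin P" and licq: "licq P"
    and xs: "\<forall>t. (\<exists>x. opt_sol P t x) \<longrightarrow> opt_sol P t (xs t)" and \<tau>hat: "\<tau>hat > 0"
  let ?\<theta> = "level P" and ?c = "\<lambda>x. cost P \<bullet> x" and ?p = "mix_val std_normal_cdf 1 0 P"
  note chance = chance_set_eq[OF wf pd]
  obtain \<rho> where \<rho>: "\<rho> > 0" "\<And>t. t \<in> {?\<theta> - \<rho>..?\<theta> + \<rho>} \<Longrightarrow> chance_set P t \<noteq> {}"
    using near by (auto simp: feasible_nearby_def)
  have opt: "opt_sol P t (xs t)" if "t \<in> {?\<theta> - \<rho>..?\<theta> + \<rho>}" for t
    using xs exists_opt_sol[OF wf pd away \<rho>(2)[OF that]] by blast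
  have \<theta>: "?\<theta> > 0" using wf by (simp add: well_formed_def)
  have opt0: "opt_sol P ?\<theta> (xs ?\<theta>)" using \<rho>(1) by (intro opt) auto
  \<comment> \<open>Half the tolerance for each side, so that the whole cost window stays within
    it.\<close>
  have e: "\<tau>hat / 2 > 0" using \<tau>hat by simp
  obtain t0 where t0: "t0 < ?\<theta>" "\<And>s x. s > t0 \<Longrightarrow> x \<in> chance_set P s \<Longrightarrow> ?c x > ?c (xs ?\<theta>) - \<tau>hat / 2"
    using value_left_continuous[OF wf pd away opt0 e] by blast
  obtain x1 where x1: "x1 \<in> polytope P" "prob_le P x1 > ?\<theta>" "?c x1 < ?c (xs ?\<theta>) + \<tau>hat / 2"
    using value_right_continuous[OF wf pd licq opt0 e] by blast
  \<comment> \<open>In this order: the tolerance itself, the range of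
    \<open>exists_breakpoints\<close>, the levels known to be feasible, \<open>lo\<close> <
    \<theta>, \<theta> - \<tau> > \<open>t0\<close>, and feasibility of \<open>x1\<close> at level
    \<theta> + \<tau>.\<close>
  define \<tau> where "\<tau> = Min {\<tau>hat, exp (- 1), \<rho>, ?\<theta> / 2, (?\<theta> - t0) / 2, prob_le P x1 - ?\<theta>}"
  have "\<tau> > 0" using \<tau>hat \<rho>(1) \<theta> t0(1) x1(2) by (simp add: \<tau>_def)
  have \<tau>: "\<tau> \<le> \<tau>hat" "\<tau> \<le> exp (- 1)" "\<tau> \<le> \<rho>" "\<tau> \<le> ?\<theta> / 2" "\<tau> \<le> (?\<theta> - t0) / 2" "\<tau> \<le> prob_le P x1 - ?\<theta>"
    unfolding \<tau>_def by (rule Min_le, simp, simp)+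
  have "exp (- 1 :: real) < 1" by simp
  then have "\<tau> < 1" using \<tau>(2) by linarith
  let ?m = "xs (?\<theta> - \<tau>)" and ?q = "xs (?\<theta> + \<tau>)"
  have optm: "opt_sol P (?\<theta> - \<tau>) ?m" and optq: "opt_sol P (?\<theta> + \<tau>) ?q"
    using \<open>\<tau> > 0\<close> \<tau>(3) by (auto intro!: opt)
  have feas: "x \<in> polytope P \<and> ?p x \<ge> t" if "opt_sol P t x" for t x
    using that chance by (auto simp: opt_sol_def is_arg_min_def)
  have best: "?c x \<le> ?c y" if "opt_sol P t x" "y \<in> polytope P" "?p y \<ge> t" for t x y
    using that chance by (auto simp: opt_sol_def is_arg_min_def not_less)
  have lower: "?c ?m > ?c (xs ?\<theta>) - \<tau>hat / 2"
    using feas[OF optm] t0(1) \<tau>(5) by (intro t0(2)[of "?\<theta> - \<tau>"]) (auto simp: chance)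
  have "x1 \<in> chance_set P (?\<theta> + \<tau>)" using x1 \<tau>(6) by (simp add: chance_set_def)
  then have upper: "?c ?q < ?c (xs ?\<theta>) + \<tau>hat / 2"
    using best[OF optq, of x1] x1(3) chance by fastforce
  obtain N z lo hi where z: "valid_breakpoints N N z" "real (N + N + 1) \<le> 6 * sqrt (1 / \<tau> * ln (1 / \<tau>))"
    and O: "cdf_like (upper_cdf N N z) 1 lo" "lo \<le> \<tau>" "\<exists>x. upper_cdf N N z x = 1"
      "\<And>x. std_normal_cdf x \<le> upper_cdf N N z x" "\<And>x. upper_cdf N N z x \<le> std_normal_cdf x + \<tau>"
    and I: "cdf_like (lower_cdf N N z) hi 0" "1 - \<tau> \<le> hi" "hi \<le> 1" "\<exists>x. lower_cdf N N z x = hi"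
      "\<And>x. lower_cdf N N z x \<le> std_normal_cdf x" "\<And>x. std_normal_cdf x \<le> lower_cdf N N z x + \<tau>"
    using exists_breakpoints[OF \<open>\<tau> > 0\<close> \<tau>(2)] by metis
  let ?o = "mix_val (upper_cdf N N z) 1 lo P" and ?i = "mix_val (lower_cdf N N z) hi 0 P"
  have po: "?p x \<le> ?o x + 0" for x
    using O(4) cdf_like_lo_nonneg[OF O(1)] by (intro mix_val_mono[OF wf]) auto
  have op: "?o x \<le> ?p x + \<tau>" for x
    using O(2,5) \<open>\<tau> > 0\<close> by (intro mix_val_mono[OF wf]) auto
  have ip: "?i x \<le> ?p x + 0" for x
    using I(3,5) by (intro mix_val_mono[OF wf]) auto
  have pi: "?p x \<le> ?i x + \<tau>" for x
    using I(2,6) \<open>\<tau> > 0\<close> by (intro mix_val_mono[OF wf]) auto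
  have lo: "lo < ?\<theta>" using O(2) \<tau>(4) \<theta> by linarith
  have neO: "?o (xs ?\<theta>) \<ge> ?\<theta>" using feas[OF opt0] po[of "xs ?\<theta>"] by linarith
  obtain xO where xO: "approx_opt_x P (upper_cdf N N z) xO" "xO \<in> polytope P" "?o xO \<ge> ?\<theta>"
    and minO: "\<And>y. y \<in> polytope P \<Longrightarrow> ?o y \<ge> ?\<theta> \<Longrightarrow> ?c xO \<le> ?c y"
    by (rule exists_approx_opt[OF O(1) wf pd away O(3) lo conjunct1[OF feas[OF opt0]] neO]) blast
  \<comment> \<open>The optimal point at the raised level \<theta> + \<tau> is feasible for the
    inner problem, which therefore has a solution.\<close>
  have neI: "?i ?q \<ge> ?\<theta>" using feas[OF optq] pi[of ?q] by linarith
  obtain xI where xI: "approx_opt_x P (lower_cdf N N z) xI" "xI \<in> polytope P" "?i xI \<ge> ?\<theta>"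
    and minI: "\<And>y. y \<in> polytope P \<Longrightarrow> ?i y \<ge> ?\<theta> \<Longrightarrow> ?c xI \<le> ?c y"
    by (rule exists_approx_opt[OF I(1) wf pd away I(4) \<theta> conjunct1[OF feas[OF optq]] neI]) blast
  have pO: "?p xO \<ge> ?\<theta> - \<tau>" using op[of xO] xO(3) by linarith
  have pI: "?p xI \<ge> ?\<theta>" using ip[of xI] xI(3) by linarith
  have 1: "?c ?m \<le> ?c xO" by (rule best[OF optm xO(2) pO])
  have 2: "?c xO \<le> ?c (xs ?\<theta>)" by (rule minO[OF conjunct1[OF feas[OF opt0]] neO])
  have 3: "?c (xs ?\<theta>) \<le> ?c xI" by (rule best[OF opt0 xI(2) pI])
  have 4: "?c xI \<le> ?c ?q" by (rule minI[OF conjunct1[OF feas[OF optq]] neI])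
  have tol: "tol_optimal P (xs ?\<theta>) \<tau>hat x"
    if "x \<in> polytope P" "?p x \<ge> ?\<theta> - \<tau>" "\<bar>?c (xs ?\<theta>) - ?c x\<bar> \<le> \<tau>hat" for x
    using that \<tau>(1) prob_le_eq_mix_val[OF wf pd, of x]
    by (auto simp: tol_optimal_def tol_feasible_def polytope_def)
  have "tol_optimal P (xs ?\<theta>) \<tau>hat xO" using 1 2 lower \<tau>hat by (intro tol xO pO) linarith
  moreover have "tol_optimal P (xs ?\<theta>) \<tau>hat xI" using 3 4 upper \<tau>hat pI \<open>\<tau> > 0\<close> by (intro tol xI) linarith+
  moreover have "\<bar>?c xI - ?c xO\<bar> \<le> \<bar>?c ?q - ?c ?m\<bar>" using 1 2 3 4 by linarith
  moreover have "\<bar>?c ?q - ?c ?m\<bar> \<le> \<tau>hat" using 1 2 3 4 lower upper by linarith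
  moreover have "\<forall>t\<in>{?\<theta> - \<tau>, ?\<theta>, ?\<theta> + \<tau>}. opt_sol P t (xs t)" using optm optq opt0 by blast
  ultimately show "\<exists>\<tau> L\<^sub>O R\<^sub>O z\<^sub>O L\<^sub>I R\<^sub>I z\<^sub>I.
        0 < \<tau> \<and> \<tau> \<le> \<tau>hat \<and> \<tau> < 1 \<and>
        valid_breakpoints L\<^sub>O R\<^sub>O z\<^sub>O \<and>
        real (L\<^sub>O + R\<^sub>O + 1) \<le> 6 * sqrt (1 / \<tau> * ln (1 / \<tau>)) \<and>
        valid_breakpoints L\<^sub>I R\<^sub>I z\<^sub>I \<and>
        real (L\<^sub>I + R\<^sub>I + 1) \<le> 6 * sqrt (1 / \<tau> * ln (1 / \<tau>)) \<and>
        (\<forall>t\<in>{level P - \<tau>, level P, level P + \<tau>}. opt_sol P t (xs t)) \<and>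
        (\<exists>x\<^sub>O x\<^sub>I.
          approx_opt_x P (upper_cdf L\<^sub>O R\<^sub>O z\<^sub>O) x\<^sub>O \<and>
          approx_opt_x P (lower_cdf L\<^sub>I R\<^sub>I z\<^sub>I) x\<^sub>I \<and>
          tol_optimal P (xs (level P)) \<tau>hat x\<^sub>O \<and>
          tol_optimal P (xs (level P)) \<tau>hat x\<^sub>I \<and>
          \<bar>cost P \<bullet> x\<^sub>I - cost P \<bullet> x\<^sub>O\<bar>
            \<le> \<bar>cost P \<bullet> xs (level P + \<tau>) - cost P \<bullet> xs (level P - \<tau>)\<bar> \<and>
          \<bar>cost P \<bullet> xs (level P + \<tau>) - cost P \<bullet> xs (level P - \<tau>)\<bar> \<le> \<tau>hat)"
    \<comment> \<open>One symmetric array serves both problems.\<close>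
    using \<open>\<tau> > 0\<close> \<tau>(1) \<open>\<tau> < 1\<close> z xO(1) xI(1)
    by (intro exI[of _ \<tau>] exI[of _ N] exI[of _ z]) blast
qed

end
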